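(* Let $G$ be a subgroup of $S_{\mathbb N}$ and $\mathbb A\in\{\mathscr O_b,\mathscr W,\mathscr A,\mathscr H^\infty\}$. Then $\pi_G(\mathscr D_{\mathbb A})\subset\mathscr D_{\mathbb A}$, and the induced map $\pi_G:\mathbb A\to\mathbb A$ is a continuous linear projection of norm one onto $\mathbb A_G$, satisfying $$\pi_G(fg)=f\,\pi_G(g)\quad\text{for all } f\in\mathbb A_G,\ g\in\mathbb A.$$
   Context: $\mathscr D$ is the algebra of formal Dirichlet series $\sum_{n\ge1}a_nn^{-s}$, $a_n\in\mathbb C$. Let $\mathbb C_+=\{\mathrm{Re}\,s>0\}$. $\mathscr O_u$ is the algebra of holomorphic functions on $\mathbb C_+$ that are limits of Dirichlet series converging uniformly on each half-plane $\{\mathrm{Re}\,s>\varepsilon\}$, $\varepsilon>0$ (the series is unique). $\Omega(n)$ is the number of prime factors of $n$ counted with multiplicity; for $f\in\mathscr O_u$ with Dirichlet series $\sum a_nn^{-s}$ and $r\in(0,1)$, $f_r\in\mathscr O_u$ is the limit function of $\sum r^{\Omega(n)}a_nn^{-s}$. - $\mathscr O_b$: all $f\in\mathscr O_u$ with $f_r$ bounded on $\mathbb C_+$ for every $r\in(0,1)$; a Fréchet algebra with seminorms $P_r(f)=\sup_{\mathbb C_+}|f_r|$, $0<r<1$. - $\mathscr H^\infty$: bounded functions in $\mathscr O_u$, with the supremum norm. - $\mathscr W$: limit functions of Dirichlet series with $\sum|a_n|<\infty$, with norm $\|f\|_1=\sum|a_n|$. - $\mathscr A$: the closure of $\mathscr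 W$ in $\mathscr H^\infty$, with the supremum norm. $\mathscr D_{\mathbb A}\subset\mathscr D$ is the set of Dirichlet series converging to functions in $\mathbb A$; a map of $\mathscr D_{\mathbb A}$ to itself induces a map of $\mathbb A$ denoted by the same symbol. $S_{\mathbb N}$ is the group of all permutations of $\mathbb N=\{1,2,\dots\}$; $p_1<p_2<\cdots$ are the primes, $\nu_p(n)$ the exponent of $p$ in $n$. For $\sigma\in S_{\mathbb N}$, $\hat\sigma(n)=\prod_ip_{\sigma(i)}^{\nu_{p_i}(n)}$, and $S_\sigma(\sum a_nn^{-s})=\sum a_{\hat\sigma^{-1}(n)}n^{-s}$. $\mathbb A_G$ is the closed subalgebra of $f\in\mathbb A$ whose Dirichlet series $D$ satisfies $S_\sigma(D)=D$ for all $\sigma\in G$. $\mathbb O\subset\mathbb N$ is the union of all finite orbits of $G$ on $\mathbb N$; $\mathbb N_{\mathbb O}$ is the multiplicative unital semigroup generated by the primes $p_i$, $i\in\mathbb O$. For $n\in\mathbb N_{\mathbb O}$, $\mathsf O(n)=\{\hat\sigma(n):\sigma\in G\}$ (a finite set). The linear map $\pi_G:\mathscr D\to\mathscr D$ is $\pi_G(\sum a_nn^{-s})=\sum b_nn^{-s}$, where $b_n=0$ for $n\notin\mathbb N_{\mathbb O}$ and $b_n=\frac1{|\mathsf O(n)|}\sum_{k\in\mathsf O(n)}a_k$ for $n\in\mathbb N_{\mathbb O}$. For $\mathbb A=\mathscr O_b$, "norm one" means that for all $r\in(0,1)$ and $f\in\mathscr O_b$, $P_r(\pi_G(f))\le P_r(f)$,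 with equality for $f$ of constant value one. *)

theory Defs
  imports
    "HOL-Complex_Analysis.Complex_Analysis"
    "HOL-Computational_Algebra.Primes"
    "HOL-Library.Infinite_Set"
    "HOL-Algebra.Bij"
begin

definition right_half_plane :: "complex set" where
  "right_half_plane = {s. Re s > 0}"

text \<open>
  A formal Dirichlet series is its coefficient sequence. Coefficients are indexed by \<open>n \<ge> 1\<close>;
  the value at \<open>0\<close> is pinned to \<open>0\<close> so that equality of series is equality of functions.
\<close>

definition formal_dirichlet_series :: "(nat \<Rightarrow> complex) set" where
  "formal_dirichlet_series = {a. a 0 = 0}"

text \<open>
  Functions on the right half-plane are represented by their extension by \<open>0\<close> to all complex
  numbers, so that equality on the half-plane is equality in HOL and the pointwise operations
  preserve the representation. The sums below formally start at \<open>n = 0\<close>, where the term is \<open>0\<close>.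
\<close>

definition dirichlet_function :: "(nat \<Rightarrow> complex) \<Rightarrow> complex \<Rightarrow> complex" where
  "dirichlet_function a =
     (\<lambda>s. if s \<in> right_half_plane then \<Sum>n. a n * of_nat n powr (- s) else 0)"

definition has_dirichlet_series :: "(complex \<Rightarrow> complex) \<Rightarrow> (nat \<Rightarrow> complex) \<Rightarrow> bool" where
  "has_dirichlet_series f a \<longleftrightarrow>
     a \<in> formal_dirichlet_series \<and>
     (\<forall>s. s \<notin> right_half_plane \<longrightarrow> f s = 0) \<and>
     (\<forall>\<epsilon>>0. uniform_limit {s. Re s > \<epsilon>} (\<lambda>N s. \<Sum>n<N. a n * of_nat n powr (- s)) f sequentially)"

definition O_u :: "(complex \<Rightarrow> complex) set" where
  "O_u = {f. f holomorphic_on right_half_plane \<and> (\<exists>a. has_dirichlet_series f a)}"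

text \<open>Meaningful on \<open>O_u\<close>, where the Dirichlet series of a function is unique.\<close>

definition dirichlet_coeffs :: "(complex \<Rightarrow> complex) \<Rightarrow> nat \<Rightarrow> complex" where
  "dirichlet_coeffs f = (THE a. has_dirichlet_series f a)"

definition bigomega :: "nat \<Rightarrow> nat" where
  "bigomega n = size (prime_factorization n)"

text \<open>
  The function \<open>f\<^sub>r\<close>. For \<open>0 < r < 1\<close> and \<open>f\<close> in \<open>O_u\<close> the dilated series again converges
  uniformly on each half-plane, so the infinite sum in \<^const>\<open>dirichlet_function\<close> is its limit.
\<close>

definition dilate :: "real \<Rightarrow> (complex \<Rightarrow> complex) \<Rightarrow> complex \<Rightarrow> complex" where
  "dilate r f = dirichlet_function (\<lambda>n. of_real r ^ bigomega n * dirichlet_coeffs f n)"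

definition sup_norm :: "(complex \<Rightarrow> complex) \<Rightarrow> real" where
  "sup_norm f = (SUP s\<in>right_half_plane. norm (f s))"

definition dilate_seminorm :: "real \<Rightarrow> (complex \<Rightarrow> complex) \<Rightarrow> real" where
  "dilate_seminorm r f = sup_norm (dilate r f)"

definition l1_norm :: "(complex \<Rightarrow> complex) \<Rightarrow> real" where
  "l1_norm f = (\<Sum>n. norm (dirichlet_coeffs f n))"

text \<open>The topology on \<open>X\<close> with the open balls of the seminorms in \<open>Q\<close> as a subbasis.\<close>

definition seminorm_topology ::
  "(complex \<Rightarrow> complex) set \<Rightarrow> ((complex \<Rightarrow> complex) \<Rightarrow> real) set \<Rightarrow> (complex \<Rightarrow> complex) topology" where
  "seminorm_topology X Q =
     topology_generated_by
       {{g \<in> X. q (\<lambda>s. g s - f s) < e} | f q e. f \<in> X \<and> q \<in> Q \<and> e > 0}"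

definition O_b :: "(complex \<Rightarrow> complex) set" where
  "O_b = {f \<in> O_u. \<forall>r\<in>{0<..<1}. bounded (dilate r f ` right_half_plane)}"

definition H_inf :: "(complex \<Rightarrow> complex) set" where
  "H_inf = {f \<in> O_u. bounded (f ` right_half_plane)}"

definition Wiener_Dirichlet :: "(complex \<Rightarrow> complex) set" where
  "Wiener_Dirichlet =
     {dirichlet_function a | a. a \<in> formal_dirichlet_series \<and> summable (\<lambda>n. norm (a n))}"

definition A_alg :: "(complex \<Rightarrow> complex) set" where
  "A_alg = seminorm_topology H_inf {sup_norm} closure_of Wiener_Dirichlet"

datatype dirichlet_algebra = Alg_O_b | Alg_W | Alg_A | Alg_H_inf

primrec elems :: "dirichlet_algebra \<Rightarrow> (complex \<Rightarrow> complex) set" where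
  "elems Alg_O_b = O_b"
| "elems Alg_W = Wiener_Dirichlet"
| "elems Alg_A = A_alg"
| "elems Alg_H_inf = H_inf"

primrec seminorms :: "dirichlet_algebra \<Rightarrow> ((complex \<Rightarrow> complex) \<Rightarrow> real) set" where
  "seminorms Alg_O_b = dilate_seminorm ` {0<..<1}"
| "seminorms Alg_W = {l1_norm}"
| "seminorms Alg_A = {sup_norm}"
| "seminorms Alg_H_inf = {sup_norm}"

definition alg_topology :: "dirichlet_algebra \<Rightarrow> (complex \<Rightarrow> complex) topology" where
  "alg_topology \<AA> = seminorm_topology (elems \<AA>) (seminorms \<AA>)"

definition one_fun :: "complex \<Rightarrow> complex" where
  "one_fun = (\<lambda>s. if s \<in> right_half_plane then 1 else 0)"

text \<open>
  For a normed algebra the operator norm is rendered as in the library's \<^const>\<open>onorm\<close>, which is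
  not directly applicable because the algebras are sets, not types.
\<close>

definition operator_norm_eq_one ::
  "(complex \<Rightarrow> complex) set \<Rightarrow> ((complex \<Rightarrow> complex) \<Rightarrow> real) \<Rightarrow>
   ((complex \<Rightarrow> complex) \<Rightarrow> complex \<Rightarrow> complex) \<Rightarrow> bool" where
  "operator_norm_eq_one X q T \<longleftrightarrow>
     bdd_above ((\<lambda>f. q (T f) / q f) ` X) \<and> (SUP f\<in>X. q (T f) / q f) = 1"

primrec has_norm_one ::
  "dirichlet_algebra \<Rightarrow> ((complex \<Rightarrow> complex) \<Rightarrow> complex \<Rightarrow> complex) \<Rightarrow> bool" where
  "has_norm_one Alg_O_b T \<longleftrightarrow>
     (\<forall>r\<in>{0<..<1}. (\<forall>f\<in>O_b. dilate_seminorm r (T f) \<le> dilate_seminorm r f) \<and>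
        dilate_seminorm r (T one_fun) = dilate_seminorm r one_fun)"
| "has_norm_one Alg_W T \<longleftrightarrow> operator_norm_eq_one Wiener_Dirichlet l1_norm T"
| "has_norm_one Alg_A T \<longleftrightarrow> operator_norm_eq_one A_alg sup_norm T"
| "has_norm_one Alg_H_inf T \<longleftrightarrow> operator_norm_eq_one H_inf sup_norm T"

definition series_of :: "dirichlet_algebra \<Rightarrow> (nat \<Rightarrow> complex) set" where
  "series_of \<AA> = {a. \<exists>f\<in>elems \<AA>. has_dirichlet_series f a}"

text \<open>The \<open>i\<close>-th prime for \<open>i \<ge> 1\<close>, so \<open>nth_prime 1 = 2\<close>.\<close>

definition nth_prime :: "nat \<Rightarrow> nat" where
  "nth_prime i = enumerate {p. prime p} (i - 1)"

text \<open>
  Only arguments \<open>n \<ge> 1\<close> matter (at \<open>0\<close> the index set is infinite), and \<open>\<sigma>\<close> is only evaluated at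
  positive indices, so that elements of \<^term>\<open>BijGroup {1::nat..}\<close>, which are unspecified at \<open>0\<close>, can
  be used directly.
\<close>

definition perm_hat :: "(nat \<Rightarrow> nat) \<Rightarrow> nat \<Rightarrow> nat" where
  "perm_hat \<sigma> n =
     (\<Prod>i | i \<ge> 1 \<and> nth_prime i dvd n. nth_prime (\<sigma> i) ^ multiplicity (nth_prime i) n)"

definition perm_series :: "(nat \<Rightarrow> nat) \<Rightarrow> (nat \<Rightarrow> complex) \<Rightarrow> nat \<Rightarrow> complex" where
  "perm_series \<sigma> a = (\<lambda>n. if n = 0 then 0 else a (inv_into {1..} (perm_hat \<sigma>) n))"

definition invariant_elems :: "dirichlet_algebra \<Rightarrow> (nat \<Rightarrow> nat) set \<Rightarrow> (complex \<Rightarrow> complex) set" where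
  "invariant_elems \<AA> G =
     {f \<in> elems \<AA>. \<forall>\<sigma>\<in>G. perm_series \<sigma> (dirichlet_coeffs f) = dirichlet_coeffs f}"

definition finite_orbit_points :: "(nat \<Rightarrow> nat) set \<Rightarrow> nat set" where
  "finite_orbit_points G = \<Union>{X. finite X \<and> (\<exists>i\<ge>1. X = {\<sigma> i | \<sigma>. \<sigma> \<in> G})}"

inductive_set finite_orbit_numbers :: "(nat \<Rightarrow> nat) set \<Rightarrow> nat set" for G where
  one: "1 \<in> finite_orbit_numbers G"
| prime: "i \<in> finite_orbit_points G \<Longrightarrow> nth_prime i \<in> finite_orbit_numbers G"
| mult: "m \<in> finite_orbit_numbers G \<Longrightarrow> n \<in> finite_orbit_numbers G \<Longrightarrow>
           m * n \<in> finite_orbit_numbers G"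

definition number_orbit :: "(nat \<Rightarrow> nat) set \<Rightarrow> nat \<Rightarrow> nat set" where
  "number_orbit G n = {perm_hat \<sigma> n | \<sigma>. \<sigma> \<in> G}"

definition proj_series :: "(nat \<Rightarrow> nat) set \<Rightarrow> (nat \<Rightarrow> complex) \<Rightarrow> nat \<Rightarrow> complex" where
  "proj_series G a =
     (\<lambda>n. if n \<in> finite_orbit_numbers G
          then (\<Sum>k\<in>number_orbit G n. a k) / of_nat (card (number_orbit G n)) else 0)"

definition proj :: "(nat \<Rightarrow> nat) set \<Rightarrow> (complex \<Rightarrow> complex) \<Rightarrow> complex \<Rightarrow> complex" where
  "proj G f = dirichlet_function (proj_series G (dirichlet_coeffs f))"

end

theory Submission
  imports Defs "HOL-Probability.Sinc_Integral"
begin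

text \<open>
  The four algebras are read off from coefficient sequences. A function in \<open>H_inf\<close> with coefficients
  \<open>a\<close> acts by Dirichlet convolution on square summable sequences, and its supremum norm is the norm of
  this operator (\<open>bounded_iff_mult_bound\<close>); \<open>mult_bound M a\<close> says that this norm is at most
  \<open>M\<close>. The matrix of the operator has entries \<open>a (m / n)\<close>, so three operations are visibly
  contractive in this picture although they are not in terms of functions on the half-plane: permuting the primes only
  permutes rows and columns (\<open>mult_bound_map\<close>), forming means preserves bounds
  (\<open>mult_bound_average\<close>) and a completely multiplicative weight with values in \<open>[0, 1]\<close> is a
  Schur multiplier given by a Gram matrix of unit vectors (\<open>mult_bound_completely_multiplicative\<close>).

  The projection is composed of these. The indicator function of the numbers with finite orbit is completely
  multiplicative, and on finitely many such numbers the orbit average is a mean over finitely many elements of the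
  group (\<open>average_finite\<close>). Hence the projection is contractive for the supremum norm
  (\<open>mult_bound_orbit_average\<close>), and for the seminorms of \<open>O_b\<close> because it commutes with
  dilations. For absolutely convergent series the same means give the estimate directly, and \<open>A_alg\<close> is
  handled by continuity. Invariant functions are fixed because coefficients of a multiplier are square summable, so an
  invariant sequence vanishes on infinite orbits (\<open>invariant_vanishes\<close>); the module identity is a
  computation with convolutions (\<open>average_conv\<close>).

  The link between coefficients and functions is the analytic part, because series have to converge uniformly on every
  smaller half-plane. From functions to coefficients, integration against a Fejer kernel makes the characters of
  distinct integers orthogonal (\<open>dirichlet_poly_mult_bound\<close>). From coefficients to functions, testing the
  operator on characters restricted to a Folner sequence of sets of divisors gives Dirichlet polynomials with the same
  bound (\<open>mult_bound_folner_mean\<close>); Bohr's logarithmic bound for their partial sums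
  (\<open>truncation_bound_exists\<close>) and summation by parts then give uniform convergence
  (\<open>dseries_of_mult_bounded\<close>).
\<close>

section \<open>The Fejer kernel\<close>

definition fejer_kernel :: "real \<Rightarrow> real \<Rightarrow> real" where
  "fejer_kernel B t = (1 - cos (B * t)) / t\<^sup>2"

text \<open>The constant is \<open>\<pi>\<close>; the estimates below rest on its positivity.\<close>
definition fejer_const :: real where
  "fejer_const = (\<integral>t. fejer_kernel 1 t \<partial>lborel)"

lemma fejer_kernel_nonneg: "fejer_kernel B t \<ge> 0"
  by (simp add: fejer_kernel_def)

lemma fejer_kernel_measurable [measurable]: "fejer_kernel B \<in> borel_measurable borel"
  unfolding fejer_kernel_def by measurable

lemma integrable_inverse_one_plus_square: "integrable lborel (\<lambda>x::real. inverse (1 + x\<^sup>2))"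
  using integrable_inverse_1_plus_square by (simp add: set_integrable_def)

lemma one_minus_cos_le: "1 - cos (x::real) \<le> x\<^sup>2 / 2"
proof -
  have "1 - cos x = 2 * (sin (x/2))\<^sup>2"
    using cos_double_sin[of "x/2"] by simp
  also have "\<bar>sin (x/2)\<bar> \<le> \<bar>x/2\<bar>" by (rule abs_sin_x_le_abs_x)
  then have "(sin (x/2))\<^sup>2 \<le> (x/2)\<^sup>2" by (simp only: abs_le_square_iff)
  then have "2 * (sin (x/2))\<^sup>2 \<le> x\<^sup>2 / 2" by (simp add: power_divide)
  finally show ?thesis .
qed

lemma fejer_kernel_1_bound: "fejer_kernel 1 t \<le> 4 * inverse (1 + t\<^sup>2)"
proof (cases "\<bar>t\<bar> \<le> 1")
  case True
  then have t2: "t\<^sup>2 \<le> 1" by (simp add: abs_square_le_1)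
  have "fejer_kernel 1 t \<le> 1 / 2"
  proof (cases "t = 0")
    case False
    then show ?thesis using one_minus_cos_le[of t]
      by (simp add: fejer_kernel_def field_simps)
  qed (simp add: fejer_kernel_def)
  also have "\<dots> \<le> 4 * inverse (1 + t\<^sup>2)"
    using t2 by (simp add: field_simps add_pos_nonneg)
  finally show ?thesis .
next
  case False
  then have t2: "t\<^sup>2 > 1" by (metis abs_square_le_1 not_le)
  have "fejer_kernel 1 t \<le> 2 / t\<^sup>2"
    unfolding fejer_kernel_def using cos_ge_minus_one[of t] by (intro divide_right_mono) auto
  also have "\<dots> \<le> 4 * inverse (1 + t\<^sup>2)"
    using t2 by (simp add: divide_simps add_pos_nonneg)
  finally show ?thesis .
qed

lemma integrable_fejer_kernel_1: "integrable lborel (fejer_kernel 1)"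
  by (rule Bochner_Integration.integrable_bound[where f = "\<lambda>t. 4 * inverse (1 + t\<^sup>2)"])
     (auto simp: integrable_inverse_one_plus_square fejer_kernel_nonneg
           intro!: integrable_mult_right order_trans[OF fejer_kernel_1_bound])

lemma fejer_const_pos: "fejer_const > 0"
proof -
  define m where "m = (1 - cos 1) / (4::real)"
  have c1: "cos 1 < (1::real)"
    using cos_monotone_0_pi[of 0 1] pi_gt3 by simp
  then have m: "m > 0" by (simp add: m_def)
  have "m = (\<integral>t. m * indicator {1..2} t \<partial>(lborel::real measure))" by simp
  also have "\<dots> \<le> fejer_const"
    unfolding fejer_const_def
  proof (rule integral_mono)
    show "m * indicator {1..2} t \<le> fejer_kernel 1 t" for t :: real
    proof (cases "t \<in> {1..2}")
      case True
      then have "cos t \<le> cos 1" using pi_gt3 by (intro cos_monotone_0_pi_le) auto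
      moreover have "t\<^sup>2 \<le> 4" using True power_mono[of t 2 2] by auto
      moreover have "t\<^sup>2 > 0" using True by auto
      ultimately have "(1 - cos 1) / 4 \<le> (1 - cos t) / t\<^sup>2"
        using c1 by (intro frac_le) auto
      then show ?thesis using True by (simp add: m_def fejer_kernel_def)
    qed (simp add: fejer_kernel_nonneg)
  qed (auto intro: integrable_fejer_kernel_1)
  finally show ?thesis using m by simp
qed

text \<open>The substitution \<open>t \<mapsto> B t\<close> turns \<open>fejer_kernel 1\<close> into a multiple of
  \<open>fejer_kernel B\<close>, so the integral is homogeneous in \<open>B\<close>. This scaling replaces any contour
  integration or Fourier inversion.\<close>
lemma has_integral_fejer_kernel:
  "has_bochner_integral lborel (fejer_kernel B) (fejer_const * \<bar>B\<bar>)"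
proof (cases "B = 0")
  case True
  then show ?thesis by (simp add: fejer_kernel_def[abs_def] has_bochner_integral_zero)
next
  case False
  have "has_bochner_integral lborel (fejer_kernel 1) fejer_const"
    unfolding fejer_const_def using integrable_fejer_kernel_1 by (rule has_bochner_integral_integrable)
  then have "has_bochner_integral lborel (\<lambda>t. fejer_kernel 1 (0 + B * t)) (fejer_const /\<^sub>R \<bar>B\<bar>)"
    using lborel_has_bochner_integral_real_affine_iff[OF False] by blast
  then have "has_bochner_integral lborel (\<lambda>t. B\<^sup>2 * fejer_kernel 1 (0 + B * t)) (B\<^sup>2 * (fejer_const /\<^sub>R \<bar>B\<bar>))"
    by (intro has_bochner_integral_mult_right)
  moreover have "B\<^sup>2 * (fejer_const /\<^sub>R \<bar>B\<bar>) = fejer_const * \<bar>B\<bar>"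
    using False by (auto simp: field_simps power2_eq_square abs_if)
  moreover have "(\<lambda>t. B\<^sup>2 * fejer_kernel 1 (0 + B * t)) = fejer_kernel B"
    using False by (auto simp: fejer_kernel_def fun_eq_iff power_mult_distrib)
  ultimately show ?thesis by (simp only:)
qed

text \<open>Expanding the product of cosines writes \<open>fejer_kernel B t * cos (t * u)\<close> as a combination of the kernels
  with parameters \<open>B + u\<close>, \<open>B - u\<close> and \<open>u\<close>, whose integrals are known by
  scaling; the sine part is odd. The transform is thus a tent supported on \<open>[-B, B]\<close>.\<close>
lemma fejer_fourier:
  assumes "B \<ge> 0"
  shows "has_bochner_integral lborel (\<lambda>t. of_real (fejer_kernel B t) * cis (- (t * u)))
           (of_real (fejer_const * max 0 (B - \<bar>u\<bar>)))"
proof -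
  have re: "has_bochner_integral lborel (\<lambda>t. fejer_kernel B t * cos (t * u))
              (fejer_const * max 0 (B - \<bar>u\<bar>))"
  proof -
    have "has_bochner_integral lborel
       (\<lambda>t. fejer_kernel (B + u) t / 2 + fejer_kernel (B - u) t / 2 - fejer_kernel u t)
       (fejer_const * \<bar>B + u\<bar> / 2 + fejer_const * \<bar>B - u\<bar> / 2 - fejer_const * \<bar>u\<bar>)"
      by (intro has_bochner_integral_add has_bochner_integral_diff has_bochner_integral_divide
                has_integral_fejer_kernel)
    moreover have "fejer_const * \<bar>B + u\<bar> / 2 + fejer_const * \<bar>B - u\<bar> / 2 - fejer_const * \<bar>u\<bar>
       = fejer_const * max 0 (B - \<bar>u\<bar>)"
      using assms by (auto simp: max_def abs_if field_simps)
    moreover have "fejer_kernel (B + u) t / 2 + fejer_kernel (B - u) t / 2 - fejer_kernel u t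
       = fejer_kernel B t * cos (t * u)" for t
      unfolding fejer_kernel_def
      by (cases "t = 0") (auto simp: distrib_right left_diff_distrib cos_add cos_diff field_simps)
    ultimately show ?thesis by simp
  qed
  have int: "integrable lborel (fejer_kernel B)"
    using has_integral_fejer_kernel by (rule integrable.intros)
  have im: "has_bochner_integral lborel (\<lambda>t. fejer_kernel B t * sin (t * u)) 0"
  proof -
    have "integrable lborel (\<lambda>t. fejer_kernel B t * sin (t * u))"
      by (rule Bochner_Integration.integrable_bound[OF int])
         (auto simp: abs_mult intro!: mult_left_le)
    moreover have "(\<integral>t. fejer_kernel B t * sin (t * u) \<partial>lborel) =
        - (\<integral>t. fejer_kernel B t * sin (t * u) \<partial>lborel)"
      by (subst lborel_integral_real_affine[where c = "-1" and t = 0])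
         (simp_all add: fejer_kernel_def)
    ultimately show ?thesis by (simp add: has_bochner_integral_iff)
  qed
  have "has_bochner_integral lborel
      (\<lambda>t. of_real (fejer_kernel B t * cos (t * u)) - \<i> * of_real (fejer_kernel B t * sin (t * u)))
      (of_real (fejer_const * max 0 (B - \<bar>u\<bar>)) - \<i> * of_real 0)"
    by (intro has_bochner_integral_diff has_bochner_integral_mult_right has_bochner_integral_of_real re im)
  moreover have "of_real (fejer_kernel B t * cos (t * u)) - \<i> * of_real (fejer_kernel B t * sin (t * u))
     = of_real (fejer_kernel B t) * cis (- (t * u))" for t
    by (simp add: complex_eq_iff)
  ultimately show ?thesis by simp
qed

text \<open>A pointwise inequality between generalised trigonometric polynomials survives integration against the nonnegative
  kernel, which multiplies each frequency \<open>u\<close> by the tent \<open>max 0 (B - \<bar>u\<bar>)\<close>.\<close>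
lemma exp_sum_fejer_dominated:
  fixes z :: "'i \<Rightarrow> complex" and w :: "'k \<Rightarrow> complex"
  assumes "B \<ge> 0"
    and dom: "\<And>t. norm (\<Sum>j\<in>J. z j * cis (- (t * u j))) \<le> Re (\<Sum>k\<in>K. w k * cis (- (t * v k)))"
  shows "norm (\<Sum>j\<in>J. z j * of_real (max 0 (B - \<bar>u j\<bar>))) \<le> Re (\<Sum>k\<in>K. w k * of_real (max 0 (B - \<bar>v k\<bar>)))"
proof -
  have gen: "has_bochner_integral lborel
      (\<lambda>t. of_real (fejer_kernel B t) * (\<Sum>j\<in>J. z j * cis (- (t * u j))))
      (of_real fejer_const * (\<Sum>j\<in>J. z j * of_real (max 0 (B - \<bar>u j\<bar>))))"
    for J :: "'j set" and z :: "'j \<Rightarrow> complex" and u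
  proof -
    have "has_bochner_integral lborel
        (\<lambda>t. \<Sum>j\<in>J. z j * (of_real (fejer_kernel B t) * cis (- (t * u j))))
        (\<Sum>j\<in>J. z j * of_real (fejer_const * max 0 (B - \<bar>u j\<bar>)))"
      by (intro has_bochner_integral_sum has_bochner_integral_mult_right fejer_fourier assms)
    then show ?thesis by (simp add: sum_distrib_left mult_ac)
  qed
  let ?f = "\<lambda>t. of_real (fejer_kernel B t) * (\<Sum>j\<in>J. z j * cis (- (t * u j)))"
  let ?g = "\<lambda>t. of_real (fejer_kernel B t) * (\<Sum>k\<in>K. w k * cis (- (t * v k)))"
  have f: "integrable lborel ?f" "integral\<^sup>L lborel ?f = of_real fejer_const * (\<Sum>j\<in>J. z j * of_real (max 0 (B - \<bar>u j\<bar>)))"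
    using gen[of z u J] by (auto simp: has_bochner_integral_iff)
  have g: "integrable lborel ?g" "integral\<^sup>L lborel ?g = of_real fejer_const * (\<Sum>k\<in>K. w k * of_real (max 0 (B - \<bar>v k\<bar>)))"
    using gen[of w v K] by (auto simp: has_bochner_integral_iff)
  have "norm (integral\<^sup>L lborel ?f) \<le> (\<integral>t. norm (?f t) \<partial>lborel)"
    by (rule integral_norm_bound)
  also have "\<dots> \<le> (\<integral>t. Re (?g t) \<partial>lborel)"
  proof (rule integral_mono)
    fix t
    have "fejer_kernel B t * norm (\<Sum>j\<in>J. z j * cis (- (t * u j)))
       \<le> fejer_kernel B t * Re (\<Sum>k\<in>K. w k * cis (- (t * v k)))"
      by (intro mult_left_mono dom fejer_kernel_nonneg)
    then show "norm (?f t) \<le> Re (?g t)"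
      by (simp add: norm_mult fejer_kernel_nonneg del: Re_sum)
  next
    show "integrable lborel (\<lambda>t. norm (?f t))" using f(1) by (rule integrable_norm)
    show "integrable lborel (\<lambda>t. Re (?g t))" using g(1) by (rule integrable_Re)
  qed
  also have "\<dots> = Re (integral\<^sup>L lborel ?g)"
    by (rule integral_Re) (rule g)
  finally have "fejer_const * norm (\<Sum>j\<in>J. z j * of_real (max 0 (B - \<bar>u j\<bar>)))
      \<le> fejer_const * Re (\<Sum>k\<in>K. w k * of_real (max 0 (B - \<bar>v k\<bar>)))"
    unfolding f(2) g(2) using fejer_const_pos by (simp add: norm_mult del: Re_sum)
  then show ?thesis using fejer_const_pos by simp
qed

section \<open>Multiplier bounds and Dirichlet polynomials\<close>

abbreviation mult_form :: "nat set \<Rightarrow> (nat \<Rightarrow> complex) \<Rightarrow> (nat \<Rightarrow> complex) \<Rightarrow> (nat \<Rightarrow> complex) \<Rightarrow> complex" where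
  "mult_form I a x y \<equiv> \<Sum>m\<in>I. \<Sum>n\<in>I. (if n dvd m then a (m div n) else 0) * x n * y m"

abbreviation energy :: "nat set \<Rightarrow> (nat \<Rightarrow> complex) \<Rightarrow> (nat \<Rightarrow> complex) \<Rightarrow> real" where
  "energy I x y \<equiv> \<Sum>n\<in>I. (norm (x n))\<^sup>2 + (norm (y n))\<^sup>2"

text \<open>The boundary character \<open>n powr (- \<i> * t)\<close>.\<close>
abbreviation twist :: "real \<Rightarrow> nat \<Rightarrow> complex" where
  "twist t n \<equiv> cis (- (t * ln (real n)))"

text \<open>Dirichlet convolution with \<open>a\<close> acts on square summable sequences by the matrix with entry \<open>a (m /
  n)\<close> at \<open>(m, n)\<close> for \<open>n\<close> dividing \<open>m\<close>, and the definition says that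
  this operator has norm at most \<open>M\<close>. The bound on the bilinear form is stated with the arithmetic mean
  of the squared norms instead of the product of the norms; by homogeneity this is equivalent, and the additive right
  hand side makes the condition visibly stable under averaging and under orthogonal decompositions of \<open>x\<close>
  and \<open>y\<close>.\<close>
definition mult_bound :: "real \<Rightarrow> (nat \<Rightarrow> complex) \<Rightarrow> bool" where
  "mult_bound M a \<longleftrightarrow> (\<forall>I x y. finite I \<longrightarrow> 0 \<notin> I \<longrightarrow>
     2 * norm (mult_form I a x y)
       \<le> M * energy I x y)"

lemma mult_boundI:
  assumes "\<And>I x y. finite I \<Longrightarrow> 0 \<notin> I \<Longrightarrow>
     2 * norm (mult_form I a x y)
       \<le> M * energy I x y"
  shows "mult_bound M a"
  using assms by (auto simp: mult_bound_def)

lemma mult_boundD: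
  assumes "mult_bound M a" "finite I" "0 \<notin> I"
  shows "2 * norm (mult_form I a x y)
       \<le> M * energy I x y"
  using assms by (auto simp: mult_bound_def)

text \<open>On a vertical line \<open>P X Y\<close> is dominated in modulus by \<open>M (\<bar>X\<bar>\<^sup>2 +
  \<bar>Y\<bar>\<^sup>2) / 2\<close>, where \<open>X\<close> and \<open>Y\<close> are the sums with coefficients
  \<open>x\<close> and \<open>y\<close> over characters of opposite sign. Integrating against a Fejer kernel that is
  narrow on the frequency side keeps exactly the terms of frequency zero. As \<open>ln\<close> is injective and
  additive, these are on the left the terms with \<open>d * n = m\<close> and on the right the diagonal.\<close>
lemma dirichlet_poly_mult_bound:
  assumes S: "finite S" "0 \<notin> S"
    and M: "\<And>t. norm (\<Sum>n\<in>S. p n * twist t n) \<le> M"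
  shows "mult_bound M (\<lambda>n. if n \<in> S then p n else 0)"
proof (rule mult_boundI)
  fix I :: "nat set" and x y :: "nat \<Rightarrow> complex"
  assume I: "finite I" "0 \<notin> I"
  let ?q = "\<lambda>n. if n \<in> S then p n else 0"
  have M0: "M \<ge> 0" using order_trans[OF norm_ge_zero M[of 0]] by simp
  define J where "J = S \<times> I \<times> I"
  define z where "z = (\<lambda>(d,n,m). 2 * (p d * x n * y m))"
  define u where "u = (\<lambda>(d,n,m). ln (real d) + ln (real n) - ln (real m))"
  define w where "w = (\<lambda>(n,n'). of_real M * (x n * cnj (x n') + y n' * cnj (y n)))"
  define v where "v = (\<lambda>(n,n'). ln (real n) - ln (real n'))"
  \<comment> \<open>No nonzero frequency is smaller in modulus, so that the tent of width \<open>\<delta>\<close> sees the frequency zero only.\<close>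
  define \<delta> where "\<delta> = Min (insert 1 ((\<lambda>j. \<bar>u j\<bar>) ` J \<union> (\<lambda>k. \<bar>v k\<bar>) ` (I \<times> I) - {0}))"
  have fin: "finite J" "finite (I \<times> I)" using S I by (auto simp: J_def)
  have \<delta>: "\<delta> > 0" unfolding \<delta>_def using fin by (subst Min_gr_iff) auto
  have \<delta>u: "max 0 (\<delta> - \<bar>u j\<bar>) = (if u j = 0 then \<delta> else 0)" if "j \<in> J" for j
  proof (cases "u j = 0")
    case False
    then have "\<delta> \<le> \<bar>u j\<bar>" unfolding \<delta>_def using fin that by (intro Min_le) auto
    then show ?thesis using False by simp
  qed (use \<delta> in auto)
  have \<delta>v: "max 0 (\<delta> - \<bar>v k\<bar>) = (if v k = 0 then \<delta> else 0)" if "k \<in> I \<times> I" for k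
  proof (cases "v k = 0")
    case False
    then have "\<delta> \<le> \<bar>v k\<bar>" unfolding \<delta>_def using fin that by (intro Min_le) auto
    then show ?thesis using False by simp
  qed (use \<delta> in auto)
  have "norm (\<Sum>j\<in>J. z j * of_real (max 0 (\<delta> - \<bar>u j\<bar>))) \<le> Re (\<Sum>k\<in>I \<times> I. w k * of_real (max 0 (\<delta> - \<bar>v k\<bar>)))"
  proof (rule exp_sum_fejer_dominated)
    fix t
    define P where "P = (\<Sum>d\<in>S. p d * twist t d)"
    define X where "X = (\<Sum>n\<in>I. x n * twist t n)"
    define Y where "Y = (\<Sum>m\<in>I. y m * cis (t * ln (real m)))"
    have XY: "X * Y = (\<Sum>n\<in>I. \<Sum>m\<in>I. x n * twist t n * (y m * cis (t * ln (real m))))"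
      unfolding X_def Y_def by (rule sum_product)
    have "P * (X * Y) = (\<Sum>d\<in>S. \<Sum>n\<in>I. p d * twist t d *
        (\<Sum>m\<in>I. x n * twist t n * (y m * cis (t * ln (real m)))))"
      unfolding XY P_def by (rule sum_product)
    then have "P * (X * Y) = (\<Sum>d\<in>S. \<Sum>n\<in>I. \<Sum>m\<in>I. p d * twist t d *
        (x n * twist t n * (y m * cis (t * ln (real m)))))"
      by (simp only: sum_distrib_left)
    then have "2 * (P * (X * Y)) = (\<Sum>d\<in>S. \<Sum>n\<in>I. \<Sum>m\<in>I. 2 * (p d * twist t d *
        (x n * twist t n * (y m * cis (t * ln (real m))))))"
      by (simp only: sum_distrib_left)
    then have "(\<Sum>j\<in>J. z j * cis (- (t * u j))) = 2 * (P * (X * Y))"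
      unfolding J_def z_def u_def sum.cartesian_product
      by (auto simp: cis_mult algebra_simps intro!: sum.cong)
    moreover have "(\<Sum>k\<in>I \<times> I. w k * cis (- (t * v k))) = of_real M * (X * cnj X + Y * cnj Y)"
    proof -
      have "(\<Sum>k\<in>I \<times> I. w k * cis (- (t * v k))) =
        (\<Sum>n\<in>I. \<Sum>n'\<in>I. of_real M * (x n * cnj (x n')) * cis (- (t * (ln (real n) - ln (real n')))))
        + (\<Sum>n\<in>I. \<Sum>n'\<in>I. of_real M * (y n' * cnj (y n)) * cis (- (t * (ln (real n) - ln (real n')))))"
        unfolding w_def v_def sum.cartesian_product sum.distrib[symmetric]
        by (intro sum.cong refl) (auto simp: algebra_simps)
      also have "(\<Sum>n\<in>I. \<Sum>n'\<in>I. of_real M * (x n * cnj (x n')) * cis (- (t * (ln (real n) - ln (real n')))))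
         = of_real M * (X * cnj X)"
      proof -
        have "X * cnj X = (\<Sum>n\<in>I. \<Sum>n'\<in>I. x n * twist t n * cnj (x n' * cis (- (t * ln (real n')))))"
          unfolding X_def cnj_sum by (rule sum_product)
        then show ?thesis by (auto simp: sum_distrib_left cis_cnj cis_mult algebra_simps intro!: sum.cong)
      qed
      also have "(\<Sum>n\<in>I. \<Sum>n'\<in>I. of_real M * (y n' * cnj (y n)) * cis (- (t * (ln (real n) - ln (real n')))))
         = of_real M * (cnj Y * Y)"
      proof -
        have "cnj Y * Y = (\<Sum>n\<in>I. \<Sum>n'\<in>I. cnj (y n * cis (t * ln (real n))) * (y n' * cis (t * ln (real n'))))"
          unfolding Y_def cnj_sum by (rule sum_product)
        then show ?thesis by (auto simp: sum_distrib_left cis_cnj cis_mult algebra_simps intro!: sum.cong)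
      qed
      finally show ?thesis by (simp add: algebra_simps)
    qed
    moreover have "norm (2 * (P * (X * Y))) \<le> Re (of_real M * (X * cnj X + Y * cnj Y))"
    proof -
      have "norm P \<le> M" unfolding P_def by (rule M)
      then have "norm P * (2 * (norm X * norm Y)) \<le> M * (2 * (norm X * norm Y))"
        by (rule mult_right_mono) auto
      also have "\<dots> \<le> M * ((norm X)\<^sup>2 + (norm Y)\<^sup>2)"
        using M0 sum_squares_bound[of "norm X" "norm Y"] by (intro mult_left_mono) (auto simp: mult_ac)
      also have "\<dots> = Re (of_real M * (X * cnj X + Y * cnj Y))"
        by (simp add: complex_norm_square[symmetric] power2_eq_square[symmetric] del: Re_complex_of_real
            flip: of_real_power of_real_add of_real_mult) (simp add: complex_norm_square[symmetric])
      finally show ?thesis by (simp add: norm_mult mult_ac)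
    qed
    ultimately show "norm (\<Sum>j\<in>J. z j * cis (- (t * u j))) \<le> Re (\<Sum>k\<in>I \<times> I. w k * cis (- (t * v k)))"
      by simp
  qed (use \<delta> in auto)
  also have "(\<Sum>j\<in>J. z j * of_real (max 0 (\<delta> - \<bar>u j\<bar>)))
      = of_real \<delta> * (2 * (mult_form I ?q x y))"
  proof -
    have u0: "u (d, n, m) = 0 \<longleftrightarrow> d * n = m" if "d \<in> S" "n \<in> I" "m \<in> I" for d n m
    proof -
      have "d > 0" "n > 0" "m > 0" using that S I by (metis gr0I)+
      then have "u (d, n, m) = ln (real (d * n)) - ln (real m)" by (simp add: u_def ln_mult)
      also have "\<dots> = 0 \<longleftrightarrow> real (d * n) = real m"
        using \<open>d > 0\<close> \<open>n > 0\<close> \<open>m > 0\<close> by (simp add: ln_inj_iff)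
      finally show ?thesis by (simp only: of_nat_eq_iff)
    qed
    have inner: "(\<Sum>d\<in>S. if d * n = m then p d else 0) = (if n dvd m then ?q (m div n) else 0)"
      if "n \<in> I" for n m
    proof -
      have "n > 0" using that I by (metis gr0I)
      then have "(\<Sum>d\<in>S. if d * n = m then p d else 0) = (\<Sum>d\<in>S. if d = m div n then (if n dvd m then p d else 0) else 0)"
        by (intro sum.cong refl) auto
      then show ?thesis using S by (simp add: sum.delta)
    qed
    have "(\<Sum>j\<in>J. z j * of_real (max 0 (\<delta> - \<bar>u j\<bar>))) = (\<Sum>j\<in>J. z j * (if u j = 0 then of_real \<delta> else 0))"
      by (intro sum.cong refl) (simp add: \<delta>u)
    also have "\<dots> = (\<Sum>d\<in>S. \<Sum>n\<in>I. \<Sum>m\<in>I. of_real \<delta> * (2 * ((if d * n = m then p d else 0) * x n * y m)))"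
      unfolding J_def sum.cartesian_product z_def
      by (intro sum.cong refl) (auto simp: u0 split: prod.splits)
    also have "\<dots> = (\<Sum>n\<in>I. \<Sum>m\<in>I. \<Sum>d\<in>S. of_real \<delta> * (2 * ((if d * n = m then p d else 0) * x n * y m)))"
      by (subst sum.swap, rule sum.cong[OF refl], rule sum.swap)
    also have "\<dots> = (\<Sum>n\<in>I. \<Sum>m\<in>I. of_real \<delta> * (2 * ((if n dvd m then ?q (m div n) else 0) * x n * y m)))"
      by (intro sum.cong refl) (simp add: inner[symmetric] sum_distrib_left sum_distrib_right)
    also have "\<dots> = (\<Sum>m\<in>I. \<Sum>n\<in>I. of_real \<delta> * (2 * ((if n dvd m then ?q (m div n) else 0) * x n * y m)))"
      by (rule sum.swap)
    finally show ?thesis by (simp only: sum_distrib_left)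
  qed
  also have "(\<Sum>k\<in>I \<times> I. w k * of_real (max 0 (\<delta> - \<bar>v k\<bar>))) = of_real (\<delta> * (M * energy I x y))"
  proof -
    have v0: "v (n, m) = 0 \<longleftrightarrow> m = n" if "n \<in> I" "m \<in> I" for n m
    proof -
      have "n > 0" "m > 0" using that I by (metis gr0I)+
      then show ?thesis by (auto simp add: v_def ln_inj_iff)
    qed
    have "(\<Sum>k\<in>I \<times> I. w k * of_real (max 0 (\<delta> - \<bar>v k\<bar>))) = (\<Sum>k\<in>I \<times> I. w k * (if v k = 0 then of_real \<delta> else 0))"
      by (intro sum.cong refl) (simp add: \<delta>v)
    also have "\<dots> = (\<Sum>n\<in>I. \<Sum>m\<in>I. if m = n then of_real \<delta> * w (n, n) else 0)"
      unfolding sum.cartesian_product by (intro sum.cong refl) (auto simp: v0)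
    also have "\<dots> = (\<Sum>n\<in>I. of_real \<delta> * w (n, n))"
      using I by (simp add: sum.delta)
    also have "\<dots> = (\<Sum>n\<in>I. of_real (\<delta> * (M * ((norm (x n))\<^sup>2 + (norm (y n))\<^sup>2))))"
      by (intro sum.cong refl) (simp add: w_def flip: complex_norm_square)
    finally show ?thesis by (simp only: sum_distrib_left of_real_sum)
  qed
  finally have "\<delta> * (2 * norm (mult_form I ?q x y))
      \<le> \<delta> * (M * energy I x y)"
    using \<delta> by (simp only: norm_mult norm_of_real Re_complex_of_real) simp
  then show "2 * norm (mult_form I ?q x y)
      \<le> M * energy I x y"
    using \<delta> by (simp only: mult_le_cancel_left_pos)
qed

section \<open>Truncating Dirichlet polynomials\<close>

text \<open>The three summands on the right dominate the kernel for small, intermediate and large \<open>t\<close>; they come from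
  two, one and no uses of \<open>\<bar>sin z\<bar> \<le> \<bar>z\<bar>\<close> in the product formula for the
  difference of cosines.\<close>
lemma trapezoid_kernel_bound:
  assumes T: "T = real N + 1" "N \<ge> 1"
    and A: "A = ln (real N)" and B: "B = ln (real N + 1)"
  shows "\<bar>fejer_kernel B t - fejer_kernel A t\<bar> / (B - A) \<le>
     B * indicator {-1..1} t + (inverse \<bar>t\<bar> * indicator {1..T} t + inverse \<bar>t\<bar> * indicator {-T..-1} t)
       + 4 / T * inverse (1 + (t / T)\<^sup>2)"
proof -
  have AB: "0 \<le> A" "A < B" using assms by (auto simp: ln_less_cancel_iff)
  have T1: "T > 1" using T by simp
  have gap: "1 / (B - A) \<le> T"
  proof -

    have "A - B = ln (real N / T)" using T A B by (simp add: ln_div)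
    also have "\<dots> \<le> real N / T - 1" using T by (intro ln_le_minus_one) auto
    also have "\<dots> = - (1 / T)" using T by (simp add: field_simps)
    finally have "1 / T \<le> B - A" by simp
    then show ?thesis using AB T1 by (simp add: field_simps)
  qed
  have cosd: "\<bar>cos (A * t) - cos (B * t)\<bar> = 2 * \<bar>sin ((A + B) * t / 2)\<bar> * \<bar>sin ((B - A) * t / 2)\<bar>"
    using cos_diff_cos[of "A * t" "B * t"] by (simp add: abs_mult algebra_simps)
  have L: "\<bar>fejer_kernel B t - fejer_kernel A t\<bar> / (B - A) = \<bar>cos (A * t) - cos (B * t)\<bar> / ((B - A) * t\<^sup>2)"
    by (simp add: fejer_kernel_def diff_divide_distrib[symmetric] abs_divide)
  have s2: "\<bar>sin ((B - A) * t / 2)\<bar> \<le> (B - A) * \<bar>t\<bar> / 2"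
    using abs_sin_x_le_abs_x[of "(B - A) * t / 2"] AB by (simp add: abs_mult)
  have s1: "\<bar>sin ((A + B) * t / 2)\<bar> \<le> (A + B) * \<bar>t\<bar> / 2"
    using abs_sin_x_le_abs_x[of "(A + B) * t / 2"] AB by (simp add: abs_mult)
  have pos: "4 / T * inverse (1 + (t / T)\<^sup>2) \<ge> 0" using T1 by simp
  have posB: "B * indicator {-1..1} t \<ge> 0" using AB by (auto split: split_indicator)
  have posM: "inverse \<bar>t\<bar> * indicator {1..T} t + inverse \<bar>t\<bar> * indicator {-T..-1} t \<ge> 0" by auto
  consider "t = 0" | "\<bar>t\<bar> \<le> 1" "t \<noteq> 0" | "\<bar>t\<bar> > 1" "\<bar>t\<bar> \<le> T" | "\<bar>t\<bar> > T" by linarith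
  then show ?thesis
  proof cases
    case 1
    then show ?thesis using pos AB T1 by (simp add: fejer_kernel_def)
  next
    case 2
    have "\<bar>cos (A * t) - cos (B * t)\<bar> \<le> 2 * ((A + B) * \<bar>t\<bar> / 2) * ((B - A) * \<bar>t\<bar> / 2)"
      unfolding cosd using s1 s2 AB by (intro mult_mono) auto
    also have "\<dots> = ((A + B) / 2) * ((B - A) * t\<^sup>2)"
      by (simp add: power2_eq_square)
    also have "\<dots> \<le> B * ((B - A) * t\<^sup>2)"
      using AB by (intro mult_right_mono) auto
    finally have "\<bar>cos (A * t) - cos (B * t)\<bar> / ((B - A) * t\<^sup>2) \<le> B"
      using AB 2 by (simp add: divide_le_eq)
    moreover have ind: "indicator {-1..1} t = (1::real)" using 2 by (auto simp: indicator_def)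
    moreover have "B * indicator {-1..1} t = B" using ind by simp
    ultimately show ?thesis unfolding L using pos posM by linarith
  next
    case 3
    have "\<bar>cos (A * t) - cos (B * t)\<bar> \<le> 2 * 1 * ((B - A) * \<bar>t\<bar> / 2)"
      unfolding cosd using s2 AB by (intro mult_mono) auto
    moreover have "inverse \<bar>t\<bar> * ((B - A) * t\<^sup>2) = (B - A) * \<bar>t\<bar>"
    proof -
      have "t\<^sup>2 = \<bar>t\<bar> * \<bar>t\<bar>" by (simp add: power2_eq_square)
      moreover have "inverse a * ((B - A) * (a * a)) = (B - A) * a" if "a > 1" for a :: real
        using that by simp
      ultimately show ?thesis using 3 by metis
    qed
    ultimately have "\<bar>cos (A * t) - cos (B * t)\<bar> \<le> inverse \<bar>t\<bar> * ((B - A) * t\<^sup>2)"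
      by linarith
    then have "\<bar>cos (A * t) - cos (B * t)\<bar> / ((B - A) * t\<^sup>2) \<le> inverse \<bar>t\<bar>"
      using AB 3 by (simp add: divide_le_eq)
    moreover have "inverse \<bar>t\<bar> \<le> inverse \<bar>t\<bar> * indicator {1..T} t + inverse \<bar>t\<bar> * indicator {-T..-1} t"
      using 3 by (auto split: split_indicator)
    ultimately show ?thesis unfolding L using pos posB by linarith
  next
    case 4
    have "\<bar>cos (A * t) - cos (B * t)\<bar> \<le> 2 * 1 * 1"
      unfolding cosd by (intro mult_mono) auto
    then have "\<bar>cos (A * t) - cos (B * t)\<bar> / ((B - A) * t\<^sup>2) \<le> 2 / ((B - A) * t\<^sup>2)"
      using AB by (intro divide_right_mono) auto
    also have "\<dots> = 1 / (B - A) * (2 / t\<^sup>2)" by simp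
    also have "\<dots> \<le> T * (2 / t\<^sup>2)" using gap by (intro mult_right_mono) auto
    also have "\<dots> \<le> 4 / T * inverse (1 + (t / T)\<^sup>2)"
    proof -
      have T2: "T\<^sup>2 < t\<^sup>2" using power_strict_mono[of T "\<bar>t\<bar>" 2] 4 T1 by simp
      have "4 / T * inverse (1 + (t / T)\<^sup>2) = 4 * T / (T\<^sup>2 + t\<^sup>2)"
        using T1 by (simp add: field_simps power2_eq_square)
      moreover have "T * (2 / t\<^sup>2) \<le> 4 * T / (T\<^sup>2 + t\<^sup>2)"
        using T1 T2 4 by (simp add: field_simps add_pos_pos)
      ultimately show ?thesis by simp
    qed
    finally show ?thesis unfolding L using posM posB by linarith
  qed
qed

text \<open>Bohr's inequality for partial sums. The difference quotient of two Fejer kernels at \<open>A = ln N\<close> and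
  \<open>B = ln (N + 1)\<close> has a trapezoid as transform, which is one on \<open>ln 1, \<dots>, ln N\<close> and
  zero from \<open>ln (N + 1)\<close> on, so integrating a translate of the polynomial against it cuts the sum at
  \<open>N\<close>. The \<open>L\<^sup>1\<close> norm of this kernel is only logarithmic in \<open>N\<close>, and that
  is what later gives convergence on the whole half-plane.\<close>
lemma truncation_bound_exists:
  "\<exists>c>0. \<forall>M S p N t. finite S \<longrightarrow> 0 \<notin> S \<longrightarrow>
     (\<forall>t. norm (\<Sum>n\<in>S. p n * twist t n) \<le> M) \<longrightarrow> N \<ge> 1 \<longrightarrow>
     norm (\<Sum>n\<in>S \<inter> {..N}. p n * twist t n) \<le> c * (1 + ln (real N + 1)) * M"
proof -
  define D where "D = (\<integral>t. inverse (1 + t\<^sup>2) \<partial>(lborel::real measure))"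
  have D0: "D \<ge> 0" unfolding D_def by (intro integral_nonneg_AE) auto
  define c where "c = (4 + 4 * D) / fejer_const"
  have c0: "c > 0" using D0 fejer_const_pos by (simp add: c_def)
  have "norm (\<Sum>n\<in>S \<inter> {..N}. p n * twist t n) \<le> c * (1 + ln (real N + 1)) * M"
    if S: "finite S" "0 \<notin> S" and M: "\<And>t. norm (\<Sum>n\<in>S. p n * twist t n) \<le> M"
      and N: "N \<ge> 1" for M S p N t
  proof -
    define A where "A = ln (real N)"
    define B where "B = ln (real N + 1)"
    define T where "T = real N + 1"
    have AB: "0 \<le> A" "A < B" using N by (auto simp: A_def B_def)
    have T1: "T > 1" using N by (simp add: T_def)
    have M0: "M \<ge> 0" using order_trans[OF norm_ge_zero M[of 0]] by simp
    define k where "k = (\<lambda>t. (fejer_kernel B t - fejer_kernel A t) / (B - A))"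
    define g where "g = (\<lambda>t. B * indicator {-1..1} t + (inverse \<bar>t\<bar> * indicator {1..T} t + inverse \<bar>t\<bar> * indicator {-T..-1} t)
       + 4 / T * inverse (1 + (t / T)\<^sup>2))"
    have kg: "\<bar>k t\<bar> \<le> g t" for t
      unfolding k_def g_def using trapezoid_kernel_bound[OF T_def N A_def B_def, of t] AB
      by (simp add: abs_divide)
    have h1: "has_bochner_integral lborel (\<lambda>t. inverse \<bar>t\<bar> * indicator {1..T} t) (ln T - ln 1)"
    proof -
      have "has_bochner_integral lborel (\<lambda>t. inverse t * indicator {1..T} t) (ln T - ln 1)"
        using T1 by (intro has_bochner_integral_FTC_Icc_real) (auto intro!: derivative_eq_intros continuous_intros simp: divide_inverse)
      moreover have "(\<lambda>t. inverse t * indicator {1..T} t) = (\<lambda>t. inverse \<bar>t\<bar> * indicator {1..T} t)"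
        by (auto simp: fun_eq_iff split: split_indicator)
      ultimately show ?thesis by simp
    qed
    have h2: "has_bochner_integral lborel (\<lambda>t. inverse \<bar>t\<bar> * indicator {-T..-1} t) (ln T - ln 1)"
    proof -
      have "has_bochner_integral lborel (\<lambda>t. inverse \<bar>0 + (-1) * t\<bar> * indicator {1..T} (0 + (-1) * t)) ((ln T - ln 1) /\<^sub>R \<bar>-1\<bar>)"
        using h1 by (subst (asm) lborel_has_bochner_integral_real_affine_iff[where c = "-1" and t = 0]) auto
      moreover have "(\<lambda>t. inverse \<bar>0 + (-1) * t\<bar> * indicator {1..T} (0 + (-1) * t)) = (\<lambda>t. inverse \<bar>t\<bar> * indicator {-T..-1} t)"
        by (auto simp: fun_eq_iff split: split_indicator)
      ultimately show ?thesis by simp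
    qed
    have h3: "has_bochner_integral lborel (\<lambda>t. inverse (1 + (t / T)\<^sup>2)) (T * D)"
    proof -
      have "has_bochner_integral lborel (\<lambda>t::real. inverse (1 + t\<^sup>2)) D"
        unfolding D_def by (intro has_bochner_integral_integrable integrable_inverse_one_plus_square)
      then have "has_bochner_integral lborel (\<lambda>t::real. inverse (1 + (0 + inverse T * t)\<^sup>2)) (D /\<^sub>R \<bar>inverse T\<bar>)"
        using T1 by (subst (asm) lborel_has_bochner_integral_real_affine_iff[where c = "inverse T" and t = 0]) auto
      then show ?thesis using T1 by (simp add: divide_inverse mult_ac)
    qed
    have h4: "has_bochner_integral lborel (\<lambda>t::real. B * indicator {-1..1} t) (B * measure lborel {-1..1::real})"
      using has_bochner_integral_real_indicator[of "{-1..1::real}" lborel]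
      by (intro has_bochner_integral_mult_right) auto
    have "has_bochner_integral lborel g (B * measure lborel {-1..1::real} + ((ln T - ln 1) + (ln T - ln 1)) + 4 / T * (T * D))"
      unfolding g_def by (intro has_bochner_integral_add has_bochner_integral_mult_right h1 h2 h3 h4)
    moreover have "B * measure lborel {-1..1::real} + ((ln T - ln 1) + (ln T - ln 1)) + 4 / T * (T * D) = 4 * B + 4 * D"
      using T1 by (simp add: B_def T_def)
    ultimately have g: "integrable lborel g" "integral\<^sup>L lborel g = 4 * B + 4 * D"
      by (auto simp: has_bochner_integral_iff)
    have ff: "has_bochner_integral lborel (\<lambda>s. of_real (k s) * cis (- (s * u)))
        (of_real (fejer_const * ((max 0 (B - \<bar>u\<bar>) - max 0 (A - \<bar>u\<bar>)) / (B - A))))" for u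
    proof -
      have "has_bochner_integral lborel (\<lambda>s. (of_real (fejer_kernel B s) * cis (- (s * u)) - of_real (fejer_kernel A s) * cis (- (s * u))) / of_real (B - A))
        ((of_real (fejer_const * max 0 (B - \<bar>u\<bar>)) - of_real (fejer_const * max 0 (A - \<bar>u\<bar>))) / of_real (B - A))"
        using AB by (intro has_bochner_integral_divide has_bochner_integral_diff fejer_fourier) auto
      then show ?thesis by (simp add: k_def algebra_simps)
    qed
    define P where "P = (\<lambda>s. \<Sum>n\<in>S. (p n * twist t n) * (of_real (k s) * twist s n))"
    have trap: "(max 0 (B - \<bar>ln (real n)\<bar>) - max 0 (A - \<bar>ln (real n)\<bar>)) / (B - A) = (if n \<le> N then 1 else 0)"
      if "n \<in> S" for n
    proof -
      have n: "n > 0" using that S by (metis gr0I)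
      then have ln0: "ln (real n) \<ge> 0" by simp
      show ?thesis
      proof (cases "n \<le> N")
        case True
        then have "ln (real n) \<le> A" using n by (simp add: A_def)
        then show ?thesis using True ln0 AB by (simp add: max_def)
      next
        case False
        then have "real N + 1 \<le> real n" by linarith
        then have "B \<le> ln (real n)" unfolding B_def using N n by (subst ln_le_cancel_iff) auto
        then show ?thesis using False ln0 AB by (simp add: max_def)
      qed
    qed
    have "has_bochner_integral lborel P (\<Sum>n\<in>S. (p n * twist t n) *
       of_real (fejer_const * ((max 0 (B - \<bar>ln (real n)\<bar>) - max 0 (A - \<bar>ln (real n)\<bar>)) / (B - A))))"
      unfolding P_def by (intro has_bochner_integral_sum has_bochner_integral_mult_right ff)
    also have "(\<Sum>n\<in>S. (p n * twist t n) *
       of_real (fejer_const * ((max 0 (B - \<bar>ln (real n)\<bar>) - max 0 (A - \<bar>ln (real n)\<bar>)) / (B - A))))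
      = (\<Sum>n\<in>S. if n \<in> {..N} then of_real fejer_const * (p n * twist t n) else 0)"
      by (intro sum.cong refl) (simp add: trap)
    also have "\<dots> = of_real fejer_const * (\<Sum>n\<in>S \<inter> {..N}. p n * twist t n)"
      using S by (simp only: sum.inter_restrict[symmetric] sum_distrib_left)
    finally have P: "integrable lborel P" "integral\<^sup>L lborel P = of_real fejer_const * (\<Sum>n\<in>S \<inter> {..N}. p n * twist t n)"
      by (auto simp: has_bochner_integral_iff)
    have Pb: "norm (P s) \<le> M * g s" for s
    proof -
      have "P s = of_real (k s) * (\<Sum>n\<in>S. p n * twist (t + s) n)"
        unfolding P_def sum_distrib_left by (intro sum.cong refl) (auto simp: cis_mult algebra_simps)
      then have "norm (P s) = \<bar>k s\<bar> * norm (\<Sum>n\<in>S. p n * twist (t + s) n)"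
        by (simp add: norm_mult)
      also have "\<dots> \<le> g s * M" using kg M order_trans[OF abs_ge_zero kg] by (intro mult_mono) auto
      finally show ?thesis by (simp add: mult.commute)
    qed
    have "norm (integral\<^sup>L lborel P) \<le> (\<integral>s. norm (P s) \<partial>lborel)"
      by (rule integral_norm_bound)
    also have "\<dots> \<le> (\<integral>s. M * g s \<partial>lborel)"
      using P(1) g(1) by (intro integral_mono Pb) auto
    also have "\<dots> = M * (4 * B + 4 * D)" using g by simp
    finally have "fejer_const * norm (\<Sum>n\<in>S \<inter> {..N}. p n * twist t n) \<le> M * (4 * B + 4 * D)"
      unfolding P(2) using fejer_const_pos by (simp add: norm_mult)
    also have "\<dots> \<le> M * ((4 + 4 * D) * (1 + B))"
      using M0 D0 AB by (intro mult_left_mono) (auto simp: algebra_simps)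
    finally show ?thesis using fejer_const_pos unfolding c_def B_def by (simp add: field_simps)
  qed
  then show ?thesis using c0 by blast
qed

section \<open>Calculus of multiplier bounds\<close>

lemma mult_bound_nonneg:
  assumes "mult_bound M a"
  shows "M \<ge> 0"
  using mult_boundD[OF assms, of "{1}" "\<lambda>_. 1" "\<lambda>_. 0"] by simp

lemma mult_bound_tendsto:
  assumes F: "F \<noteq> bot"
    and a: "\<And>n. n > 0 \<Longrightarrow> ((\<lambda>k. a k n) \<longlongrightarrow> b n) F"
    and M: "(M \<longlongrightarrow> L) F"
    and bd: "eventually (\<lambda>k. mult_bound (M k) (a k)) F"
  shows "mult_bound L b"
proof (rule mult_boundI)
  fix I :: "nat set" and x y :: "nat \<Rightarrow> complex"
  assume I: "finite I" "0 \<notin> I"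
  have ten: "((\<lambda>k. if n dvd m then a k (m div n) else 0) \<longlongrightarrow> (if n dvd m then b (m div n) else 0)) F"
    if "m \<in> I" for m n
  proof (cases "n dvd m")
    case True
    moreover have "m > 0" using that I by (metis gr0I)
    ultimately have "m div n > 0" by (metis dvd_div_eq_0_iff gr0I)
    then show ?thesis using a True by simp
  qed auto
  show "2 * norm (mult_form I b x y)
      \<le> L * energy I x y"
  proof (rule tendsto_le[OF F])
    show "((\<lambda>k. M k * energy I x y) \<longlongrightarrow> L * energy I x y) F"
      by (intro tendsto_intros M)
    show "((\<lambda>k. 2 * norm (mult_form I (a k) x y)) \<longlongrightarrow>
       2 * norm (mult_form I b x y)) F"
      by (intro tendsto_intros ten)
    show "\<forall>\<^sub>F k in F. 2 * norm (mult_form I (a k) x y)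
        \<le> M k * energy I x y"
      using bd by eventually_elim (use I in \<open>auto dest: mult_boundD\<close>)
  qed
qed

lemma mult_bound_cong:
  assumes "mult_bound M a" "\<And>n. n > 0 \<Longrightarrow> a n = b n"
  shows "mult_bound M b"
  by (rule mult_bound_tendsto[of sequentially "\<lambda>_. a" b "\<lambda>_. M" M]) (auto simp: assms)

lemma mult_bound_cmult:
  assumes "mult_bound M a"
  shows "mult_bound (norm c * M) (\<lambda>n. c * a n)"
proof (rule mult_boundI)
  fix I :: "nat set" and x y :: "nat \<Rightarrow> complex"
  assume I: "finite I" "0 \<notin> I"
  have "(mult_form I (\<lambda>n. c * a n) x y)
     = c * (mult_form I a x y)"
    unfolding sum_distrib_left by (intro sum.cong refl) auto
  then show "2 * norm (mult_form I (\<lambda>n. c * a n) x y)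
      \<le> norm c * M * energy I x y"
    using mult_left_mono[OF mult_boundD[OF assms I, of x y] norm_ge_zero[of c]]
    by (simp add: norm_mult mult_ac)
qed

lemma mult_bound_add:
  assumes "mult_bound M a" "mult_bound N b"
  shows "mult_bound (M + N) (\<lambda>n. a n + b n)"
proof (rule mult_boundI)
  fix I :: "nat set" and x y :: "nat \<Rightarrow> complex"
  assume I: "finite I" "0 \<notin> I"
  have "(mult_form I (\<lambda>n. a n + b n) x y)
     = (mult_form I a x y)
     + (mult_form I b x y)"
    unfolding sum.distrib[symmetric] by (intro sum.cong refl) (auto simp: algebra_simps)
  then show "2 * norm (mult_form I (\<lambda>n. a n + b n) x y)
      \<le> (M + N) * energy I x y"
    using mult_boundD[OF assms(1) I, of x y] mult_boundD[OF assms(2) I, of x y]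
      norm_triangle_ineq[of "mult_form I a x y"
        "mult_form I b x y"]
    by (simp add: distrib_right)
qed

lemma mult_bound_average:
  assumes "finite R" "R \<noteq> {}" "\<And>h. h \<in> R \<Longrightarrow> mult_bound M (a h)"
  shows "mult_bound M (\<lambda>n. (\<Sum>h\<in>R. a h n) / of_nat (card R))"
proof -
  have zero: "mult_bound 0 (\<lambda>_. 0)" by (rule mult_boundI) simp
  have "mult_bound (of_nat (card R') * M) (\<lambda>n. \<Sum>h\<in>R'. a h n)" if "R' \<subseteq> R" for R'
    using finite_subset[OF that assms(1)] that
  proof (induction R' rule: finite_induct)
    case (insert h R')
    then have "mult_bound (M + of_nat (card R') * M) (\<lambda>n. a h n + (\<Sum>h\<in>R'. a h n))"
      by (intro mult_bound_add assms) auto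
    then show ?case using insert by (simp add: algebra_simps)
  qed (simp add: zero)
  from mult_bound_cmult[OF this[OF order_refl], of "1 / of_nat (card R)"] show ?thesis
    using assms(1,2) by (simp add: norm_divide card_eq_0_iff)
qed

text \<open>Apply the operator to \<open>r\<close> times the unit sequence, with \<open>y\<close> the conjugate of
  \<open>a\<close> on \<open>I\<close>; choosing \<open>r = M\<close> undoes the use of the arithmetic mean.\<close>
lemma mult_bound_l2:
  assumes a: "mult_bound M a" and I: "finite I" "0 \<notin> I"
  shows "(\<Sum>n\<in>I. (norm (a n))\<^sup>2) \<le> M\<^sup>2"
proof -
  define S where "S = (\<Sum>n\<in>I. (norm (a n))\<^sup>2)"
  have S0: "S \<ge> 0" by (simp add: S_def sum_nonneg)
  have M0: "M \<ge> 0" using mult_bound_nonneg[OF a] .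
  have key: "2 * r * S \<le> M * (r\<^sup>2 + S)" if "r \<ge> 0" for r
  proof -
    define x where "x = (\<lambda>n::nat. if n = 1 then of_real r else (0::complex))"
    define y where "y = (\<lambda>n. if n \<in> I then cnj (a n) else 0)"
    have "(\<Sum>m\<in>insert 1 I. \<Sum>n\<in>insert 1 I. (if n dvd m then a (m div n) else 0) * x n * y m)
       = (\<Sum>m\<in>insert 1 I. \<Sum>n\<in>insert 1 I. if n = 1 then a m * of_real r * y m else 0)"
      by (intro sum.cong refl) (auto simp: x_def)
    also have "\<dots> = (\<Sum>m\<in>insert 1 I. a m * of_real r * y m)"
      using I by (simp add: sum.delta)
    also have "\<dots> = (\<Sum>m\<in>I. a m * of_real r * cnj (a m))"
      using I by (intro sum.mono_neutral_cong_right) (auto simp: y_def)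
    also have "\<dots> = of_real (r * S)"
      unfolding S_def sum_distrib_left of_real_sum
    proof (intro sum.cong refl)
      fix m
      have "a m * of_real r * cnj (a m) = of_real r * (a m * cnj (a m))" by simp
      then show "a m * of_real r * cnj (a m) = of_real (r * (norm (a m))\<^sup>2)"
        by (simp only: complex_norm_square[symmetric] of_real_mult of_real_power)
    qed
    finally have "2 * (r * S) \<le> M * (\<Sum>n\<in>insert 1 I. (norm (x n))\<^sup>2 + (norm (y n))\<^sup>2)"
      using mult_boundD[OF a, of "insert 1 I" x y] I S0 that by (simp add: norm_mult del: sum.insert_if)
    also have "(\<Sum>n\<in>insert 1 I. (norm (x n))\<^sup>2 + (norm (y n))\<^sup>2) = r\<^sup>2 + S"
    proof -
      have "(\<Sum>n\<in>insert 1 I. (norm (x n))\<^sup>2) = (\<Sum>n\<in>insert 1 I. if n = 1 then r\<^sup>2 else 0)"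
        by (intro sum.cong refl) (auto simp: x_def)
      moreover have "(\<Sum>n\<in>insert 1 I. (norm (y n))\<^sup>2) = S"
        unfolding S_def using I by (intro sum.mono_neutral_cong_right) (auto simp: y_def)
      ultimately show ?thesis using I by (simp only: sum.distrib) (simp add: sum.delta del: sum.insert_if)
    qed
    finally show ?thesis by simp
  qed
  have "S \<le> M\<^sup>2"
  proof (cases "M = 0")
    case True
    then show ?thesis using key[of 1] S0 by simp
  next
    case False
    then have "M > 0" using M0 by simp
    have "M * (2 * S) \<le> M * (M\<^sup>2 + S)" using key[OF M0] by (simp add: mult_ac)
    then show ?thesis using \<open>M > 0\<close> by simp
  qed
  then show ?thesis by (simp add: S_def)
qed

lemma mult_bound_coeff:
  assumes "mult_bound M a" "n > 0"
  shows "norm (a n) \<le> M"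
proof (rule power2_le_imp_le)
  show "(norm (a n))\<^sup>2 \<le> M\<^sup>2"
    using mult_bound_l2[OF assms(1), of "{n}"] assms(2) by simp
qed (rule mult_bound_nonneg[OF assms(1)])

lemma mult_bound_absolutely_summable:
  assumes a: "summable (\<lambda>n. norm (a n))"
  shows "mult_bound (\<Sum>n. norm (a n)) a"
proof (rule mult_bound_tendsto[of sequentially "\<lambda>k n. if n \<in> {1..<k} then a n else 0" _ "\<lambda>_. \<Sum>n. norm (a n)"])
  show "\<forall>\<^sub>F k in sequentially. mult_bound (\<Sum>n. norm (a n)) (\<lambda>n. if n \<in> {1..<k} then a n else 0)"
  proof (intro always_eventually allI dirichlet_poly_mult_bound)
    fix k t
    have "norm (\<Sum>n\<in>{1..<k}. a n * twist t n) \<le> (\<Sum>n\<in>{1..<k}. norm (a n))"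
      by (rule sum_norm_le) (simp add: norm_mult)
    also have "\<dots> \<le> (\<Sum>n. norm (a n))" using a by (intro sum_le_suminf) auto
    finally show "norm (\<Sum>n\<in>{1..<k}. a n * twist t n) \<le> (\<Sum>n. norm (a n))" .
  qed auto
  show "(\<lambda>k. if n \<in> {1..<k} then a n else 0) \<longlonglongrightarrow> a n" if "n > 0" for n
    by (rule tendsto_eventually, rule eventually_mono[OF eventually_gt_at_top[of n]]) (use that in simp)
qed auto

section \<open>Completely multiplicative contractions\<close>

text \<open>The numbers \<open>r ^ \<bar>\<nu> - \<mu>\<bar>\<close> form the Gram matrix of explicit unit vectors: this is the
  Poisson kernel in positive definite form.\<close>
lemma sum_gram_geometric:
  fixes r :: real and \<nu> \<mu> J :: nat
  assumes r: "0 \<le> r" "r \<le> 1" and \<nu>: "\<nu> \<le> \<mu>" "\<mu> \<le> J"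
  defines "u \<equiv> \<lambda>\<nu> j. if j = 0 then r ^ \<nu> else if j \<le> \<nu> then r ^ (\<nu> - j) * sqrt (1 - r\<^sup>2) else 0"
  shows "(\<Sum>j\<le>J. u \<nu> j * u \<mu> j) = r ^ (\<mu> - \<nu>)"
proof -
  have r2: "1 - r\<^sup>2 \<ge> 0" using r by (simp add: power_le_one)
  have "(\<Sum>j\<le>J. u \<nu> j * u \<mu> j) = (\<Sum>j\<in>insert 0 {1..\<nu>}. u \<nu> j * u \<mu> j)"
    using \<nu> by (intro sum.mono_neutral_right) (auto simp: u_def)
  also have "\<dots> = r ^ \<nu> * r ^ \<mu> + (\<Sum>j\<in>{1..\<nu>}. r ^ (\<nu> - j) * r ^ (\<mu> - j) * (1 - r\<^sup>2))"
    using \<nu> r2 by (subst sum.insert) (auto simp: u_def mult_ac intro!: sum.cong)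
  also have "(\<Sum>j\<in>{1..\<nu>}. r ^ (\<nu> - j) * r ^ (\<mu> - j) * (1 - r\<^sup>2)) = (\<Sum>i<\<nu>. r ^ (\<mu> - \<nu>) * (r\<^sup>2) ^ i * (1 - r\<^sup>2))"
  proof (rule sum.reindex_bij_witness[of _ "\<lambda>i. \<nu> - i" "\<lambda>j. \<nu> - j"])
    fix j assume j: "j \<in> {1..\<nu>}"
    have "r ^ (\<mu> - j) = r ^ (\<mu> - \<nu>) * r ^ (\<nu> - j)"
      using j \<nu> by (simp flip: power_add)
    then show "r ^ (\<mu> - \<nu>) * (r\<^sup>2) ^ (\<nu> - j) * (1 - r\<^sup>2) = r ^ (\<nu> - j) * r ^ (\<mu> - j) * (1 - r\<^sup>2)"
      by (simp add: power2_eq_square power_mult_distrib)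
  qed auto
  also have "\<dots> = r ^ (\<mu> - \<nu>) * ((1 - r\<^sup>2) * (\<Sum>i<\<nu>. (r\<^sup>2) ^ i))"
    by (simp add: sum_distrib_left mult_ac)
  also have "(1 - r\<^sup>2) * (\<Sum>i<\<nu>. (r\<^sup>2) ^ i) = 1 - (r\<^sup>2) ^ \<nu>"
    by (rule one_diff_power_eq[symmetric])
  also have "r ^ \<nu> * r ^ \<mu> = r ^ (\<mu> - \<nu>) * (r\<^sup>2) ^ \<nu>"
    using \<nu> by (simp add: power2_eq_square power_mult_distrib add.commute flip: power_add mult.assoc)
  finally show ?thesis by (simp add: algebra_simps)
qed

text \<open>Schur multiplication by a Gram matrix of unit vectors is a contraction: split \<open>x\<close> and \<open>y\<close>
  along the coordinates of these vectors, apply the bound to each piece, and add up.\<close>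
lemma mult_bound_prime_dilation:
  fixes r :: real
  assumes p: "prime p" and r: "0 \<le> r" "r \<le> 1" and a: "mult_bound M a"
  shows "mult_bound M (\<lambda>n. of_real (r ^ multiplicity p n) * a n)"
proof (rule mult_boundI)
  fix I :: "nat set" and x y :: "nat \<Rightarrow> complex"
  assume I: "finite I" "0 \<notin> I"
  define \<nu> where "\<nu> = (\<lambda>n. multiplicity p n)"
  define J where "J = Max (insert 0 (\<nu> ` I))"
  define u where "u = (\<lambda>\<nu> j. if j = 0 then r ^ \<nu> else if j \<le> \<nu> then r ^ (\<nu> - j) * sqrt (1 - r\<^sup>2) else 0)"
  let ?ra = "\<lambda>n. of_real (r ^ multiplicity p n) * a n"
  let ?v = "\<lambda>x j n. x n * of_real (u (\<nu> n) j)"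
  have J: "\<nu> n \<le> J" if "n \<in> I" for n
    unfolding J_def using I that by (intro Max_ge) auto
  have gram: "r ^ \<nu> (m div n) = (\<Sum>j\<le>J. u (\<nu> n) j * u (\<nu> m) j)" if "m \<in> I" "n \<in> I" "n dvd m" for m n
  proof -
    have pos: "m > 0" "n > 0" using that I by (metis gr0I)+
    from that(3) obtain d where d: "m = n * d" by blast
    with pos have "\<nu> m = \<nu> n + \<nu> d"
      unfolding \<nu>_def using p by (simp add: prime_elem_multiplicity_mult_distrib)
    moreover have "m div n = d" using d pos by simp
    ultimately show ?thesis
      using sum_gram_geometric[OF r, of "\<nu> n" "\<nu> m" J] J[OF that(1)] unfolding u_def by simp
  qed
  have "(mult_form I ?ra x y)
     = (\<Sum>m\<in>I. \<Sum>n\<in>I. \<Sum>j\<le>J. (if n dvd m then a (m div n) else 0) * (x n * of_real (u (\<nu> n) j)) * (y m * of_real (u (\<nu> m) j)))"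
  proof (intro sum.cong refl)
    fix m n assume mn: "m \<in> I" "n \<in> I"
    show "(if n dvd m then of_real (r ^ multiplicity p (m div n)) * a (m div n) else 0) * x n * y m
      = (\<Sum>j\<le>J. (if n dvd m then a (m div n) else 0) * (x n * of_real (u (\<nu> n) j)) * (y m * of_real (u (\<nu> m) j)))"
    proof (cases "n dvd m")
      case True
      have "of_real (r ^ multiplicity p (m div n)) = (\<Sum>j\<le>J. of_real (u (\<nu> n) j) * (of_real (u (\<nu> m) j) :: complex))"
        using gram[OF mn True] unfolding \<nu>_def by simp
      then show ?thesis using True by (simp add: sum_distrib_left sum_distrib_right mult_ac)
    qed simp
  qed
  also have "\<dots> = (\<Sum>j\<le>J. mult_form I a (?v x j) (?v y j))"
  proof -
    have "\<dots> = (\<Sum>m\<in>I. \<Sum>j\<le>J. \<Sum>n\<in>I. (if n dvd m then a (m div n) else 0) * (x n * of_real (u (\<nu> n) j)) * (y m * of_real (u (\<nu> m) j)))"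
      by (intro sum.cong refl sum.swap)
    then show ?thesis by (simp only: sum.swap[of _ "{..J}" I])
  qed
  finally have "2 * norm (mult_form I ?ra x y)
     \<le> (\<Sum>j\<le>J. 2 * norm (mult_form I a (?v x j) (?v y j)))"
    by (simp only: sum_distrib_left[symmetric]) (intro mult_left_mono norm_sum, simp)
  also have "\<dots> \<le> (\<Sum>j\<le>J. M * (\<Sum>n\<in>I. (norm (?v x j n))\<^sup>2 + (norm (?v y j n))\<^sup>2))"
    by (intro sum_mono mult_boundD[OF a I])
  also have "\<dots> = M * (\<Sum>j\<le>J. \<Sum>n\<in>I. ((norm (x n))\<^sup>2 + (norm (y n))\<^sup>2) * (u (\<nu> n) j * u (\<nu> n) j))"
    by (simp add: sum_distrib_left norm_mult power2_eq_square algebra_simps)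
  also have "\<dots> = M * (\<Sum>n\<in>I. ((norm (x n))\<^sup>2 + (norm (y n))\<^sup>2) * (\<Sum>j\<le>J. u (\<nu> n) j * u (\<nu> n) j))"
    by (subst sum.swap) (simp only: sum_distrib_left)
  also have "\<dots> = M * energy I x y"
    using sum_gram_geometric[OF r order_refl J] unfolding u_def by simp
  finally show "2 * norm (mult_form I ?ra x y)
     \<le> M * energy I x y" .
qed

lemma completely_multiplicative_prod:
  fixes c :: "nat \<Rightarrow> 'a :: comm_monoid_mult"
  assumes one: "c 1 = 1" and mult: "\<And>m n. m > 0 \<Longrightarrow> n > 0 \<Longrightarrow> c (m * n) = c m * c n"
    and n: "n > 0" "n \<le> N"
  shows "c n = (\<Prod>p | prime p \<and> p \<le> N. c p ^ multiplicity p n)"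
proof -
  have pow: "c (p ^ e) = c p ^ e" if "p > 0" for p e
    by (induction e) (use that in \<open>auto simp: mult one[simplified]\<close>)
  have prd: "c (\<Prod>p\<in>A. p ^ e p) = (\<Prod>p\<in>A. c p ^ e p)" if "finite A" "\<And>p. p \<in> A \<Longrightarrow> p > 0" for A and e :: "nat \<Rightarrow> nat"
    using that
  proof (induction A rule: finite_induct)
    case (insert p A)
    then show ?case by (simp add: mult pow prod_pos)
  qed (use one in simp)
  have "n = (\<Prod>p\<in>prime_factors n. p ^ multiplicity p n)"
    using n by (simp add: prime_factorization_nat)
  then have "c n = c (\<Prod>p\<in>prime_factors n. p ^ multiplicity p n)" by simp
  also have "\<dots> = (\<Prod>p\<in>prime_factors n. c p ^ multiplicity p n)"
    by (rule prd) (auto dest: in_prime_factors_imp_prime intro: prime_gt_0_nat)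
  also have "\<dots> = (\<Prod>p | prime p \<and> p \<le> N. c p ^ multiplicity p n)"
  proof (rule prod.mono_neutral_left)
    show "prime_factors n \<subseteq> {p. prime p \<and> p \<le> N}"
      using n by (auto simp: in_prime_factors_iff dest!: dvd_imp_le)
    show "\<forall>p\<in>{p. prime p \<and> p \<le> N} - prime_factors n. c p ^ multiplicity p n = 1"
      using n by (auto simp: in_prime_factors_iff not_dvd_imp_multiplicity_0)
  qed auto
  finally show ?thesis .
qed

text \<open>Dilating one prime after another reaches every completely multiplicative weight with values in \<open>[0, 1]\<close>,
  because any given coefficient involves finitely many primes only. The weights used below are \<open>n powr (-
  \<epsilon>)\<close>, \<open>r ^ bigomega n\<close>, suitable quotients of these, and the indicator function of the
  numbers with finite orbit.\<close>
lemma mult_bound_completely_multiplicative: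
  fixes c :: "nat \<Rightarrow> real"
  assumes one: "c 1 = 1" and mult: "\<And>m n. m > 0 \<Longrightarrow> n > 0 \<Longrightarrow> c (m * n) = c m * c n"
    and c: "\<And>n. n > 0 \<Longrightarrow> 0 \<le> c n" "\<And>n. n > 0 \<Longrightarrow> c n \<le> 1" and a: "mult_bound M a"
  shows "mult_bound M (\<lambda>n. of_real (c n) * a n)"
proof (rule mult_bound_tendsto[of sequentially _ _ "\<lambda>_. M"])
  define cN where "cN = (\<lambda>N n. \<Prod>p | prime p \<and> p \<le> N. c p ^ multiplicity p n)"
  have finite_set: "mult_bound M (\<lambda>n. of_real (\<Prod>p\<in>P. c p ^ multiplicity p n) * a n)" if "finite P" "\<And>p. p \<in> P \<Longrightarrow> prime p" for P
    using that
  proof (induction P rule: finite_induct)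
    case (insert p P)
    have p: "prime p" using insert.prems by blast
    have IH: "mult_bound M (\<lambda>n. of_real (\<Prod>p\<in>P. c p ^ multiplicity p n) * a n)"
      using insert.IH insert.prems by blast
    have "mult_bound M (\<lambda>n. of_real (c p ^ multiplicity p n) * (of_real (\<Prod>p\<in>P. c p ^ multiplicity p n) * a n))"
      using prime_gt_0_nat[OF p] by (intro mult_bound_prime_dilation[OF p _ _ IH] c)
    then show ?case
      by (simp only: prod.insert[OF insert.hyps] of_real_mult mult.assoc)
  qed (simp add: a)
  have "mult_bound M (\<lambda>n. of_real (cN N n) * a n)" for N
    unfolding cN_def by (rule finite_set) auto
  then show "\<forall>\<^sub>F N in sequentially. mult_bound M (\<lambda>n. of_real (cN N n) * a n)"
    by (intro always_eventually allI)
  fix n :: nat assume "n > 0"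
  then have "\<forall>\<^sub>F N in sequentially. of_real (cN N n) * a n = of_real (c n) * a n"
    using completely_multiplicative_prod[of c, OF one mult, of n]
    unfolding cN_def by (intro eventually_sequentiallyI[of n]) auto
  then show "(\<lambda>N. of_real (cN N n) * a n) \<longlonglongrightarrow> of_real (c n) * a n"
    by (rule tendsto_eventually)
qed auto

section \<open>Folner means on the multiplicative semigroup\<close>

lemma dividend_dvd: "b dvd a \<Longrightarrow> a div b dvd (a :: nat)"
  by (metis dvd_div_mult_self dvd_triv_left)

text \<open>The divisors \<open>n\<close> of \<open>Q\<close> for which \<open>p * n\<close> is no longer a divisor are those with
  maximal exponent of \<open>p\<close>. Removing up to \<open>L\<close> factors \<open>p\<close> from them gives
  \<open>L + 1\<close> disjoint copies of this set among the divisors.\<close>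
lemma card_top_divisors:
  fixes Q p L :: nat
  assumes Q: "Q > 0" and p: "prime p" and L: "p ^ L dvd Q"
  shows "card {n. n dvd Q \<and> \<not> p * n dvd Q} * (L + 1) \<le> card {n. n dvd Q}"
proof -
  define E where "E = multiplicity p Q"
  have p0: "p > 0" "p \<noteq> 1" using p by (auto simp: prime_gt_0_nat)
  have LE: "L \<le> E" unfolding E_def using L Q p0 by (intro multiplicity_geI) auto
  let ?A = "{n. n dvd Q \<and> \<not> p * n dvd Q}"
  have mult: "multiplicity p n = E" if "n \<in> ?A" for n
  proof (rule ccontr)
    assume neq: "multiplicity p n \<noteq> E"
    have n: "n dvd Q" "n > 0" using that Q by (auto intro: gr0I)
    have le: "multiplicity q n \<le> multiplicity q Q" for q
      using n Q by (intro dvd_imp_multiplicity_le) auto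
    have "p * n dvd Q"
    proof (rule multiplicity_le_imp_dvd)
      show "multiplicity q (p * n) \<le> multiplicity q Q" if q: "prime q" for q
      proof (cases "q = p")
        case True
        then have "multiplicity q (p * n) = Suc (multiplicity p n)"
          using p n by (simp add: prime_elem_multiplicity_mult_distrib)
        then show ?thesis using le[of p] neq True by (simp add: E_def)
      next
        case False
        then have "\<not> q dvd p" using p q primes_dvd_imp_eq by blast
        then have "multiplicity q p = 0" by (rule not_dvd_imp_multiplicity_0)
        then have "multiplicity q (p * n) = multiplicity q n"
          using q n p0 by (simp add: prime_elem_multiplicity_mult_distrib)
        then show ?thesis using le by simp
      qed
    qed (use n p0 in auto)
    then show False using that by simp
  qed
  have pw: "p ^ j dvd n" if "n \<in> ?A" "j \<le> L" for n j
    using mult[OF that(1)] that LE by (auto intro!: multiplicity_dvd')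
  have "card (?A \<times> {..L}) \<le> card {n. n dvd Q}"
  proof (rule card_inj_on_le)
    show "inj_on (\<lambda>(n, j). n div p ^ j) (?A \<times> {..L})"
    proof (rule inj_onI)
      fix a b assume ab: "a \<in> ?A \<times> {..L}" "b \<in> ?A \<times> {..L}"
        "(\<lambda>(n, j). n div p ^ j) a = (\<lambda>(n, j). n div p ^ j) b"
      obtain n j n' j' where nj: "a = (n, j)" "b = (n', j')" by force
      have *: "n dvd Q" "\<not> p * n dvd Q" "j \<in> {..L}" "n' dvd Q" "\<not> p * n' dvd Q" "j' \<in> {..L}"
        and eq: "n div p ^ j = n' div p ^ j'" using ab by (simp_all add: nj)
      have m: "multiplicity p (k div p ^ i) = E - i \<and> p ^ i * (k div p ^ i) = k" if k: "k \<in> ?A" "i \<le> L" for k i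
      proof -
        obtain l where l: "k = p ^ i * l" using pw[OF k] by blast
        have "k > 0" using that Q by (auto intro: gr0I)
        then have "l > 0" using l by (auto intro: gr0I)
        then have "multiplicity p k = i + multiplicity p l"
          unfolding l using p p0 by (simp add: prime_elem_multiplicity_mult_distrib)
        then show ?thesis using mult[OF that(1)] l p0 by simp
      qed
      have mem: "n \<in> ?A" "n' \<in> ?A" and jL: "j \<le> L" "j' \<le> L" using * by simp_all
      note mj = m[OF mem(1) jL(1)] m[OF mem(2) jL(2)]
      have "E - j = E - j'" using mj eq by metis
      moreover have "j \<le> E" "j' \<le> E" using * LE by auto
      ultimately have "j = j'" by linarith
      then show "a = b" using mj eq nj by metis
    qed
    show "(\<lambda>(n, j). n div p ^ j) ` (?A \<times> {..L}) \<subseteq> {n. n dvd Q}"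
    proof clarsimp
      fix n j assume "n dvd Q" "\<not> p * n dvd Q" "j \<le> L"
      then show "n div p ^ j dvd Q"
        using pw[of n j] dvd_trans[OF dividend_dvd, of "p ^ j" n Q] by simp
    qed
  qed (use Q in \<open>simp add: finite_divisors_nat\<close>)
  then show ?thesis by (simp add: card_cartesian_product)
qed

text \<open>The divisors of \<open>fact L ^ L\<close> form a Folner sequence in the multiplicative semigroup: multiplication by a
  fixed \<open>d\<close> moves only a proportion \<open>O(1 / L)\<close> of them out of the set.\<close>
lemma factorial_power_folner_bound:
  fixes d :: nat
  assumes "d > 0"
  shows "\<exists>C. \<forall>\<^sub>F L in sequentially. card {n. n dvd fact L ^ L \<and> \<not> d * n dvd fact L ^ L} * (L + 1)
     \<le> C * card {n::nat. n dvd fact L ^ L}"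
  using assms
proof (induction d rule: prime_divisors_induct)
  case (unit d)
  then show ?case by (intro exI[of _ 0]) auto
next
  case (factor p d)
  then have d: "d > 0" and p: "p > 0" by auto
  from factor.IH d obtain C where C: "\<forall>\<^sub>F L in sequentially. card {n. n dvd fact L ^ L \<and> \<not> d * n dvd fact L ^ L} * (L + 1)
     \<le> C * card {n::nat. n dvd fact L ^ L}" by blast
  have "\<forall>\<^sub>F L in sequentially. card {n. n dvd fact L ^ L \<and> \<not> p * d * n dvd fact L ^ L} * (L + 1)
     \<le> (C + 1) * card {n::nat. n dvd fact L ^ L}"
    using C eventually_ge_at_top[of p]
  proof eventually_elim
    case (elim L)
    define Q where "Q = (fact L ^ L :: nat)"
    have Q: "Q > 0" by (simp add: Q_def)
    have fin: "finite {n. n dvd Q \<and> R n}" for R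
      by (rule finite_subset[OF _ finite_divisors_nat[OF Q]]) auto
    have pL: "p ^ L dvd Q"
      unfolding Q_def using elim p by (intro dvd_power_same dvd_fact) auto
    have "card {n. n dvd Q \<and> \<not> p * d * n dvd Q}
      \<le> card ({n. n dvd Q \<and> \<not> d * n dvd Q} \<union> {n. d * n dvd Q \<and> \<not> p * (d * n) dvd Q})"
      by (intro card_mono finite_UnI fin finite_subset[OF _ finite_divisors_nat[OF Q]])
         (auto simp: mult.assoc intro: dvd_mult_right)
    also have "\<dots> \<le> card {n. n dvd Q \<and> \<not> d * n dvd Q} + card {n. d * n dvd Q \<and> \<not> p * (d * n) dvd Q}"
      by (rule card_Un_le)
    also have "card {n. d * n dvd Q \<and> \<not> p * (d * n) dvd Q} \<le> card {n. n dvd Q \<and> \<not> p * n dvd Q}"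
      by (rule card_inj_on_le[where f = "\<lambda>n. d * n"]) (use d fin in \<open>auto simp: inj_on_def\<close>)
    finally have "card {n. n dvd Q \<and> \<not> p * d * n dvd Q} * (L + 1)
      \<le> card {n. n dvd Q \<and> \<not> d * n dvd Q} * (L + 1) + card {n. n dvd Q \<and> \<not> p * n dvd Q} * (L + 1)"
      by (simp only: add_mult_distrib[symmetric]) (rule mult_le_mono1, linarith)
    also have "\<dots> \<le> C * card {n. n dvd Q} + card {n. n dvd Q}"
      using elim(1) card_top_divisors[OF Q factor.hyps(1) pL] unfolding Q_def by (intro add_mono) auto
    finally show ?case by (simp add: Q_def)
  qed
  then show ?case by blast
qed auto

lemma factorial_power_folner:
  fixes d :: nat
  assumes "d > 0"
  shows "(\<lambda>L. real (card {n. d * n dvd fact L ^ L}) / real (card {n::nat. n dvd fact L ^ L})) \<longlonglongrightarrow> 1"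
proof -
  obtain C where C: "\<forall>\<^sub>F L in sequentially. card {n. n dvd fact L ^ L \<and> \<not> d * n dvd fact L ^ L} * (L + 1)
     \<le> C * card {n::nat. n dvd fact L ^ L}" using factorial_power_folner_bound[OF assms] by blast
  let ?f = "\<lambda>L. real (card {n. d * n dvd fact L ^ L}) / real (card {n::nat. n dvd fact L ^ L})"
  have ev: "\<forall>\<^sub>F L in sequentially. 1 - real C / real (L + 1) \<le> ?f L \<and> ?f L \<le> 1"
    using C
  proof eventually_elim
    case (elim L)
    define Q where "Q = (fact L ^ L :: nat)"
    have Q: "Q > 0" by (simp add: Q_def)
    note fin = finite_divisors_nat[OF Q]
    have c0: "card {n. n dvd Q} > 0" using fin Q by (subst card_gt_0_iff) auto
    have "{n. n dvd Q} = {n. d * n dvd Q} \<union> {n. n dvd Q \<and> \<not> d * n dvd Q}"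
      by (auto intro: dvd_mult_right)
    moreover have "finite {n. d * n dvd Q}" by (rule finite_subset[OF _ fin]) (auto intro: dvd_mult_right)
    moreover have "finite {n. n dvd Q \<and> \<not> d * n dvd Q}" by (rule finite_subset[OF _ fin]) auto
    ultimately have "card {n. n dvd Q} = card {n. d * n dvd Q} + card {n. n dvd Q \<and> \<not> d * n dvd Q}"
      by (simp add: card_Un_disjoint disjoint_iff)
    then have *: "real (card {n. d * n dvd Q}) = real (card {n. n dvd Q}) - real (card {n. n dvd Q \<and> \<not> d * n dvd Q})"
      by simp
    have "real (card {n. n dvd Q \<and> \<not> d * n dvd Q} * (L + 1)) \<le> real (C * card {n. n dvd Q})"
      using elim unfolding Q_def by (simp only: of_nat_le_iff)
    then have "real (card {n. n dvd Q \<and> \<not> d * n dvd Q}) / real (card {n. n dvd Q}) \<le> real C / real (L + 1)"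
      using c0 by (simp add: field_simps)
    then show ?case using c0 unfolding Q_def[symmetric] * by (simp add: diff_divide_distrib)
  qed
  have lim: "(\<lambda>L. 1 - real C / real (L + 1)) \<longlonglongrightarrow> 1"
    by real_asymp
  show ?thesis
    by (rule tendsto_sandwich[OF _ _ lim tendsto_const]) (use ev in \<open>auto elim: eventually_mono\<close>)
qed

text \<open>Test the bilinear form on the characters \<open>x n = n powr (\<i> * t)\<close> and \<open>y m = m powr (- \<i> *
  t)\<close>, restricted to the divisors of \<open>Q\<close>: the coefficient of \<open>a d\<close> becomes the number
  of divisors \<open>n\<close> for which \<open>d * n\<close> still divides \<open>Q\<close>.\<close>
lemma mult_bound_folner_mean:
  assumes a: "mult_bound M a" and Q: "Q > 0"
  shows "norm (\<Sum>d | d dvd Q. of_real (real (card {n. d * n dvd Q}) / real (card {n. n dvd Q})) * a d * twist t d) \<le> M"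
proof -
  define I where "I = {n. n dvd Q}"
  have I: "finite I" "0 \<notin> I" "I \<noteq> {}" using Q by (auto simp: I_def)
  have c0: "card I > 0" using I by (simp add: card_gt_0_iff)
  define x where "x = (\<lambda>n::nat. cis (t * ln (real n)))"
  define y where "y = (\<lambda>n::nat. twist t n)"
  have "(mult_form I a x y)
     = (\<Sum>(m,n)\<in>I \<times> I. (if n dvd m then a (m div n) else 0) * x n * y m)"
    by (simp add: sum.cartesian_product)
  also have "\<dots> = (\<Sum>(m,n)\<in>{(m,n)\<in>I \<times> I. n dvd m}. a (m div n) * x n * y m)"
    using I by (intro sum.mono_neutral_cong_right) (auto split: if_splits)
  also have "\<dots> = (\<Sum>(d,n)\<in>(SIGMA d:I. {n. d * n dvd Q}). a d * twist t d)"
  proof (rule sum.reindex_bij_witness[of _ "\<lambda>(d,n). (d * n, n)" "\<lambda>(m,n). (m div n, n)"], goal_cases)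
    case (1 mn)
    then show ?case by auto
  next
    case (2 mn)
    then show ?case using I by (auto simp: I_def intro: dvd_mult_left dvd_trans[OF dividend_dvd])
  next
    case (3 dn)
    then show ?case using Q by (auto intro: gr0I)
  next
    case (4 dn)
    then show ?case by (auto simp: I_def intro: dvd_mult_right)
  next
    case (5 mn)
    obtain m n where mn: "mn = (m, n)" by force
    with 5 obtain d where d: "m = n * d" and nI: "n \<in> I" and mI: "m \<in> I" by auto
    have pos: "n > 0" "d > 0" using nI mI d I by (auto intro: gr0I)
    have "x n * y m = twist t d"
      using pos by (simp add: x_def y_def cis_mult d ln_mult algebra_simps)
    then show ?case using pos by (simp add: mn d mult.assoc)
  qed
  also have "\<dots> = (\<Sum>d\<in>I. \<Sum>n | d * n dvd Q. a d * twist t d)"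
  proof (rule sum.Sigma[symmetric])
    show "\<forall>d\<in>I. finite {n. d * n dvd Q}"
      using I unfolding I_def by (auto intro!: finite_subset[OF _ I(1)[unfolded I_def]] intro: dvd_mult_right)
  qed (rule I)
  also have "\<dots> = of_nat (card I) * (\<Sum>d | d dvd Q. of_real (real (card {n. d * n dvd Q}) / real (card {n. n dvd Q})) * a d * twist t d)"
    unfolding sum_distrib_left I_def[symmetric] using c0 by (intro sum.cong refl) (simp add: I_def[symmetric])
  finally have "2 * (real (card I) * norm (\<Sum>d | d dvd Q. of_real (real (card {n. d * n dvd Q}) / real (card {n. n dvd Q})) * a d * twist t d))
     \<le> M * energy I x y"
    using mult_boundD[OF a I(1,2), of x y] by (simp only: norm_mult norm_of_nat)
  also have "\<dots> = 2 * (real (card I) * M)"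
    by (simp add: x_def y_def)
  finally show ?thesis using c0 by simp
qed

definition folner_mean :: "(nat \<Rightarrow> complex) \<Rightarrow> nat \<Rightarrow> nat \<Rightarrow> complex" where
  "folner_mean a L d =
     of_real (real (card {n. d * n dvd fact L ^ L}) / real (card {n::nat. n dvd fact L ^ L})) * a d"

lemma folner_mean_outside: "\<not> d dvd fact L ^ L \<Longrightarrow> folner_mean a L d = 0"
proof -
  assume "\<not> d dvd fact L ^ L"
  then have "{n. d * n dvd fact L ^ L} = {}" by (auto intro: dvd_mult_left)
  then show ?thesis by (simp add: folner_mean_def)
qed

lemma folner_mean_tendsto:
  assumes "d > 0"
  shows "(\<lambda>L. folner_mean a L d) \<longlonglongrightarrow> a d"
proof -
  have "(\<lambda>L. folner_mean a L d) \<longlonglongrightarrow> of_real 1 * a d"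
    unfolding folner_mean_def by (intro tendsto_intros factorial_power_folner[OF assms])
  then show ?thesis by simp
qed

lemma folner_mean_bound:
  "mult_bound M a \<Longrightarrow> norm (\<Sum>d | d dvd fact L ^ L. folner_mean a L d * twist t d) \<le> M"
  unfolding folner_mean_def by (rule mult_bound_folner_mean) simp_all

text \<open>Bohr's inequality applies to the Folner means of \<open>a\<close>, which are Dirichlet polynomials bounded by
  \<open>M\<close>; for fixed \<open>N\<close> their partial sums converge to those of \<open>a\<close>.\<close>
lemma mult_bound_partial_sums:
  "\<exists>c>0. \<forall>M a N t. mult_bound M a \<longrightarrow> N \<ge> 1 \<longrightarrow>
     norm (\<Sum>n=1..N. a n * twist t n) \<le> c * (1 + ln (real N + 1)) * M"
proof -
  obtain c where c: "c > 0" and bd: "\<And>M S p N t. finite S \<Longrightarrow> 0 \<notin> S \<Longrightarrow>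
     (\<And>t. norm (\<Sum>n\<in>S. p n * twist t n) \<le> M) \<Longrightarrow> N \<ge> 1 \<Longrightarrow>
     norm (\<Sum>n\<in>S \<inter> {..N}. p n * twist t n) \<le> c * (1 + ln (real N + 1)) * M"
    using truncation_bound_exists by blast
  have "norm (\<Sum>n=1..N. a n * twist t n) \<le> c * (1 + ln (real N + 1)) * M"
    if a: "mult_bound M a" and N: "N \<ge> 1" for M a N t
  proof -
    have "(\<lambda>L. norm (\<Sum>n=1..N. folner_mean a L n * twist t n)) \<longlonglongrightarrow> norm (\<Sum>n=1..N. a n * twist t n)"
      by (intro tendsto_intros folner_mean_tendsto) auto
    moreover have "norm (\<Sum>n=1..N. folner_mean a L n * twist t n) \<le> c * (1 + ln (real N + 1)) * M" for L
    proof -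
      let ?S = "{d::nat. d dvd fact L ^ L}"
      have S: "finite ?S" "0 \<notin> ?S" by (auto intro!: finite_divisors_nat)
      have "(\<Sum>n=1..N. folner_mean a L n * twist t n) = (\<Sum>n\<in>?S \<inter> {..N}. folner_mean a L n * twist t n)"
      proof (rule sum.mono_neutral_cong_right)
        show "?S \<inter> {..N} \<subseteq> {1..N}"
        proof
          fix n assume n: "n \<in> ?S \<inter> {..N}"
          then have "n \<noteq> 0" using S(2) by (metis IntD1)
          then show "n \<in> {1..N}" using n by simp
        qed
        show "\<forall>n\<in>{1..N} - ?S \<inter> {..N}. folner_mean a L n * twist t n = 0"
          using folner_mean_outside by auto
      qed auto
      then show ?thesis using bd[OF S folner_mean_bound[OF a] N] by simp
    qed
    ultimately show ?thesis by (intro LIMSEQ_le_const2) auto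
  qed
  then show ?thesis using c by blast
qed

text \<open>Converse of \<open>dirichlet_poly_mult_bound\<close> on the boundary: the supremum of a Dirichlet polynomial on the
  imaginary axis is at most its norm as a multiplier.\<close>
lemma mult_bound_dirichlet_poly:
  assumes a: "mult_bound M a" and T: "finite T" "0 \<notin> T" "\<And>n. n \<notin> T \<Longrightarrow> a n = 0"
  shows "norm (\<Sum>n\<in>T. a n * twist t n) \<le> M"
proof -
  have "(\<lambda>L. norm (\<Sum>n\<in>T. folner_mean a L n * twist t n)) \<longlonglongrightarrow> norm (\<Sum>n\<in>T. a n * twist t n)"
    using T(2) by (intro tendsto_intros folner_mean_tendsto) (auto intro: gr0I)
  moreover have "norm (\<Sum>n\<in>T. folner_mean a L n * twist t n) \<le> M" for L
  proof -
    let ?S = "{d::nat. d dvd fact L ^ L}"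
    have S: "finite ?S" by (auto intro!: finite_divisors_nat)
    have "(\<Sum>n\<in>T. folner_mean a L n * twist t n) = (\<Sum>n\<in>T \<union> ?S. folner_mean a L n * twist t n)"
      using T S by (intro sum.mono_neutral_left) (auto simp: folner_mean_def)
    also have "\<dots> = (\<Sum>n\<in>?S. folner_mean a L n * twist t n)"
      using T S by (intro sum.mono_neutral_right) (auto simp: folner_mean_outside)
    finally show ?thesis using folner_mean_bound[OF a] by simp
  qed
  ultimately show ?thesis by (intro LIMSEQ_le_const2) auto
qed

section \<open>Convergence of multiplier series\<close>

lemma of_nat_powr_minus:
  assumes "n > 0"
  shows "of_nat n powr (- s) = of_real (real n powr (- Re s)) * twist (Im s) n"
proof -
  have "of_nat n powr (- s) = exp (- s * of_real (ln (real n)))"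
    using assms by (simp add: powr_def Ln_of_nat)
  also have "- s * of_real (ln (real n)) = of_real (- Re s * ln (real n)) + \<i> * of_real (- (Im s * ln (real n)))"
    by (simp add: complex_eq_iff)
  also have "exp \<dots> = of_real (exp (- Re s * ln (real n))) * twist (Im s) n"
    by (simp only: exp_add exp_of_real cis_conv_exp)
  finally show ?thesis using assms by (simp add: powr_def)
qed

lemma norm_of_nat_powr_minus:
  assumes "n > 0"
  shows "norm (of_nat n powr (- s :: complex)) = real n powr (- Re s)"
  using assms by (simp add: of_nat_powr_minus norm_mult)

lemma mult_bound_shift:
  assumes "mult_bound M a" "\<epsilon> \<ge> 0"
  shows "mult_bound M (\<lambda>n. of_real (real n powr (- \<epsilon>)) * a n)"
proof (rule mult_bound_completely_multiplicative[OF _ _ _ _ assms(1)])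
  show "real n powr (- \<epsilon>) \<le> 1" if "n > 0" for n
    using that assms(2) powr_mono[of "-\<epsilon>" 0 "real n"] by simp
qed (auto simp: powr_mult)

lemma partial_sums_power_bound:
  assumes a: "mult_bound M a" and \<delta>: "\<delta> > 0"
  shows "\<exists>K\<ge>0. \<forall>n t. n \<ge> 1 \<longrightarrow> norm (\<Sum>k=1..n. a k * twist t k) \<le> K * real n powr \<delta>"
proof -
  obtain c where c: "c > 0" and bd: "\<And>N t. N \<ge> 1 \<Longrightarrow>
     norm (\<Sum>n=1..N. a n * twist t n) \<le> c * (1 + ln (real N + 1)) * M"
    using mult_bound_partial_sums a by blast
  have M0: "M \<ge> 0" using mult_bound_nonneg[OF a] .
  define K where "K = c * (1 + 2 powr \<delta> / \<delta>) * M"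
  have "norm (\<Sum>k=1..n. a k * twist t k) \<le> K * real n powr \<delta>" if n: "n \<ge> 1" for n t
  proof -
    have "ln (real n + 1) \<le> (real n + 1) powr \<delta> / \<delta>"
      using \<delta> by (intro ln_powr_bound) auto
    also have "\<dots> \<le> (2 * real n) powr \<delta> / \<delta>"
      using \<delta> n by (intro divide_right_mono powr_mono2) auto
    also have "\<dots> = 2 powr \<delta> / \<delta> * real n powr \<delta>" by (simp add: powr_mult)
    finally have "1 + ln (real n + 1) \<le> (1 + 2 powr \<delta> / \<delta>) * real n powr \<delta>"
      using ge_one_powr_ge_zero[of "real n" \<delta>] n \<delta> by (simp add: distrib_right)
    then have "c * (1 + ln (real n + 1)) * M \<le> c * ((1 + 2 powr \<delta> / \<delta>) * real n powr \<delta>) * M"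
      using c M0 by (intro mult_left_mono mult_right_mono) auto
    then show ?thesis using bd[OF n, of t] by (simp add: K_def mult_ac)
  qed
  moreover have "K \<ge> 0" using c M0 \<delta> by (simp add: K_def)
  ultimately show ?thesis by blast
qed

text \<open>Summation by parts against \<open>n powr (- \<sigma>)\<close>. With \<open>v n = n powr (- \<sigma> / 2)\<close> the
  partial sums on the imaginary axis are at most \<open>K / v n\<close>, while \<open>(v n)\<^sup>2 - (v (n +
  1))\<^sup>2 \<le> 2 * v n * (v n - v (n + 1))\<close>; so the sum that arises telescopes, uniformly in
  \<open>\<sigma> \<ge> \<epsilon>\<close>.\<close>
lemma dirichlet_tail_bound:
  assumes a: "mult_bound M a" and \<epsilon>: "\<epsilon> > 0"
  shows "\<exists>K\<ge>0. \<forall>s N1 N2. Re s \<ge> \<epsilon> \<longrightarrow> 1 \<le> N1 \<longrightarrow> N1 \<le> N2 \<longrightarrow>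
     norm (\<Sum>n=N1..<N2. a n * of_nat n powr (- s)) \<le> K * real N1 powr (- (\<epsilon> / 2))"
proof -
  define \<delta> where "\<delta> = \<epsilon> / 2"
  have \<delta>: "\<delta> > 0" using \<epsilon> by (simp add: \<delta>_def)
  obtain K where K: "K \<ge> 0" and bd: "\<And>n t. n \<ge> 1 \<Longrightarrow> norm (\<Sum>k=1..n. a k * twist t k) \<le> K * real n powr \<delta>"
    using partial_sums_power_bound[OF a \<delta>] by blast
  have "norm (\<Sum>n=N1..<N2. a n * of_nat n powr (- s)) \<le> 3 * K * real N1 powr (- \<delta>)"
    if s: "Re s \<ge> \<epsilon>" and N: "1 \<le> N1" "N1 \<le> N2" for s N1 N2
  proof -
    define \<sigma> where "\<sigma> = Re s"
    define b where "b = (\<lambda>k. a k * twist (Im s) k)"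
    define A where "A = (\<lambda>n. \<Sum>k=1..<n. b k)"
    define v where "v = (\<lambda>n. real n powr (- (\<sigma> / 2)))"
    have \<sigma>: "\<delta> \<le> \<sigma> / 2" using s by (simp add: \<sigma>_def \<delta>_def)
    have A_Suc: "A (Suc n) = A n + b n" if "n \<ge> 1" for n
      unfolding A_def using that by (simp add: sum.atLeastLessThan_Suc)
    have A1: "norm (A (Suc n)) \<le> K * real n powr \<delta>" if "n \<ge> 1" for n
      using bd[OF that, of "Im s"] unfolding A_def b_def atLeastLessThanSuc_atLeastAtMost .
    have A2: "norm (A n) \<le> K * real n powr \<delta>" if n1: "n \<ge> 1" for n
    proof (cases "n = 1")
      case True
      then show ?thesis using K by (simp add: A_def)
    next
      case False
      then obtain m where m: "n = Suc m" "m \<ge> 1" using n1 by (cases n) auto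
      have "norm (A n) \<le> K * real m powr \<delta>" using A1[OF m(2)] m by simp
      also have "\<dots> \<le> K * real n powr \<delta>"
        using K m \<delta> by (intro mult_left_mono powr_mono2) auto
      finally show ?thesis .
    qed
    have v: "v n > 0" "v (Suc n) \<le> v n" "real n powr \<delta> * v n \<le> 1" if "n \<ge> 1" for n
    proof -
      show "v n > 0" using that by (simp add: v_def)
      show "v (Suc n) \<le> v n" unfolding v_def using that \<sigma> \<delta> by (intro powr_mono2') auto
      have "real n powr \<delta> * v n = real n powr (\<delta> - \<sigma> / 2)"
        by (simp add: v_def flip: powr_add)
      also have "\<dots> \<le> real n powr 0" using \<sigma> that by (intro powr_mono) auto
      finally show "real n powr \<delta> * v n \<le> 1" using that by simp
    qed
    have trm: "a n * of_nat n powr (- s) = b n * of_real ((v n)\<^sup>2)" if "n \<ge> 1" for n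
    proof -
      have "(v n)\<^sup>2 = real n powr (- Re s)"
        by (simp add: v_def \<sigma>_def power2_eq_square flip: powr_add)
      then show ?thesis using that by (simp add: b_def of_nat_powr_minus)
    qed
    have main: "norm ((\<Sum>n=N1..<N2. b n * of_real ((v n)\<^sup>2)) - A N2 * of_real ((v N2)\<^sup>2) + A N1 * of_real ((v N1)\<^sup>2))
       \<le> 2 * K * (v N1 - v N2)"
      using N(2)
    proof (induction N2 rule: dec_induct)
      case (step n)
      then have n: "n \<ge> 1" using N by simp
      have "(\<Sum>k=N1..<Suc n. b k * of_real ((v k)\<^sup>2)) - A (Suc n) * of_real ((v (Suc n))\<^sup>2) + A N1 * of_real ((v N1)\<^sup>2)
        = ((\<Sum>k=N1..<n. b k * of_real ((v k)\<^sup>2)) - A n * of_real ((v n)\<^sup>2) + A N1 * of_real ((v N1)\<^sup>2))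
          + A (Suc n) * of_real ((v n)\<^sup>2 - (v (Suc n))\<^sup>2)"
        using step A_Suc[OF n] by (simp add: sum.atLeastLessThan_Suc algebra_simps)
      also have "norm \<dots> \<le> 2 * K * (v N1 - v n) + norm (A (Suc n)) * \<bar>(v n)\<^sup>2 - (v (Suc n))\<^sup>2\<bar>"
        by (rule order_trans[OF norm_triangle_ineq], rule add_mono[OF step.IH]) (simp only: norm_mult norm_of_real order_refl)
      also have "norm (A (Suc n)) * \<bar>(v n)\<^sup>2 - (v (Suc n))\<^sup>2\<bar> \<le> 2 * K * (v n - v (Suc n))"
      proof -
        have "(v n)\<^sup>2 - (v (Suc n))\<^sup>2 = (v n + v (Suc n)) * (v n - v (Suc n))"
          by (simp add: power2_eq_square algebra_simps)
        moreover have "v (Suc n) > 0" using v(1)[of "Suc n"] by simp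
        ultimately have "\<bar>(v n)\<^sup>2 - (v (Suc n))\<^sup>2\<bar> \<le> (2 * v n) * (v n - v (Suc n))"
          using v(1,2)[OF n] by (simp add: abs_mult mult_right_mono)
        then have "norm (A (Suc n)) * \<bar>(v n)\<^sup>2 - (v (Suc n))\<^sup>2\<bar> \<le> (K * real n powr \<delta>) * ((2 * v n) * (v n - v (Suc n)))"
          using A1[OF n] K by (intro mult_mono) auto
        also have "\<dots> = 2 * K * (v n - v (Suc n)) * (real n powr \<delta> * v n)" by simp
        also have "\<dots> \<le> 2 * K * (v n - v (Suc n)) * 1"
          using v(2,3)[OF n] K by (intro mult_left_mono) auto
        finally show ?thesis by simp
      qed
      finally show ?case by (simp add: algebra_simps)
    qed simp
    have edge: "norm (A n * of_real ((v n)\<^sup>2)) \<le> K * v n" if n: "n \<ge> 1" for n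
    proof -
      have "norm (A n * of_real ((v n)\<^sup>2)) = norm (A n) * (v n)\<^sup>2" by (simp add: norm_mult norm_power)
      also have "\<dots> \<le> (K * real n powr \<delta>) * (v n)\<^sup>2" by (intro mult_right_mono A2[OF n]) auto
      also have "\<dots> = K * v n * (real n powr \<delta> * v n)" by (simp add: power2_eq_square)
      also have "\<dots> \<le> K * v n * 1" using v[OF n] K by (intro mult_left_mono) auto
      finally show ?thesis by simp
    qed
    have "(\<Sum>n=N1..<N2. a n * of_nat n powr (- s)) = (\<Sum>n=N1..<N2. b n * of_real ((v n)\<^sup>2))"
      using N by (intro sum.cong refl trm) auto
    also have "\<dots> = ((\<Sum>n=N1..<N2. b n * of_real ((v n)\<^sup>2)) - A N2 * of_real ((v N2)\<^sup>2) + A N1 * of_real ((v N1)\<^sup>2))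
        + A N2 * of_real ((v N2)\<^sup>2) - A N1 * of_real ((v N1)\<^sup>2)" by simp
    also have "norm \<dots> \<le> 2 * K * (v N1 - v N2) + K * v N2 + K * v N1"
      by (rule order_trans[OF norm_triangle_ineq4], rule add_mono[OF order_trans[OF norm_triangle_ineq add_mono[OF main]]])
         (use edge N in auto)
    also have "\<dots> \<le> 3 * K * v N1"
      using K v(1)[of N2] N by (simp add: algebra_simps)
    also have "\<dots> \<le> 3 * K * real N1 powr (- \<delta>)"
      unfolding v_def using K \<sigma> N by (intro mult_left_mono powr_mono) auto
    finally show ?thesis .
  qed
  then show ?thesis using K unfolding \<delta>_def by (intro exI[of _ "3 * K"]) auto
qed

text \<open>The coefficient side of \<open>O_u\<close>: the translates of the series to the right are multipliers.\<close>
definition locally_mult_bounded :: "(nat \<Rightarrow> complex) \<Rightarrow> bool" where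
  "locally_mult_bounded a \<longleftrightarrow> (\<forall>\<epsilon>>0. \<exists>M. mult_bound M (\<lambda>n. of_real (real n powr (- \<epsilon>)) * a n))"

lemma mult_bound_imp_locally: "mult_bound M a \<Longrightarrow> locally_mult_bounded a"
  unfolding locally_mult_bounded_def using mult_bound_shift by (meson less_imp_le)

lemma dseries_of_mult_bounded:
  assumes a: "locally_mult_bounded a" and a0: "a 0 = 0"
  shows "has_dirichlet_series (dirichlet_function a) a"
proof -
  have "uniform_limit {s. Re s > \<epsilon>} (\<lambda>N s. \<Sum>n<N. a n * of_nat n powr (- s)) (dirichlet_function a) sequentially"
    if \<epsilon>: "\<epsilon> > 0" for \<epsilon>
  proof -
    let ?X = "{s. Re s > \<epsilon>}"
    let ?f = "\<lambda>N s. \<Sum>n<N. a n * of_nat n powr (- s)"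
    \<comment> \<open>Half of \<open>\<epsilon>\<close> makes the coefficients a multiplier, the other half pays for the tail estimate.\<close>
    define b where "b = (\<lambda>n. of_real (real n powr (- (\<epsilon> / 2))) * a n)"
    have "\<exists>M. mult_bound M b" using a \<epsilon> unfolding b_def locally_mult_bounded_def by simp
    then obtain M where M: "mult_bound M b" ..
    obtain K where K: "K \<ge> 0" and bd: "\<And>s N1 N2. Re s \<ge> \<epsilon> / 2 \<Longrightarrow> 1 \<le> N1 \<Longrightarrow> N1 \<le> N2 \<Longrightarrow>
        norm (\<Sum>n=N1..<N2. b n * of_nat n powr (- s)) \<le> K * real N1 powr (- (\<epsilon> / 2 / 2))"
      using dirichlet_tail_bound[OF M, of "\<epsilon> / 2"] \<epsilon> by auto
    have tail: "norm (?f N2 s - ?f N1 s) \<le> K * real N1 powr (- (\<epsilon> / 4))"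
      if s: "s \<in> ?X" and N: "1 \<le> N1" "N1 \<le> N2" for s N1 N2
    proof -
      have "?f N2 s - ?f N1 s = (\<Sum>n=N1..<N2. a n * of_nat n powr (- s))"
        using N by (simp add: sum_diff_nat_ivl flip: atLeast0LessThan)
      also have "\<dots> = (\<Sum>n=N1..<N2. b n * of_nat n powr (- (s - of_real (\<epsilon> / 2))))"
      proof (intro sum.cong refl)
        fix n assume "n \<in> {N1..<N2}"
        then have n: "n > 0" using N by auto
        have "real n powr (- Re s) = real n powr (- (\<epsilon> / 2)) * real n powr (- Re (s - of_real (\<epsilon> / 2)))"
          by (simp flip: powr_add)
        then show "a n * of_nat n powr (- s) = b n * of_nat n powr (- (s - of_real (\<epsilon> / 2)))"
          unfolding b_def of_nat_powr_minus[OF n] by simp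
      qed
      finally show ?thesis using bd[of "s - of_real (\<epsilon> / 2)" N1 N2] s N by (simp add: algebra_simps)
    qed
    have lim0: "(\<lambda>N. K * real N powr (- (\<epsilon> / 4))) \<longlonglongrightarrow> 0"
      using \<epsilon> by real_asymp
    have "uniformly_Cauchy_on ?X ?f"
    proof (rule uniformly_Cauchy_onI')
      fix e :: real assume e: "e > 0"
      then have "\<forall>\<^sub>F N in sequentially. K * real N powr (- (\<epsilon> / 4)) < e"
        using lim0 by (auto dest!: order_tendstoD)
      then obtain N0 where N0: "\<And>N. N \<ge> N0 \<Longrightarrow> K * real N powr (- (\<epsilon> / 4)) < e"
        by (auto simp: eventually_sequentially)
      show "\<exists>M. \<forall>x\<in>?X. \<forall>m\<ge>M. \<forall>n>m. dist (?f m x) (?f n x) < e"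
      proof (intro exI[of _ "max 1 N0"] ballI allI impI)
        fix s m n assume *: "s \<in> ?X" "max 1 N0 \<le> m" "m < n"
        then have "norm (?f n s - ?f m s) \<le> K * real m powr (- (\<epsilon> / 4))" by (intro tail) auto
        also have "\<dots> < e" using * by (intro N0) auto
        finally show "dist (?f m s) (?f n s) < e" by (simp add: dist_norm norm_minus_commute)
      qed
    qed
    then have "uniformly_convergent_on ?X ?f" by (rule Cauchy_uniformly_convergent)
    then have "uniform_limit ?X ?f (\<lambda>s. lim (\<lambda>N. ?f N s)) sequentially"
      by (simp add: uniformly_convergent_uniform_limit_iff)
    moreover have "lim (\<lambda>N. ?f N s) = dirichlet_function a s" if "s \<in> ?X" for s
      using that \<epsilon> by (simp add: dirichlet_function_def right_half_plane_def suminf_eq_lim)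
    ultimately show ?thesis
      using uniform_limit_cong'[of ?X ?f ?f "\<lambda>s. lim (\<lambda>N. ?f N s)" "dirichlet_function a" sequentially] by simp
  qed
  then show ?thesis
    using a0 by (auto simp: has_dirichlet_series_def formal_dirichlet_series_def dirichlet_function_def)
qed

lemma dseries_coeff0: "has_dirichlet_series f a \<Longrightarrow> a 0 = 0"
  by (simp add: has_dirichlet_series_def formal_dirichlet_series_def)

lemma dseries_outside: "has_dirichlet_series f a \<Longrightarrow> s \<notin> right_half_plane \<Longrightarrow> f s = 0"
  by (simp add: has_dirichlet_series_def)

lemma dseries_uniform_limit:
  "has_dirichlet_series f a \<Longrightarrow> \<epsilon> > 0 \<Longrightarrow>
   uniform_limit {s. Re s > \<epsilon>} (\<lambda>N s. \<Sum>n<N. a n * of_nat n powr (- s)) f sequentially"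
  by (simp add: has_dirichlet_series_def)

lemma dseries_sums:
  assumes "has_dirichlet_series f a" "Re s > 0"
  shows "(\<lambda>n. a n * of_nat n powr (- s)) sums f s"
  unfolding sums_def
  by (rule tendsto_uniform_limitI[OF dseries_uniform_limit[OF assms(1), of "Re s / 2"]])
     (use assms in auto)

lemma dseries_eq_dirichlet_function:
  assumes "has_dirichlet_series f a"
  shows "f = dirichlet_function a"
proof
  fix s
  show "f s = dirichlet_function a s"
    using dseries_sums[OF assms, of s] dseries_outside[OF assms, of s]
    by (auto simp: dirichlet_function_def right_half_plane_def sums_iff)
qed

lemma dseries_bounded:
  assumes f: "has_dirichlet_series f a" and \<epsilon>: "\<epsilon> > 0"
  shows "\<exists>K. \<forall>s. Re s > \<epsilon> \<longrightarrow> norm (f s) \<le> K"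
proof -
  let ?f = "\<lambda>N s. \<Sum>n<N. a n * of_nat n powr (- s)"
  have "\<forall>\<^sub>F N in sequentially. \<forall>s\<in>{s. Re s > \<epsilon>}. dist (?f N s) (f s) < 1"
    using dseries_uniform_limit[OF f \<epsilon>] by (rule uniform_limitD) simp
  then obtain N where N: "\<And>s. Re s > \<epsilon> \<Longrightarrow> dist (?f N s) (f s) < 1"
    by (auto simp: eventually_sequentially)
  have "norm (f s) \<le> 1 + (\<Sum>n<N. norm (a n))" if s: "Re s > \<epsilon>" for s
  proof -
    have "norm (a n * of_nat n powr (- s)) \<le> norm (a n)" for n
    proof (cases "n = 0")
      case False
      then have "real n powr (- Re s) \<le> real n powr 0" using s \<epsilon> by (intro powr_mono) auto
      then show ?thesis using False by (simp add: norm_mult norm_of_nat_powr_minus mult_left_le)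
    qed simp
    then have "norm (?f N s) \<le> (\<Sum>n<N. norm (a n))"
      by (intro sum_norm_le)
    then show ?thesis using N[OF s] norm_triangle_ineq2[of "f s" "?f N s"] by (simp add: dist_norm norm_minus_commute)
  qed
  then show ?thesis by blast
qed

lemma dseries_holomorphic:
  assumes f: "has_dirichlet_series f a"
  shows "f holomorphic_on right_half_plane"
proof (rule holomorphic_uniform_sequence)
  show "open right_half_plane" unfolding right_half_plane_def by (rule open_halfspace_Re_gt)
  show "(\<lambda>s. \<Sum>n<N. a n * of_nat n powr (- s)) holomorphic_on right_half_plane" for N
  proof (intro holomorphic_on_sum holomorphic_on_mult holomorphic_on_const)
    fix n
    show "(\<lambda>s. of_nat n powr (- s)) holomorphic_on right_half_plane"
      by (cases "n = 0") (auto intro!: holomorphic_intros)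
  qed
  fix x assume x: "x \<in> right_half_plane"
  then have d: "Re x > 0" by (simp add: right_half_plane_def)
  have sub: "cball x (Re x / 2) \<subseteq> {s. Re s > Re x / 4}"
  proof
    fix s assume "s \<in> cball x (Re x / 2)"
    then have "Re (x - s) \<le> Re x / 2"
      using complex_Re_le_cmod[of "x - s"] by (auto simp: dist_norm)
    then have "Re x / 2 \<le> Re s" by simp
    then show "s \<in> {s. Re s > Re x / 4}" using d by simp
  qed
  have "uniform_limit (cball x (Re x / 2)) (\<lambda>N s. \<Sum>n<N. a n * of_nat n powr (- s)) f sequentially"
    by (rule uniform_limit_on_subset[OF dseries_uniform_limit[OF f] sub]) (use d in simp)
  moreover have "cball x (Re x / 2) \<subseteq> right_half_plane"
    using sub d by (auto simp: right_half_plane_def)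
  ultimately show "\<exists>d>0. cball x d \<subseteq> right_half_plane \<and>
      uniform_limit (cball x d) (\<lambda>N s. \<Sum>n<N. a n * of_nat n powr (- s)) f sequentially"
    using d by (intro exI[of _ "Re x / 2"]) auto
qed

section \<open>Bounded functions as multipliers\<close>

lemma dirichlet_poly_on_line:
  assumes "0 \<notin> S" "Re s = \<sigma>"
  shows "(\<Sum>n\<in>S. p n * of_nat n powr (- s)) =
     (\<Sum>n\<in>S. (of_real (real n powr (- \<sigma>)) * p n) * twist (Im s) n)"
proof (intro sum.cong refl)
  fix n assume "n \<in> S"
  then have "n > 0" using assms by (metis gr0I)
  then show "p n * of_nat n powr (- s) = (of_real (real n powr (- \<sigma>)) * p n) * twist (Im s) n"
    using assms by (simp add: of_nat_powr_minus)
qed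

text \<open>The coefficient side of a bounded function: bounds for the approximating polynomials pass to the limit
  coefficientwise.\<close>
lemma mult_bound_of_line_limit:
  assumes S: "\<And>k. finite (S k)" "\<And>k. 0 \<notin> S k" "\<And>k n. n \<notin> S k \<Longrightarrow> p k n = 0"
    and c: "\<And>n. n > 0 \<Longrightarrow> (\<lambda>k. p k n) \<longlonglongrightarrow> c n"
    and lim: "uniform_limit {s. Re s = \<sigma>} (\<lambda>k s. \<Sum>n\<in>S k. p k n * of_nat n powr (- s)) F sequentially"
    and M: "\<And>s. Re s = \<sigma> \<Longrightarrow> norm (F s) \<le> M"
  shows "mult_bound M (\<lambda>n. of_real (real n powr (- \<sigma>)) * c n)"
proof -
  have "mult_bound (M + \<eta>) (\<lambda>n. of_real (real n powr (- \<sigma>)) * c n)" if \<eta>: "\<eta> > 0" for \<eta>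
  proof (rule mult_bound_tendsto[of sequentially _ _ "\<lambda>_. M + \<eta>"])
    show "\<forall>\<^sub>F k in sequentially. mult_bound (M + \<eta>) (\<lambda>n. of_real (real n powr (- \<sigma>)) * p k n)"
      using uniform_limitD[OF lim \<eta>]
    proof eventually_elim
      case (elim k)
      have "mult_bound (M + \<eta>) (\<lambda>n. if n \<in> S k then of_real (real n powr (- \<sigma>)) * p k n else 0)"
      proof (rule dirichlet_poly_mult_bound[OF S(1,2)])
        fix t
        let ?s = "Complex \<sigma> t"
        have "norm (\<Sum>n\<in>S k. p k n * of_nat n powr (- ?s)) \<le> M + \<eta>"
          using bspec[OF elim, of ?s] M[of ?s]
            norm_triangle_ineq2[of "\<Sum>n\<in>S k. p k n * of_nat n powr (- ?s)" "F ?s"]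
          by (simp add: dist_norm)
        then show "norm (\<Sum>n\<in>S k. of_real (real n powr (- \<sigma>)) * p k n * twist t n) \<le> M + \<eta>"
          using dirichlet_poly_on_line[of "S k" ?s \<sigma> "p k"] S(2) by simp
      qed
      then show ?case by (rule mult_bound_cong) (simp add: S(3))
    qed
    show "(\<lambda>k. of_real (real n powr (- \<sigma>)) * p k n) \<longlonglongrightarrow> of_real (real n powr (- \<sigma>)) * c n" if "n > 0" for n
      by (intro tendsto_intros c that)
  qed auto
  then have ev: "\<forall>\<^sub>F \<eta> in at_right 0. mult_bound (M + \<eta>) (\<lambda>n. of_real (real n powr (- \<sigma>)) * c n)"
    by (auto simp: eventually_at_right_field intro: exI[of _ 1])
  have "((\<lambda>\<eta>. M + \<eta>) \<longlongrightarrow> M + 0) (at_right (0::real))" by (intro tendsto_intros)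
  then show ?thesis
    by (intro mult_bound_tendsto[of "at_right 0" "\<lambda>_. _", OF _ _ _ ev]) auto
qed

text \<open>The bound transfers back to the function even though coefficientwise limits say nothing about uniform ones: the
  differences \<open>P k - P k0\<close> are uniformly small, hence small as multipliers, hence so is the limit
  sequence minus the coefficients of \<open>P k0\<close>. So \<open>P k0\<close> is almost bounded by \<open>M\<close>
  as a multiplier, and being a polynomial also as a function. For \<open>c = 0\<close> and \<open>M = 0\<close> this
  is the uniqueness of the limit function with given coefficients.\<close>
lemma line_limit_bound:
  assumes S: "\<And>k. finite (S k)" "\<And>k. 0 \<notin> S k" "\<And>k n. n \<notin> S k \<Longrightarrow> p k n = 0"
    and c: "\<And>n. n > 0 \<Longrightarrow> (\<lambda>k. p k n) \<longlonglongrightarrow> c n"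
    and lim: "uniform_limit {s. Re s = \<sigma>} (\<lambda>k s. \<Sum>n\<in>S k. p k n * of_nat n powr (- s)) F sequentially"
    and M: "mult_bound M (\<lambda>n. of_real (real n powr (- \<sigma>)) * c n)" and s: "Re s = \<sigma>"
  shows "norm (F s) \<le> M"
proof (rule field_le_epsilon)
  fix \<eta>' :: real assume "\<eta>' > 0"
  define \<eta> where "\<eta> = \<eta>' / 3"
  have \<eta>: "\<eta> > 0" using \<open>\<eta>' > 0\<close> by (simp add: \<eta>_def)
  define q where "q = (\<lambda>k n. of_real (real n powr (- \<sigma>)) * p k n)"
  define d where "d = (\<lambda>n. of_real (real n powr (- \<sigma>)) * c n)"
  define P where "P = (\<lambda>k t. \<Sum>n\<in>S k. q k n * twist t n)"
  have P: "(\<Sum>n\<in>S k. p k n * of_nat n powr (- Complex \<sigma> t)) = P k t" for k t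
    unfolding P_def q_def using dirichlet_poly_on_line[of "S k" "Complex \<sigma> t" \<sigma> "p k"] S(2) by simp
  have ql: "(\<lambda>k. q k n) \<longlonglongrightarrow> d n" if "n > 0" for n
    unfolding q_def d_def by (intro tendsto_intros c that)
  define t where "t = Im s"
  have seq: "s = Complex \<sigma> t" using s by (simp add: t_def complex_eq_iff)
  obtain k0 where k0': "\<forall>k\<ge>k0. \<forall>x\<in>{s. Re s = \<sigma>}. dist (\<Sum>n\<in>S k. p k n * of_nat n powr (- x)) (F x) < \<eta>"
    using uniform_limitD[OF lim \<eta>] unfolding eventually_sequentially by blast
  have k0: "norm (P k t - F (Complex \<sigma> t)) < \<eta>" if "k \<ge> k0" for k t
    using k0'[rule_format, OF that, of "Complex \<sigma> t"] by (simp add: dist_norm P)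
  have cauchy: "norm (P k t - P k0 t) \<le> 2 * \<eta>" if "k \<ge> k0" for k t
    using k0[OF that, of t] k0[of k0 t] norm_triangle_ineq4[of "P k t - F (Complex \<sigma> t)" "P k0 t - F (Complex \<sigma> t)"]
    by simp
  have q0: "q k n = 0" if "n \<notin> S k" for k n using S(3)[OF that] by (simp add: q_def)
  have "mult_bound (2 * \<eta>) (\<lambda>n. d n - q k0 n)"
  proof (rule mult_bound_tendsto[of sequentially "\<lambda>k n. q k n - q k0 n" _ "\<lambda>_. 2 * \<eta>"])
    show "(\<lambda>k. q k n - q k0 n) \<longlonglongrightarrow> d n - q k0 n" if "n > 0" for n
      by (intro tendsto_intros ql that)
    show "\<forall>\<^sub>F k in sequentially. mult_bound (2 * \<eta>) (\<lambda>n. q k n - q k0 n)"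
      using eventually_ge_at_top[of k0]
    proof eventually_elim
      case (elim k)
      let ?S = "S k \<union> S k0"
      have fin: "finite ?S" "0 \<notin> ?S" using S by auto
      have "P j t = (\<Sum>n\<in>?S. q j n * twist t n)" if "j = k \<or> j = k0" for j t
        unfolding P_def using fin q0 that by (intro sum.mono_neutral_left) auto
      then have "norm (\<Sum>n\<in>?S. (q k n - q k0 n) * twist t n) \<le> 2 * \<eta>" for t
        using cauchy[OF elim, of t] by (simp add: left_diff_distrib sum_subtractf)
      from dirichlet_poly_mult_bound[OF fin this] show ?case
        by (rule mult_bound_cong) (use q0 in auto)
    qed
  qed auto
  \<comment> \<open>The coefficients of \<open>P k0\<close> are \<open>d - (d - q k0)\<close>.\<close>
  from mult_bound_add[OF M mult_bound_cmult[OF this, of "-1"]]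
  have "mult_bound (M + 2 * \<eta>) (q k0)" by (simp add: d_def)
  then have "norm (P k0 t) \<le> M + 2 * \<eta>"
    unfolding P_def using S q0 by (intro mult_bound_dirichlet_poly) auto
  then show "norm (F s) \<le> M + \<eta>'"
    using k0[of k0 t] norm_triangle_ineq2[of "F s" "P k0 t"]
    by (simp add: seq norm_minus_commute \<eta>_def)
qed

lemma dseries_line_limit:
  assumes f: "has_dirichlet_series f a" and \<sigma>: "\<sigma> > 0"
  shows "uniform_limit {s. Re s = \<sigma>} (\<lambda>k s. \<Sum>n\<in>{1..<k}. (if n < k then a n else 0) * of_nat n powr (- s)) f sequentially"
proof -
  have "uniform_limit {s. Re s = \<sigma>} (\<lambda>k s. \<Sum>n<k. a n * of_nat n powr (- s)) f sequentially"
    by (rule uniform_limit_on_subset[OF dseries_uniform_limit[OF f, of "\<sigma> / 2"]]) (use \<sigma> in auto)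
  moreover have "(\<Sum>n<k. a n * of_nat n powr (- s)) = (\<Sum>n\<in>{1..<k}. (if n < k then a n else 0) * of_nat n powr (- s))" for k s
    by (rule sum.mono_neutral_cong_right) (auto simp: not_less_eq_eq)
  ultimately show ?thesis by simp
qed

lemma dseries_line_mult_bound:
  assumes f: "has_dirichlet_series f a" and \<sigma>: "\<sigma> > 0" and M: "\<And>s. Re s = \<sigma> \<Longrightarrow> norm (f s) \<le> M"
  shows "mult_bound M (\<lambda>n. of_real (real n powr (- \<sigma>)) * a n)"
proof (rule mult_bound_of_line_limit[OF _ _ _ _ dseries_line_limit[OF f \<sigma>] M])
  show "(\<lambda>k. if n < k then a n else 0) \<longlonglongrightarrow> a n" for n
    by (rule tendsto_eventually, rule eventually_mono[OF eventually_gt_at_top[of n]]) simp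
qed (use dseries_coeff0[OF f] in \<open>auto simp: not_less_eq_eq\<close>)

lemma dseries_locally_mult_bounded:
  assumes f: "has_dirichlet_series f a"
  shows "locally_mult_bounded a"
  unfolding locally_mult_bounded_def
proof (intro allI impI)
  fix \<epsilon> :: real assume \<epsilon>: "\<epsilon> > 0"
  obtain K where "\<And>s. Re s > \<epsilon> / 2 \<Longrightarrow> norm (f s) \<le> K"
    using dseries_bounded[OF f, of "\<epsilon> / 2"] \<epsilon> by auto
  then show "\<exists>M. mult_bound M (\<lambda>n. of_real (real n powr (- \<epsilon>)) * a n)"
    using \<epsilon> by (intro exI[of _ K] dseries_line_mult_bound[OF f]) auto
qed

text \<open>Both directions work on vertical lines. In one the line tends to the imaginary axis; in the other \<open>n powr (-
  \<sigma>)\<close> is a contractive weight. So the supremum norm on the half-plane is the multiplier norm of the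
  coefficients.\<close>
lemma bounded_iff_mult_bound:
  assumes f: "has_dirichlet_series f a"
  shows "(\<forall>s\<in>right_half_plane. norm (f s) \<le> M) \<longleftrightarrow> mult_bound M a"
proof
  assume M: "\<forall>s\<in>right_half_plane. norm (f s) \<le> M"
  show "mult_bound M a"
  proof (rule mult_bound_tendsto[of "at_right 0" _ _ "\<lambda>_. M"])
    show "\<forall>\<^sub>F \<sigma> in at_right 0. mult_bound M (\<lambda>n. of_real (real n powr (- \<sigma>)) * a n)"
      unfolding eventually_at_right_field using M
      by (auto intro!: exI[of _ 1] dseries_line_mult_bound[OF f] simp: right_half_plane_def)
    show "((\<lambda>\<sigma>. of_real (real n powr (- \<sigma>)) * a n) \<longlongrightarrow> a n) (at_right 0)" if "n > 0" for n
    proof -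
      have "((\<lambda>\<sigma>. of_real (real n powr (- \<sigma>)) * a n) \<longlongrightarrow> of_real (real n powr (- 0)) * a n) (at_right 0)"
        using that by (intro tendsto_intros) auto
      then show ?thesis using that by simp
    qed
  qed auto
next
  assume M: "mult_bound M a"
  show "\<forall>s\<in>right_half_plane. norm (f s) \<le> M"
  proof
    fix s assume "s \<in> right_half_plane"
    then have \<sigma>: "Re s > 0" by (simp add: right_half_plane_def)
    show "norm (f s) \<le> M"
    proof (rule line_limit_bound[OF _ _ _ _ dseries_line_limit[OF f \<sigma>]])
      show "(\<lambda>k. if n < k then a n else 0) \<longlonglongrightarrow> a n" for n
        by (rule tendsto_eventually, rule eventually_mono[OF eventually_gt_at_top[of n]]) simp
      show "mult_bound M (\<lambda>n. of_real (real n powr (- Re s)) * a n)"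
        using mult_bound_shift[OF M] \<sigma> by simp
    qed (use dseries_coeff0[OF f] in \<open>auto simp: not_less_eq_eq\<close>)
  qed
qed

lemma dseries_add:
  assumes "has_dirichlet_series f a" "has_dirichlet_series g b"
  shows "has_dirichlet_series (\<lambda>s. f s + g s) (\<lambda>n. a n + b n)"
  using assms unfolding has_dirichlet_series_def
  by (auto simp: formal_dirichlet_series_def distrib_right sum.distrib intro!: uniform_limit_intros)

lemma dseries_cmult:
  assumes "has_dirichlet_series f a"
  shows "has_dirichlet_series (\<lambda>s. c * f s) (\<lambda>n. c * a n)"
  using assms unfolding has_dirichlet_series_def
  by (auto simp: formal_dirichlet_series_def mult.assoc simp flip: sum_distrib_left
      intro!: bounded_linear.uniform_limit[OF bounded_linear_mult_right])

lemma dseries_diff: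
  assumes "has_dirichlet_series f a" "has_dirichlet_series g b"
  shows "has_dirichlet_series (\<lambda>s. f s - g s) (\<lambda>n. a n - b n)"
  using dseries_add[OF assms(1) dseries_cmult[OF assms(2), of "-1"]] by simp

lemma dseries_unique:
  assumes "has_dirichlet_series f a" "has_dirichlet_series f b"
  shows "a = b"
proof
  fix n
  have 0: "has_dirichlet_series (\<lambda>s. 0) (\<lambda>n. a n - b n)"
    using dseries_diff[OF assms] by simp
  have "mult_bound 0 (\<lambda>n. a n - b n)"
    using bounded_iff_mult_bound[OF 0, of 0] by simp
  then show "a n = b n"
    using mult_bound_coeff[of 0 "\<lambda>n. a n - b n" n] dseries_coeff0[OF 0]
    by (cases "n = 0") auto
qed

lemma dirichlet_coeffs_eq:
  assumes "has_dirichlet_series f a"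
  shows "dirichlet_coeffs f = a"
  unfolding dirichlet_coeffs_def using assms dseries_unique by blast

definition dirichlet_conv :: "(nat \<Rightarrow> complex) \<Rightarrow> (nat \<Rightarrow> complex) \<Rightarrow> nat \<Rightarrow> complex" where
  "dirichlet_conv a b n = (\<Sum>d | d dvd n. a d * b (n div d))"

lemma of_nat_mult_powr_minus:
  assumes "m > 0" "n > 0"
  shows "(of_nat m * of_nat n) powr (- s) = of_nat m powr (- s) * (of_nat n powr (- s) :: complex)"
proof -
  have "(of_nat m * of_nat n) powr (- s) = of_nat (m * n) powr (- s)" by simp
  also have "\<dots> = of_nat m powr (- s) * of_nat n powr (- s)"
    using assms by (subst (1 2 3) of_nat_powr_minus) (auto simp: powr_mult ln_mult cis_mult algebra_simps)
  finally show ?thesis .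
qed

text \<open>Products of partial sums are Dirichlet polynomials that converge to \<open>f g\<close> uniformly on vertical lines and
  have the right coefficients in the limit. Boundedness of \<open>f g\<close> makes the convolution locally a
  multiplier, so its series converges to some function \<open>h\<close>; the difference \<open>f g - h\<close> is a
  limit of polynomials with coefficients tending to zero, hence zero.\<close>
lemma dseries_product:
  assumes f: "has_dirichlet_series f a" and g: "has_dirichlet_series g b"
  shows "has_dirichlet_series (\<lambda>s. f s * g s) (dirichlet_conv a b)"
proof -
  define c where "c = dirichlet_conv a b"
  define D where "D = (\<lambda>k::nat. {1..<k} \<times> {1..<k})"
  define p where "p = (\<lambda>k n. \<Sum>(d,e) | (d,e) \<in> D k \<and> d * e = n. a d * b e)"
  define S where "S = (\<lambda>k. {1..<k * k :: nat})"
  have D: "finite (D k)" "(\<lambda>(d,e). d * e) ` D k \<subseteq> S k" for k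
    by (auto simp: D_def S_def Suc_le_eq intro!: mult_strict_mono)
  have S: "finite (S k)" "0 \<notin> S k" for k by (auto simp: S_def)
  have p0: "p k n = 0" if "n \<notin> S k" for k n
  proof -
    have "{(d,e). (d,e) \<in> D k \<and> d * e = n} = {}" using D(2)[of k] that by force
    then show ?thesis by (simp only: p_def sum.empty)
  qed
  have pc: "p k n = c n" if "n > 0" "n < k" for k n
    unfolding p_def c_def dirichlet_conv_def
  proof (rule sum.reindex_bij_witness[of _ "\<lambda>d. (d, n div d)" fst], goal_cases)
    case (4 d)
    then have "d \<le> n" "d \<noteq> 0" "n div d \<noteq> 0" using that by (auto dest: dvd_imp_le intro: gr0I simp: dvd_div_eq_0_iff)
    moreover have "n div d < k" using that(2) by (rule le_less_trans[OF div_le_dividend])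
    ultimately show ?case using 4 that unfolding D_def by (auto simp: Suc_le_eq)
  qed (use that in \<open>auto simp: D_def\<close>)
  have ev: "\<forall>\<^sub>F k in sequentially. p k n = c n" if "n > 0" for n
    using eventually_gt_at_top[of n] by eventually_elim (use pc that in auto)
  have P: "(\<Sum>n\<in>S k. p k n * of_nat n powr (- s))
     = (\<Sum>d\<in>{1..<k}. (if d < k then a d else 0) * of_nat d powr (- s)) * (\<Sum>e\<in>{1..<k}. (if e < k then b e else 0) * of_nat e powr (- s))" for k s
  proof -
    have "(\<Sum>n\<in>S k. p k n * of_nat n powr (- s))
      = (\<Sum>n\<in>S k. \<Sum>de | de \<in> D k \<and> (\<lambda>(d,e). d * e) de = n. (\<lambda>(d,e). (a d * of_nat d powr (- s)) * (b e * of_nat e powr (- s))) de)"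
      unfolding p_def sum_distrib_right
      by (intro sum.cong refl) (auto simp: of_nat_mult_powr_minus mult_ac D_def)
    also have "\<dots> = (\<Sum>(d,e)\<in>D k. (a d * of_nat d powr (- s)) * (b e * of_nat e powr (- s)))"
      using sum.group[OF D(1) S(1) D(2)] by blast
    also have "\<dots> = (\<Sum>d\<in>{1..<k}. a d * of_nat d powr (- s)) * (\<Sum>e\<in>{1..<k}. b e * of_nat e powr (- s))"
      unfolding D_def sum_product sum.cartesian_product ..
    finally show ?thesis by simp
  qed
  have ul: "uniform_limit {s. Re s = \<sigma>} (\<lambda>k s. \<Sum>n\<in>S k. p k n * of_nat n powr (- s)) (\<lambda>s. f s * g s) sequentially"
    and bd: "\<exists>K. \<forall>s. Re s = \<sigma> \<longrightarrow> norm (f s * g s) \<le> K" if \<sigma>: "\<sigma> > 0" for \<sigma>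
  proof -
    obtain K1 where K1: "\<And>s. Re s > \<sigma> / 2 \<Longrightarrow> norm (f s) \<le> K1"
      using dseries_bounded[OF f, of "\<sigma> / 2"] \<sigma> by auto
    obtain K2 where K2: "\<And>s. Re s > \<sigma> / 2 \<Longrightarrow> norm (g s) \<le> K2"
      using dseries_bounded[OF g, of "\<sigma> / 2"] \<sigma> by auto
    show "uniform_limit {s. Re s = \<sigma>} (\<lambda>k s. \<Sum>n\<in>S k. p k n * of_nat n powr (- s)) (\<lambda>s. f s * g s) sequentially"
      unfolding P
    proof (intro uniform_lim_mult dseries_line_limit[OF f \<sigma>] dseries_line_limit[OF g \<sigma>])
      show "bounded (f ` {s. Re s = \<sigma>})" unfolding bounded_iff using K1 \<sigma> by (intro exI[of _ K1]) auto
      show "bounded (g ` {s. Re s = \<sigma>})" unfolding bounded_iff using K2 \<sigma> by (intro exI[of _ K2]) auto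
    qed
    have "norm (f s * g s) \<le> K1 * K2" if "Re s = \<sigma>" for s
      unfolding norm_mult using K1[of s] K2[of s] that \<sigma> order_trans[OF norm_ge_zero, of "f s" K1]
      by (intro mult_mono) auto
    then show "\<exists>K. \<forall>s. Re s = \<sigma> \<longrightarrow> norm (f s * g s) \<le> K" by blast
  qed
  have "locally_mult_bounded c"
    unfolding locally_mult_bounded_def
  proof (intro allI impI)
    fix \<sigma> :: real assume \<sigma>: "\<sigma> > 0"
    from bd[OF \<sigma>] obtain K where K: "\<And>s. Re s = \<sigma> \<Longrightarrow> norm (f s * g s) \<le> K" by blast
    have "mult_bound K (\<lambda>n. of_real (real n powr (- \<sigma>)) * c n)"
      using ev by (intro mult_bound_of_line_limit[OF S p0 _ ul[OF \<sigma>] K]) (auto intro: tendsto_eventually)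
    then show "\<exists>M. mult_bound M (\<lambda>n. of_real (real n powr (- \<sigma>)) * c n)" ..
  qed
  moreover have "c 0 = 0" by (simp add: c_def dirichlet_conv_def)
  ultimately have h: "has_dirichlet_series (dirichlet_function c) c"
    by (rule dseries_of_mult_bounded)
  have "f s * g s = dirichlet_function c s" for s
  proof (cases "Re s > 0")
    case False
    then have "s \<notin> right_half_plane" by (simp add: right_half_plane_def)
    then show ?thesis using dseries_outside[OF f] dseries_outside[OF h] by simp
  next
    case True
    \<comment> \<open>The difference of the two approximating sequences, with coefficients tending to zero.\<close>
    define q where "q = (\<lambda>k n. p k n - (if n \<in> {1..<k} then c n else 0))"
    have sub: "{1..<k} \<subseteq> S k" for k
      unfolding S_def using le_square[of k] by (auto intro: less_le_trans)
    have "uniform_limit {z. Re z = Re s} (\<lambda>k z. (\<Sum>n\<in>S k. p k n * of_nat n powr (- z)) - (\<Sum>n\<in>{1..<k}. (if n < k then c n else 0) * of_nat n powr (- z)))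
       (\<lambda>z. f z * g z - dirichlet_function c z) sequentially"
      by (intro uniform_limit_minus ul[OF True] dseries_line_limit[OF h True])
    moreover have "(\<Sum>n\<in>S k. p k n * of_nat n powr (- z)) - (\<Sum>n\<in>{1..<k}. (if n < k then c n else 0) * of_nat n powr (- z))
       = (\<Sum>n\<in>S k. q k n * of_nat n powr (- z))" for k z
    proof -
      have "(\<Sum>n\<in>{1..<k}. (if n < k then c n else 0) * of_nat n powr (- z)) = (\<Sum>n\<in>S k. (if n \<in> {1..<k} then c n else 0) * of_nat n powr (- z))"
        using sub S by (intro sum.mono_neutral_cong_left) auto
      then show ?thesis by (simp add: q_def left_diff_distrib sum_subtractf)
    qed
    ultimately have lim: "uniform_limit {z. Re z = Re s} (\<lambda>k z. \<Sum>n\<in>S k. q k n * of_nat n powr (- z))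
       (\<lambda>z. f z * g z - dirichlet_function c z) sequentially" by simp
    have "norm (f s * g s - dirichlet_function c s) \<le> 0"
    proof (rule line_limit_bound[OF S _ _ lim, of "\<lambda>_. 0"])
      show "q k n = 0" if "n \<notin> S k" for k n using p0[OF that] sub[of k] that by (auto simp: q_def)
      show "(\<lambda>k. q k n) \<longlonglongrightarrow> 0" if n: "n > 0" for n
      proof (rule tendsto_eventually)
        show "\<forall>\<^sub>F k in sequentially. q k n = 0"
          using eventually_gt_at_top[of n] by eventually_elim (use pc n in \<open>auto simp: q_def\<close>)
      qed
      show "mult_bound 0 (\<lambda>n. of_real (real n powr (- Re s)) * 0)" by (rule mult_boundI) simp
    qed simp
    then show ?thesis by simp
  qed
  then have "(\<lambda>s. f s * g s) = dirichlet_function c" by blast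
  then show ?thesis using h by (simp add: c_def)
qed

section \<open>Orbit averages for multiplicative group actions\<close>

text \<open>The functions in \<open>H\<close> are only constrained on positive arguments, hence the group axioms in existential
  form.\<close>
locale multiplicative_group =
  fixes H :: "(nat \<Rightarrow> nat) set"
  assumes pos: "h \<in> H \<Longrightarrow> n > 0 \<Longrightarrow> h n > 0"
    and map_mult: "h \<in> H \<Longrightarrow> m > 0 \<Longrightarrow> n > 0 \<Longrightarrow> h (m * n) = h m * h n"
    and ident: "\<exists>e\<in>H. \<forall>n>0. e n = n"
    and comp: "h \<in> H \<Longrightarrow> k \<in> H \<Longrightarrow> \<exists>l\<in>H. \<forall>n>0. l n = h (k n)"
    and inverse: "h \<in> H \<Longrightarrow> \<exists>k\<in>H. \<forall>n>0. k (h n) = n \<and> h (k n) = n"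
begin

definition orbit :: "nat \<Rightarrow> nat set" where
  "orbit n = (\<lambda>h. h n) ` H"

definition finitary :: "nat set" where
  "finitary = {n. n > 0 \<and> finite (orbit n)}"

definition average :: "(nat \<Rightarrow> complex) \<Rightarrow> nat \<Rightarrow> complex" where
  "average a n = (if n \<in> finitary then (\<Sum>k\<in>orbit n. a k) / of_nat (card (orbit n)) else 0)"

lemma finitary_pos: "n \<in> finitary \<Longrightarrow> n > 0"
  by (simp add: finitary_def)

lemma map_inj: "h \<in> H \<Longrightarrow> m > 0 \<Longrightarrow> n > 0 \<Longrightarrow> h m = h n \<Longrightarrow> m = n"
  using inverse by metis

lemma map_one:
  assumes "h \<in> H"
  shows "h 1 = 1"
proof -
  have "h 1 = h 1 * h 1" using map_mult[OF assms, of 1 1] by simp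
  then show ?thesis using pos[OF assms, of 1] by simp
qed

lemma map_dvd: "h \<in> H \<Longrightarrow> m > 0 \<Longrightarrow> n dvd m \<Longrightarrow> h n dvd h m"
  by (auto elim!: dvdE simp: map_mult)

lemma map_dvd_iff: "h \<in> H \<Longrightarrow> m > 0 \<Longrightarrow> n > 0 \<Longrightarrow> h n dvd h m \<longleftrightarrow> n dvd m"
  using inverse[of h] map_dvd pos by metis

lemma map_div:
  assumes "h \<in> H" "m > 0" "n dvd m"
  shows "h (m div n) = h m div h n"
proof -
  obtain d where d: "m = n * d" using assms(3) by blast
  then have "n > 0" "d > 0" using assms(2) by auto
  then show ?thesis using assms pos[of h n] by (simp add: d map_mult)
qed

lemma orbit_refl: "n > 0 \<Longrightarrow> n \<in> orbit n"
proof -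
  assume "n > 0"
  obtain e where e: "e \<in> H" "\<forall>n>0. e n = n" using ident by blast
  have "e n \<in> orbit n" unfolding orbit_def using e(1) by (rule imageI)
  then show ?thesis using e(2) \<open>n > 0\<close> by simp
qed

lemma orbit_pos: "n > 0 \<Longrightarrow> k \<in> orbit n \<Longrightarrow> k > 0"
  using pos by (auto simp: orbit_def)

lemma orbit_subset:
  assumes h: "h \<in> H" and n: "n > 0"
  shows "orbit (h n) \<subseteq> orbit n"
proof
  fix m assume "m \<in> orbit (h n)"
  then obtain k where k: "k \<in> H" "m = k (h n)" by (auto simp: orbit_def)
  then obtain l where l: "l \<in> H" "\<forall>n>0. l n = k (h n)" using comp[OF k(1) h] by blast
  then have "m = l n" using n k(2) by simp
  then show "m \<in> orbit n" unfolding orbit_def using l(1) by (rule image_eqI)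
qed

lemma orbit_map:
  assumes "h \<in> H" "n > 0"
  shows "orbit (h n) = orbit n"
proof -
  obtain k where "k \<in> H" "k (h n) = n" using inverse[OF assms(1)] assms(2) by blast
  then show ?thesis using orbit_subset[of k "h n"] orbit_subset[OF assms] pos[OF assms] by auto
qed

lemma orbit_transitive:
  assumes "n > 0" "k \<in> orbit n" "k' \<in> orbit n"
  shows "\<exists>l\<in>H. l k = k'"
proof -
  obtain h where "h \<in> H" "k = h n" using assms(2) by (auto simp: orbit_def)
  then have "k' \<in> orbit k" using orbit_map assms(1,3) by simp
  then show ?thesis by (auto simp: orbit_def)
qed

lemma finitary_map: "h \<in> H \<Longrightarrow> n > 0 \<Longrightarrow> h n \<in> finitary \<longleftrightarrow> n \<in> finitary"
  by (simp add: finitary_def orbit_map pos)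

text \<open>Orbits of products lie in products of orbits. Conversely the orbit of a divisor consists of divisors of orbit
  elements.\<close>
lemma finitary_mult:
  assumes "m > 0" "n > 0"
  shows "m * n \<in> finitary \<longleftrightarrow> m \<in> finitary \<and> n \<in> finitary"
proof
  assume "m \<in> finitary \<and> n \<in> finitary"
  then have "finite ((\<lambda>(x, y). x * y) ` (orbit m \<times> orbit n))" by (auto simp: finitary_def)
  moreover have "orbit (m * n) \<subseteq> (\<lambda>(x, y). x * y) ` (orbit m \<times> orbit n)"
    using assms by (auto simp: orbit_def map_mult)
  ultimately show "m * n \<in> finitary" using assms finite_subset by (auto simp: finitary_def)
next
  assume fin: "m * n \<in> finitary"
  have "finite (orbit k)" if k: "k dvd m * n" for k
  proof (rule finite_subset)
    show "orbit k \<subseteq> (\<Union>l\<in>orbit (m * n). {d. d dvd l})"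
    proof
      fix d assume "d \<in> orbit k"
      then obtain h where h: "h \<in> H" "d = h k" by (auto simp: orbit_def)
      have "d dvd h (m * n)" unfolding h(2) using assms by (intro map_dvd[OF h(1) _ k]) simp
      moreover have "h (m * n) \<in> orbit (m * n)" using h(1) by (simp add: orbit_def)
      ultimately show "d \<in> (\<Union>l\<in>orbit (m * n). {d. d dvd l})" by blast
    qed
    show "finite (\<Union>l\<in>orbit (m * n). {d. d dvd l})"
      using fin assms orbit_pos[of "m * n"] by (auto simp: finitary_def)
  qed
  then show "m \<in> finitary \<and> n \<in> finitary" using assms by (auto simp: finitary_def)
qed

lemma finitary_dvd: "n \<in> finitary \<Longrightarrow> d dvd n \<Longrightarrow> d \<in> finitary"
  using finitary_pos[of n] finitary_mult by (metis dvdE nat_0_less_mult_iff)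

lemma one_finitary: "1 \<in> finitary"
proof -
  have "orbit 1 \<subseteq> {1}" using map_one by (auto simp: orbit_def)
  then show ?thesis using finite_subset by (auto simp: finitary_def)
qed

text \<open>On a finite set \<open>D\<close> of numbers with finite orbits, \<open>H\<close> acts through finitely many
  restrictions. Choose one representative for each. For \<open>d\<close> in \<open>D\<close> every point of the orbit
  of \<open>d\<close> is hit equally often, since composition with an element of \<open>H\<close> permutes the
  restrictions. So averaging over orbits is averaging over finitely many elements of \<open>H\<close>.\<close>
lemma average_finite:
  assumes D: "finite D" "D \<subseteq> finitary"
  obtains R where "R \<subseteq> H" "finite R" "R \<noteq> {}"
    "\<And>d a. d \<in> D \<Longrightarrow> average a d = (\<Sum>h\<in>R. a (h d)) / of_nat (card R)"
proof -
  let ?r = "\<lambda>h. restrict h D"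
  have "?r ` H \<subseteq> PiE D orbit" by (auto simp: orbit_def)
  moreover have "finite (PiE D orbit)" using D by (intro finite_PiE) (auto simp: finitary_def)
  ultimately have fin: "finite (?r ` H)" by (rule finite_subset)
  obtain R where R: "R \<subseteq> H" "inj_on ?r R" "?r ` H = ?r ` R"
    using subset_image_inj[of "?r ` H" ?r H] by auto
  have finR: "finite R" using fin R by (simp add: finite_image_iff)
  have Rne: "R \<noteq> {}" using R ident by auto
  have rep: "\<exists>h'\<in>R. \<forall>d\<in>D. h' d = h d" if "h \<in> H" for h
  proof -
    have "?r h \<in> ?r ` R" using R that by blast
    then obtain h' where "h' \<in> R" "?r h = ?r h'" by blast
    then show ?thesis by (metis restrict_apply')
  qed
  have Req: "h = h'" if "h \<in> R" "h' \<in> R" "\<And>d. d \<in> D \<Longrightarrow> h d = h' d" for h h'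
    using R(2) that by (auto simp: inj_on_def intro!: restrict_ext)
  have "average a d = (\<Sum>h\<in>R. a (h d)) / of_nat (card R)" if d: "d \<in> D" for a d
  proof -
    define F where "F = (\<lambda>k. {h \<in> R. h d = k})"
    have dpos: "d > 0" using d D finitary_pos by auto
    have dfin: "d \<in> finitary" using d D by auto
    have le: "card (F k) \<le> card (F k')" if k: "k \<in> orbit d" "k' \<in> orbit d" for k k'
    proof -
      obtain l where l: "l \<in> H" "l k = k'" using orbit_transitive[OF dpos k] by blast
      have "\<exists>h'\<in>R. \<forall>d\<in>D. h' d = l (h d)" if h: "h \<in> R" for h
      proof -
        obtain g where "g \<in> H" "\<forall>n>0. g n = l (h n)" using comp l h R by blast
        then show ?thesis using rep[of g] D finitary_pos by (metis subsetD)
      qed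
      then obtain \<rho> where \<rho>: "\<And>h. h \<in> R \<Longrightarrow> \<rho> h \<in> R \<and> (\<forall>d\<in>D. \<rho> h d = l (h d))" by metis
      show ?thesis
      proof (rule card_inj_on_le)
        show "inj_on \<rho> (F k)"
        proof (rule inj_onI)
          fix h h' assume hh: "h \<in> F k" "h' \<in> F k" "\<rho> h = \<rho> h'"
          show "h = h'"
          proof (rule Req)
            fix x assume x: "x \<in> D"
            have "h \<in> R" "h' \<in> R" using hh by (simp_all add: F_def)
            then have "\<rho> h x = l (h x)" "\<rho> h' x = l (h' x)" using \<rho> x by blast+
            then have "l (h x) = l (h' x)" using hh(3) by simp
            have "h \<in> H" "h' \<in> H" using \<open>h \<in> R\<close> \<open>h' \<in> R\<close> R(1) by blast+
            moreover have "x > 0" using x D(2) finitary_pos by blast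
            ultimately have "h x > 0" "h' x > 0" using pos by blast+
            with \<open>l (h x) = l (h' x)\<close> show "h x = h' x" using map_inj[OF l(1)] by blast
          qed (use hh in \<open>auto simp: F_def\<close>)
        qed
        show "\<rho> ` F k \<subseteq> F k'" using \<rho> l d by (auto simp: F_def)
        show "finite (F k')" using finR by (simp add: F_def)
      qed
    qed
    define c where "c = card (F d)"
    have c: "card (F k) = c" if "k \<in> orbit d" for k
      unfolding c_def using le that orbit_refl[OF dpos] by (intro antisym) auto
    have fo: "finite (orbit d)" using dfin by (simp add: finitary_def)
    have img: "(\<lambda>h. h d) ` R \<subseteq> orbit d" using R by (auto simp: orbit_def)
    have S: "(\<Sum>h\<in>R. b (h d)) = of_nat c * (\<Sum>k\<in>orbit d. b k)" for b :: "nat \<Rightarrow> complex"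
    proof -
      have "(\<Sum>h\<in>R. b (h d)) = (\<Sum>k\<in>orbit d. \<Sum>h | h \<in> R \<and> h d = k. b (h d))"
        by (rule sum.group[OF finR fo img, symmetric])
      also have "\<dots> = (\<Sum>k\<in>orbit d. of_nat c * b k)"
      proof (intro sum.cong refl)
        fix k assume k: "k \<in> orbit d"
        have "(\<Sum>h | h \<in> R \<and> h d = k. b (h d)) = (\<Sum>h\<in>F k. b k)" unfolding F_def by (intro sum.cong) auto
        then show "(\<Sum>h | h \<in> R \<and> h d = k. b (h d)) = of_nat c * b k" using c[OF k] by simp
      qed
      finally show ?thesis by (simp add: sum_distrib_left)
    qed
    have "of_nat (card R) = (of_nat c * of_nat (card (orbit d)) :: complex)" using S[of "\<lambda>_. 1"] by simp
    moreover have "card R \<noteq> 0" using finR Rne by simp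
    ultimately show ?thesis using S[of a] dfin by (auto simp: average_def)
  qed
  then show ?thesis using that[OF R(1) finR Rne] by blast
qed

text \<open>A multiplicative bijection permutes the entries of the convolution matrix by a permutation of the index set.\<close>
lemma mult_bound_map:
  assumes h: "h \<in> H" and a: "mult_bound M a"
  shows "mult_bound M (\<lambda>n. a (h n))"
proof (rule mult_boundI)
  fix I :: "nat set" and x y :: "nat \<Rightarrow> complex"
  assume I: "finite I" "0 \<notin> I"
  have Ipos: "n > 0" if "n \<in> I" for n using that I by (metis gr0I)
  obtain k where k: "\<forall>n>0. k (h n) = n \<and> h (k n) = n" using inverse[OF h] by blast
  have inj: "inj_on h I" using map_inj[OF h] Ipos by (auto simp: inj_on_def)
  have "(\<Sum>m\<in>h ` I. \<Sum>n\<in>h ` I. (if n dvd m then a (m div n) else 0) * x (k n) * y (k m))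
    = (\<Sum>m\<in>I. \<Sum>n\<in>I. (if h n dvd h m then a (h m div h n) else 0) * x (k (h n)) * y (k (h m)))"
    by (simp add: sum.reindex[OF inj])
  also have "\<dots> = (mult_form I (\<lambda>n. a (h n)) x y)"
    by (intro sum.cong refl) (simp add: k Ipos map_dvd_iff[OF h] map_div[OF h])
  finally have "2 * norm (mult_form I (\<lambda>n. a (h n)) x y)
      \<le> M * (\<Sum>n\<in>h ` I. (norm (x (k n)))\<^sup>2 + (norm (y (k n)))\<^sup>2)"
    using mult_boundD[OF a, of "h ` I" "\<lambda>n. x (k n)" "\<lambda>n. y (k n)"] I pos[OF h] Ipos
    by (auto simp: image_iff)
  also have "(\<Sum>n\<in>h ` I. (norm (x (k n)))\<^sup>2 + (norm (y (k n)))\<^sup>2) = energy I x y"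
    by (simp add: sum.reindex[OF inj] k Ipos cong: sum.cong)
  finally show "2 * norm (mult_form I (\<lambda>n. a (h n)) x y)
      \<le> M * energy I x y" .
qed

text \<open>First cut \<open>a\<close> down to the numbers with finite orbit, by a completely multiplicative weight; on the
  finitely many quotients that occur in a bilinear form, the projection is then a mean of sequences \<open>a (h
  n)\<close>, each with the same bound.\<close>
lemma mult_bound_orbit_average:
  assumes a: "mult_bound M a"
  shows "mult_bound M (average a)"
proof (rule mult_boundI)
  fix I :: "nat set" and x y :: "nat \<Rightarrow> complex"
  assume I: "finite I" "0 \<notin> I"
  have Ipos: "n > 0" if "n \<in> I" for n using that I by (metis gr0I)
  define a' where "a' = (\<lambda>n. of_real (if n \<in> finitary then 1 else 0) * a n)"
  have a': "mult_bound M a'"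
    unfolding a'_def using one_finitary by (intro mult_bound_completely_multiplicative a) (auto simp: finitary_mult)
  define D where "D = (\<lambda>(m, n). m div n) ` (I \<times> I) \<inter> finitary"
  have "finite D" "D \<subseteq> finitary" using I by (auto simp: D_def)
  then obtain R where R: "R \<subseteq> H" "finite R" "R \<noteq> {}"
    "\<And>d a. d \<in> D \<Longrightarrow> average a d = (\<Sum>h\<in>R. a (h d)) / of_nat (card R)"
    using average_finite by blast
  have eq: "average a (m div n) = (\<Sum>h\<in>R. a' (h (m div n))) / of_nat (card R)" if mn: "m \<in> I" "n \<in> I" "n dvd m" for m n
  proof (cases "m div n \<in> finitary")
    case True
    then have "m div n \<in> D" using mn by (force simp: D_def)
    then have "average a (m div n) = (\<Sum>h\<in>R. a (h (m div n))) / of_nat (card R)" by (rule R)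
    also have "(\<Sum>h\<in>R. a (h (m div n))) = (\<Sum>h\<in>R. a' (h (m div n)))"
      using True R(1) finitary_pos by (intro sum.cong refl) (auto simp: a'_def finitary_map subset_iff)
    finally show ?thesis .
  next
    case False
    have "m div n > 0" using Ipos[OF mn(1)] mn(3) by (auto elim!: dvdE intro: gr0I)
    then have "a' (h (m div n)) = 0" if "h \<in> R" for h
      using False that R(1) by (auto simp: a'_def finitary_map subset_iff)
    then show ?thesis using False by (simp add: average_def)
  qed
  have "mult_bound M (\<lambda>n. (\<Sum>h\<in>R. a' (h n)) / of_nat (card R))"
    by (rule mult_bound_average[OF R(2,3)], rule mult_bound_map[OF _ a']) (use R(1) in blast)
  from mult_boundD[OF this I, of x y] show "2 * norm (mult_form I (average a) x y)
      \<le> M * energy I x y"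
    by (simp add: eq cong: sum.cong if_cong)
qed

lemma average_map: "h \<in> H \<Longrightarrow> n > 0 \<Longrightarrow> average a (h n) = average a n"
  by (simp add: average_def finitary_map orbit_map)

lemma average_of_invariant:
  assumes inv: "\<And>h n. h \<in> H \<Longrightarrow> n > 0 \<Longrightarrow> a (h n) = a n" and n: "n \<in> finitary"
  shows "average a n = a n"
proof -
  have n0: "n > 0" "finite (orbit n)" "card (orbit n) \<noteq> 0"
    using n orbit_refl[of n] by (auto simp: finitary_def)
  have "(\<Sum>k\<in>orbit n. a k) = (\<Sum>k\<in>orbit n. a n)"
    using inv n0 by (intro sum.cong refl) (auto simp: orbit_def)
  then show ?thesis using n n0 by (simp add: average_def)
qed

text \<open>An invariant sequence is constant on orbits and square summable, so it is zero on infinite orbits.\<close>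
lemma invariant_vanishes:
  assumes inv: "\<And>h n. h \<in> H \<Longrightarrow> n > 0 \<Longrightarrow> a (h n) = a n" and a: "mult_bound M a"
    and n: "n > 0" "n \<notin> finitary"
  shows "a n = 0"
proof (rule ccontr)
  assume an: "a n \<noteq> 0"
  have inf: "infinite (orbit n)" using n by (simp add: finitary_def)
  obtain N :: nat where N: "real N * (norm (a n))\<^sup>2 > M\<^sup>2"
    using an reals_Archimedean3[of "(norm (a n))\<^sup>2"] by (auto simp: zero_less_power2)
  obtain I where I: "I \<subseteq> orbit n" "finite I" "card I = N"
    using infinite_arbitrarily_large[OF inf] by blast
  have "0 \<notin> I" using I orbit_pos[OF n(1)] by auto
  then have "(\<Sum>k\<in>I. (norm (a k))\<^sup>2) \<le> M\<^sup>2" by (rule mult_bound_l2[OF a I(2)])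
  moreover have "(\<Sum>k\<in>I. (norm (a k))\<^sup>2) = (\<Sum>k\<in>I. (norm (a n))\<^sup>2)"
    using I inv n by (intro sum.cong refl) (auto simp: orbit_def)
  ultimately show False using N I by simp
qed

text \<open>If \<open>a\<close> is invariant, each \<open>h\<close> carries \<open>a * b\<close> to the convolution of
  \<open>a\<close> with the image of \<open>b\<close>; now average over \<open>h\<close>. Off the finite orbits both
  sides vanish, because a product with infinite orbit has a factor with infinite orbit.\<close>
lemma average_conv:
  assumes inv: "\<And>h n. h \<in> H \<Longrightarrow> n > 0 \<Longrightarrow> a (h n) = a n"
    and supp: "\<And>n. n > 0 \<Longrightarrow> n \<notin> finitary \<Longrightarrow> a n = 0"
  shows "average (dirichlet_conv a b) = dirichlet_conv a (average b)"
proof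
  fix n
  consider "n = 0" | "n > 0" "n \<notin> finitary" | "n \<in> finitary" by blast
  then show "average (dirichlet_conv a b) n = dirichlet_conv a (average b) n"
  proof cases
    case 1
    then show ?thesis using finitary_pos by (auto simp: average_def dirichlet_conv_def)
  next
    case 2
    have "a d * average b (n div d) = 0" if "d dvd n" for d
    proof -
      obtain e where e: "n = d * e" using \<open>d dvd n\<close> by blast
      then have pos: "d > 0" "e > 0" using 2 by auto
      then have "d \<notin> finitary \<or> e \<notin> finitary" using 2 e finitary_mult by blast
      then show ?thesis using supp[of d] pos e by (auto simp: average_def)
    qed
    then have "dirichlet_conv a (average b) n = 0"
      unfolding dirichlet_conv_def by (intro sum.neutral) blast
    then show ?thesis using 2 by (simp add: average_def)
  next
    case 3
    then have n: "n > 0" by (rule finitary_pos)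
    have "finite {d. d dvd n}" "{d. d dvd n} \<subseteq> finitary" using n 3 finitary_dvd by auto
    then obtain R where R: "R \<subseteq> H" "finite R" "R \<noteq> {}"
      and avg: "\<And>d a. d \<in> {d. d dvd n} \<Longrightarrow> average a d = (\<Sum>h\<in>R. a (h d)) / of_nat (card R)"
      using average_finite[of "{d. d dvd n}"] by blast
    have conv: "dirichlet_conv a b (h n) = (\<Sum>d | d dvd n. a d * b (h (n div d)))" if h: "h \<in> H" for h
    proof -
      obtain k where k: "k \<in> H" "\<forall>n>0. k (h n) = n \<and> h (k n) = n" using inverse[OF h] by blast
      have hn: "h n > 0" using pos[OF h n] .
      show ?thesis
        unfolding dirichlet_conv_def
      proof (rule sum.reindex_bij_witness[of _ h k], goal_cases)
        case (1 d)
        then have "d > 0" using hn by (auto intro: gr0I)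
        then show ?case using k by simp
      next
        case (2 d)
        then show ?case using map_dvd[OF k(1) hn, of d] k n by simp
      next
        case (3 d)
        then have "d > 0" using n by (auto intro: gr0I)
        then show ?case using k by simp
      next
        case (4 d)
        then show ?case using map_dvd[OF h n, of d] by simp
      next
        case (5 d)
        then have d: "d > 0" using hn by (auto intro: gr0I)
        have kd: "k d dvd n" using map_dvd[OF k(1) hn, of d] k n 5 by simp
        have "a (k d) = a d" using inv[OF k(1) d] .
        moreover have "h (n div k d) = h n div d" using map_div[OF h n kd] k d by simp
        ultimately show ?case by simp
      qed
    qed
    have "average (dirichlet_conv a b) n = (\<Sum>h\<in>R. \<Sum>d | d dvd n. a d * b (h (n div d))) / of_nat (card R)"
      using R avg[of n "dirichlet_conv a b"] conv by (simp add: subset_iff)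
    also have "\<dots> = (\<Sum>d | d dvd n. a d * ((\<Sum>h\<in>R. b (h (n div d))) / of_nat (card R)))"
      by (subst sum.swap) (simp add: sum_distrib_left sum_divide_distrib)
    also have "\<dots> = dirichlet_conv a (average b) n"
      unfolding dirichlet_conv_def
      by (intro sum.cong refl) (simp add: avg[OF CollectI, OF dividend_dvd])
    finally show ?thesis .
  qed
qed

text \<open>On finite sets the projection is a mean of sequences \<open>a (h n)\<close> with \<open>h\<close> injective.\<close>
lemma average_norm_sum:
  assumes a: "summable (\<lambda>n. norm (a n))"
  shows "summable (\<lambda>n. norm (average a n))" "(\<Sum>n. norm (average a n)) \<le> (\<Sum>n. norm (a n))"
proof -
  have fin: "(\<Sum>n\<in>I. norm (average a n)) \<le> (\<Sum>n. norm (a n))" if I: "finite I" for I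
  proof -
    define D where "D = I \<inter> finitary"
    have D: "finite D" "D \<subseteq> finitary" using I by (auto simp: D_def)
    then obtain R where R: "R \<subseteq> H" "finite R" "R \<noteq> {}"
      "\<And>d a. d \<in> D \<Longrightarrow> average a d = (\<Sum>h\<in>R. a (h d)) / of_nat (card R)"
      using average_finite by blast
    have c: "card R > 0" using R by (simp add: card_gt_0_iff)
    have "(\<Sum>n\<in>I. norm (average a n)) = (\<Sum>n\<in>D. norm (average a n))"
      using I by (intro sum.mono_neutral_right) (auto simp: D_def average_def)
    also have "\<dots> \<le> (\<Sum>n\<in>D. (\<Sum>h\<in>R. norm (a (h n))) / card R)"
      by (intro sum_mono) (auto simp: R(4) norm_divide intro!: divide_right_mono norm_sum)
    also have "\<dots> = (\<Sum>h\<in>R. \<Sum>n\<in>D. norm (a (h n))) / card R"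
      by (subst sum.swap) (simp add: sum_divide_distrib)
    also have "\<dots> \<le> (\<Sum>h\<in>R. \<Sum>n. norm (a n)) / card R"
    proof (intro divide_right_mono sum_mono)
      fix h assume "h \<in> R"
      then have "inj_on h D" using R D map_inj finitary_pos by (auto simp: inj_on_def subset_iff)
      then have "(\<Sum>n\<in>D. norm (a (h n))) = (\<Sum>n\<in>h ` D. norm (a n))" by (simp add: sum.reindex)
      also have "\<dots> \<le> (\<Sum>n. norm (a n))" using D a by (intro sum_le_suminf) auto
      finally show "(\<Sum>n\<in>D. norm (a (h n))) \<le> (\<Sum>n. norm (a n))" .
    qed auto
    also have "\<dots> = (\<Sum>n. norm (a n))" using c by simp
    finally show ?thesis .
  qed
  show s: "summable (\<lambda>n. norm (average a n))"
    by (rule summableI_nonneg_bounded[of _ "\<Sum>n. norm (a n)"]) (auto intro: fin)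
  show "(\<Sum>n. norm (average a n)) \<le> (\<Sum>n. norm (a n))"
    using s by (rule suminf_le_const) (auto intro: fin)
qed

end

section \<open>Permutations of the primes\<close>

lemma bij_betw_nth_prime: "bij_betw nth_prime {1..} {p. prime p}"
proof -
  have "bij_betw (\<lambda>i. i - 1) {1..} (UNIV :: nat set)"
    by (rule bij_betw_byWitness[of _ "\<lambda>i. i + 1"]) auto
  moreover have "bij_betw (enumerate {p :: nat. prime p}) UNIV {p. prime p}"
    by (rule bij_enumerate) (rule primes_infinite)
  ultimately have "bij_betw (enumerate {p :: nat. prime p} \<circ> (\<lambda>i. i - 1)) {1..} {p. prime p}"
    by (rule bij_betw_trans)
  then show ?thesis by (simp add: nth_prime_def[abs_def] o_def)
qed

lemma prime_nth_prime: "i \<ge> 1 \<Longrightarrow> prime (nth_prime i)"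
  using bij_betw_nth_prime by (auto simp: bij_betw_def)

lemma prime_eq_nth_prime:
  assumes "prime p"
  obtains i where "i \<ge> 1" "p = nth_prime i"
proof -
  have "p \<in> nth_prime ` {1..}"
    using assms bij_betw_imp_surj_on[OF bij_betw_nth_prime] by simp
  then show ?thesis using that by auto
qed

definition prime_perm :: "(nat \<Rightarrow> nat) \<Rightarrow> nat \<Rightarrow> nat" where
  "prime_perm \<sigma> p = nth_prime (\<sigma> (inv_into {1..} nth_prime p))"

lemma prime_perm_nth_prime: "i \<ge> 1 \<Longrightarrow> prime_perm \<sigma> (nth_prime i) = nth_prime (\<sigma> i)"
  using bij_betw_nth_prime by (simp add: prime_perm_def bij_betw_inv_into_left)

text \<open>On multisets of prime factors \<open>perm_hat \<sigma>\<close> acts elementwise, which makes multiplicativity and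
  compatibility with composition evident.\<close>
lemma perm_hat_eq_prod_mset:
  assumes "n > 0"
  shows "perm_hat \<sigma> n = prod_mset (image_mset (prime_perm \<sigma>) (prime_factorization n))"
proof -
  let ?S = "{i. i \<ge> 1 \<and> nth_prime i dvd n}"
  have "bij_betw nth_prime ?S (prime_factors n)"
    using assms bij_betw_nth_prime unfolding bij_betw_def
    by (auto simp: in_prime_factors_iff inj_on_def image_iff)
       (metis atLeast_iff bij_betw_def bij_betw_nth_prime image_iff mem_Collect_eq)
  then have "(\<Prod>i\<in>?S. prime_perm \<sigma> (nth_prime i) ^ multiplicity (nth_prime i) n)
    = (\<Prod>p\<in>prime_factors n. prime_perm \<sigma> p ^ multiplicity p n)"
    by (rule prod.reindex_bij_betw)
  moreover have "perm_hat \<sigma> n = (\<Prod>i\<in>?S. prime_perm \<sigma> (nth_prime i) ^ multiplicity (nth_prime i) n)"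
    unfolding perm_hat_def by (intro prod.cong) (auto simp: prime_perm_nth_prime)
  moreover have "prod_mset (image_mset (prime_perm \<sigma>) (prime_factorization n))
    = (\<Prod>p\<in>prime_factors n. prime_perm \<sigma> p ^ multiplicity p n)"
    by (auto simp: image_prod_mset_multiplicity count_prime_factorization_prime in_prime_factors_imp_prime intro!: prod.cong)
  ultimately show ?thesis by simp
qed

lemma Bij_ge1: "\<sigma> \<in> Bij {1::nat..} \<Longrightarrow> i \<ge> 1 \<Longrightarrow> \<sigma> i \<ge> 1"
  using Bij_imp_funcset by fastforce

lemma prime_prime_perm:
  assumes "\<sigma> \<in> Bij {1..}" "prime p"
  shows "prime (prime_perm \<sigma> p)"
proof -
  obtain i where "i \<ge> 1" "p = nth_prime i" using assms(2) by (rule prime_eq_nth_prime)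
  then show ?thesis using Bij_ge1[OF assms(1)] by (simp add: prime_perm_nth_prime prime_nth_prime)
qed

lemma prime_factorization_perm_hat:
  assumes "\<sigma> \<in> Bij {1..}" "n > 0"
  shows "prime_factorization (perm_hat \<sigma> n) = image_mset (prime_perm \<sigma>) (prime_factorization n)"
  unfolding perm_hat_eq_prod_mset[OF assms(2)]
  by (rule prime_factorization_prod_mset_primes) (auto intro!: prime_prime_perm assms dest: in_prime_factors_imp_prime)

lemma perm_hat_pos:
  assumes "\<sigma> \<in> Bij {1..}" "n > 0"
  shows "perm_hat \<sigma> n > 0"
proof -
  have "prime_perm \<sigma> p \<noteq> 0" if "p \<in># prime_factorization n" for p
    using prime_prime_perm[OF assms(1) in_prime_factors_imp_prime[OF that]] by (metis not_prime_0)
  then have "0 \<notin># image_mset (prime_perm \<sigma>) (prime_factorization n)" by (metis imageE set_image_mset)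
  then have "prod_mset (image_mset (prime_perm \<sigma>) (prime_factorization n)) \<noteq> 0"
    by (simp only: prod_mset_zero_iff not_False_eq_True)
  then show ?thesis unfolding perm_hat_eq_prod_mset[OF assms(2)] by (rule neq0_conv[THEN iffD1])
qed

lemma perm_hat_mult:
  assumes "m > 0" "n > 0"
  shows "perm_hat \<sigma> (m * n) = perm_hat \<sigma> m * perm_hat \<sigma> n"
  using assms by (simp add: perm_hat_eq_prod_mset prime_factorization_mult)

lemma perm_hat_compose:
  assumes \<sigma>: "\<sigma> \<in> Bij {1..}" and \<tau>: "\<tau> \<in> Bij {1..}" and n: "n > 0"
  shows "perm_hat (compose {1..} \<sigma> \<tau>) n = perm_hat \<sigma> (perm_hat \<tau> n)"
proof -
  have "prime_perm (compose {1..} \<sigma> \<tau>) p = prime_perm \<sigma> (prime_perm \<tau> p)" if "prime p" for p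
  proof -
    obtain i where "i \<ge> 1" "p = nth_prime i" using \<open>prime p\<close> by (rule prime_eq_nth_prime)
    then show ?thesis using Bij_ge1[OF \<tau>] by (simp add: prime_perm_nth_prime compose_def)
  qed
  then have "image_mset (prime_perm (compose {1..} \<sigma> \<tau>)) (prime_factorization n)
    = image_mset (prime_perm \<sigma>) (image_mset (prime_perm \<tau>) (prime_factorization n))"
    by (auto simp: multiset.map_comp intro!: image_mset_cong dest: in_prime_factors_imp_prime)
  then have "perm_hat (compose {1..} \<sigma> \<tau>) n
    = prod_mset (image_mset (prime_perm \<sigma>) (image_mset (prime_perm \<tau>) (prime_factorization n)))"
    by (simp only: perm_hat_eq_prod_mset[OF n])
  also have "\<dots> = perm_hat \<sigma> (perm_hat \<tau> n)"
    by (simp only: perm_hat_eq_prod_mset[OF perm_hat_pos[OF \<tau> n], of \<sigma>] prime_factorization_perm_hat[OF \<tau> n])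
  finally show ?thesis .
qed

lemma perm_hat_id:
  assumes "n > 0"
  shows "perm_hat (\<lambda>i\<in>{1..}. i) n = n"
proof -
  have "prime_perm (\<lambda>i\<in>{1..}. i) p = p" if "prime p" for p
  proof -
    obtain i where "i \<ge> 1" "p = nth_prime i" using \<open>prime p\<close> by (rule prime_eq_nth_prime)
    then show ?thesis by (simp add: prime_perm_nth_prime)
  qed
  then have "image_mset (prime_perm (\<lambda>i\<in>{1..}. i)) (prime_factorization n) = prime_factorization n"
    by (auto intro!: image_mset_cong[of _ _ "\<lambda>x. x", simplified] dest: in_prime_factors_imp_prime)
  then show ?thesis using assms by (simp add: perm_hat_eq_prod_mset prod_mset_prime_factorization_nat)
qed

lemma bigomega_perm_hat:
  "\<sigma> \<in> Bij {1..} \<Longrightarrow> n > 0 \<Longrightarrow> bigomega (perm_hat \<sigma> n) = bigomega n"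
  by (simp add: bigomega_def prime_factorization_perm_hat)

lemma bigomega_mult: "m > 0 \<Longrightarrow> n > 0 \<Longrightarrow> bigomega (m * n) = bigomega m + bigomega n"
  by (simp add: bigomega_def prime_factorization_mult)

locale permutation_group =
  fixes G :: "(nat \<Rightarrow> nat) set"
  assumes G: "subgroup G (BijGroup {1..})"
begin

lemma G_Bij: "\<sigma> \<in> G \<Longrightarrow> \<sigma> \<in> Bij {1..}"
  using subgroup.subset[OF G] by (auto simp: BijGroup_def)

lemma G_compose: "\<sigma> \<in> G \<Longrightarrow> \<tau> \<in> G \<Longrightarrow> compose {1..} \<sigma> \<tau> \<in> G"
  using subgroup.m_closed[OF G, of \<sigma> \<tau>] G_Bij by (simp add: BijGroup_def)

lemma G_id: "(\<lambda>i\<in>{1..}. i) \<in> G"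
  using subgroup.one_closed[OF G] by (simp add: BijGroup_def)

lemma G_inverse:
  assumes "\<sigma> \<in> G"
  shows "\<exists>\<tau>\<in>G. compose {1..} \<sigma> \<tau> = (\<lambda>i\<in>{1..}. i) \<and> compose {1..} \<tau> \<sigma> = (\<lambda>i\<in>{1..}. i)"
proof -
  let ?B = "BijGroup {1::nat..}"
  interpret B: group ?B by (rule group_BijGroup)
  have \<sigma>: "\<sigma> \<in> carrier ?B" using subgroup.subset[OF G] assms by auto
  have \<tau>: "inv\<^bsub>?B\<^esub> \<sigma> \<in> G" using subgroup.m_inv_closed[OF G assms] .
  have "\<sigma> \<otimes>\<^bsub>?B\<^esub> inv\<^bsub>?B\<^esub> \<sigma> = \<one>\<^bsub>?B\<^esub>" "inv\<^bsub>?B\<^esub> \<sigma> \<otimes>\<^bsub>?B\<^esub> \<sigma> = \<one>\<^bsub>?B\<^esub>"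
    using \<sigma> by (rule B.r_inv, rule B.l_inv)
  then show ?thesis using G_Bij[OF assms] G_Bij[OF \<tau>] \<tau> by (auto simp: BijGroup_def)
qed

sublocale multiplicative_group "perm_hat ` G"
proof
  show "\<exists>e\<in>perm_hat ` G. \<forall>n>0. e n = n" using G_id perm_hat_id by blast
  fix h assume "h \<in> perm_hat ` G"
  then obtain \<sigma> where h: "h = perm_hat \<sigma>" and \<sigma>: "\<sigma> \<in> G" by blast
  show "h n > 0" if "n > 0" for n using perm_hat_pos[OF G_Bij[OF \<sigma>] that] by (simp add: h)
  show "h (m * n) = h m * h n" if "m > 0" "n > 0" for m n using perm_hat_mult[OF that] by (simp add: h)
  obtain \<tau> where \<tau>: "\<tau> \<in> G" "compose {1..} \<sigma> \<tau> = (\<lambda>i\<in>{1..}. i)" "compose {1..} \<tau> \<sigma> = (\<lambda>i\<in>{1..}. i)"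
    using G_inverse[OF \<sigma>] by blast
  show "\<exists>k\<in>perm_hat ` G. \<forall>n>0. k (h n) = n \<and> h (k n) = n"
    using perm_hat_compose[OF G_Bij[OF \<sigma>] G_Bij[OF \<tau>(1)]] perm_hat_compose[OF G_Bij[OF \<tau>(1)] G_Bij[OF \<sigma>]] \<tau> perm_hat_id
    by (metis h imageI)
  fix k assume "k \<in> perm_hat ` G"
  then obtain \<rho> where k: "k = perm_hat \<rho>" and \<rho>: "\<rho> \<in> G" by blast
  show "\<exists>l\<in>perm_hat ` G. \<forall>n>0. l n = h (k n)"
    using perm_hat_compose[OF G_Bij[OF \<sigma>] G_Bij[OF \<rho>]] G_compose[OF \<sigma> \<rho>] by (auto simp: h k)
qed

lemma orbit_eq: "number_orbit G n = orbit n"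
  by (auto simp: number_orbit_def orbit_def)

lemma orbit_nth_prime:
  assumes "i \<ge> 1"
  shows "orbit (nth_prime i) = nth_prime ` {\<sigma> i | \<sigma>. \<sigma> \<in> G}"
proof -
  have "perm_hat \<sigma> (nth_prime i) = nth_prime (\<sigma> i)" for \<sigma>
    using prime_nth_prime[OF assms] assms
    by (simp add: perm_hat_eq_prod_mset prime_gt_0_nat prime_factorization_prime prime_perm_nth_prime)
  then show ?thesis by (auto simp: orbit_def image_iff)
qed

text \<open>The semigroup generated by the primes with finite orbit consists of the numbers with finite orbit: finiteness passes
  to products and to divisors, and the orbit of \<open>nth_prime i\<close> corresponds to the orbit of
  \<open>i\<close>.\<close>
lemma finite_orbit_numbers_eq: "finite_orbit_numbers G = finitary"
proof (intro equalityI subsetI)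
  fix n assume "n \<in> finite_orbit_numbers G"
  then show "n \<in> finitary"
  proof induction
    case one
    show ?case by (rule one_finitary)
  next
    case (prime i)
    then obtain X j where X: "finite X" "j \<ge> 1" "X = {\<sigma> j | \<sigma>. \<sigma> \<in> G}" "i \<in> X"
      by (auto simp: finite_orbit_points_def)
    then obtain \<tau> where \<tau>: "\<tau> \<in> G" "i = \<tau> j" by auto
    then have i: "i \<ge> 1" using Bij_ge1[OF G_Bij] X(2) by simp
    have "{\<sigma> i | \<sigma>. \<sigma> \<in> G} \<subseteq> X"
    proof
      fix k assume "k \<in> {\<sigma> i | \<sigma>. \<sigma> \<in> G}"
      then obtain \<sigma> where "\<sigma> \<in> G" "k = \<sigma> i" by auto
      then have "k = compose {1..} \<sigma> \<tau> j" "compose {1..} \<sigma> \<tau> \<in> G"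
        using \<tau> X(2) G_compose by (auto simp: compose_def)
      then show "k \<in> X" unfolding X(3) by blast
    qed
    then have "finite (orbit (nth_prime i))" unfolding orbit_nth_prime[OF i] using X(1) finite_subset by blast
    then show ?case using prime_nth_prime[OF i] by (simp add: finitary_def prime_gt_0_nat)
  next
    case (mult m n)
    then show ?case using finitary_mult finitary_pos by blast
  qed
next
  fix n assume "n \<in> finitary"
  then show "n \<in> finite_orbit_numbers G"
  proof (induction n rule: prime_divisors_induct)
    case zero
    then show ?case using finitary_pos by blast
  next
    case (unit n)
    then show ?case by (simp add: finite_orbit_numbers.one[simplified])
  next
    case (factor p n)
    have "p > 0" "n > 0" using finitary_pos[OF factor.prems] by auto
    then have fin: "p \<in> finitary" "n \<in> finitary" using finitary_mult factor.prems by blast+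
    obtain i where i: "i \<ge> 1" "p = nth_prime i"
      using factor.hyps by (rule prime_eq_nth_prime)
    have "{\<sigma> i | \<sigma>. \<sigma> \<in> G} \<subseteq> {1..}" using Bij_ge1[OF G_Bij] i(1) by auto
    then have "inj_on nth_prime {\<sigma> i | \<sigma>. \<sigma> \<in> G}"
      using bij_betw_nth_prime by (auto simp: bij_betw_def intro: inj_on_subset)
    moreover have "finite (nth_prime ` {\<sigma> i | \<sigma>. \<sigma> \<in> G})"
      using fin(1) by (simp add: i(2) finitary_def orbit_nth_prime[OF i(1), symmetric])
    ultimately have "finite {\<sigma> i | \<sigma>. \<sigma> \<in> G}" by (simp add: finite_image_iff)
    moreover have "i \<in> {\<sigma> i | \<sigma>. \<sigma> \<in> G}"
      using G_id i(1) by (intro CollectI exI[of _ "\<lambda>i\<in>{1..}. i"]) simp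
    ultimately have "i \<in> finite_orbit_points G" unfolding finite_orbit_points_def using i(1) by blast
    then show ?case
      unfolding i(2) using factor.IH fin(2) by (intro finite_orbit_numbers.mult finite_orbit_numbers.prime) auto
  qed
qed

lemma proj_series_eq: "proj_series G = average"
  by (auto simp: fun_eq_iff proj_series_def average_def finite_orbit_numbers_eq orbit_eq)

lemma perm_series_invariant_iff:
  assumes "a 0 = 0"
  shows "(\<forall>\<sigma>\<in>G. perm_series \<sigma> a = a) \<longleftrightarrow> (\<forall>h\<in>perm_hat ` G. \<forall>n>0. a (h n) = a n)"
proof -
  have inv: "inv_into {1..} (perm_hat \<sigma>) (perm_hat \<sigma> n) = n" if "\<sigma> \<in> G" "n > 0" for \<sigma> n
    using that map_inj[of "perm_hat \<sigma>"] by (intro inv_into_f_f) (auto simp: inj_on_def)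
  show ?thesis
  proof (intro iffI ballI allI impI)
    fix h n assume *: "\<forall>\<sigma>\<in>G. perm_series \<sigma> a = a" "h \<in> perm_hat ` G" "n > (0::nat)"
    then obtain \<sigma> where \<sigma>: "h = perm_hat \<sigma>" "\<sigma> \<in> G" by blast
    have "a (h n) = perm_series \<sigma> a (h n)" using * \<sigma> by simp
    also have "\<dots> = a n" using inv[OF \<sigma>(2) *(3)] pos[OF *(2,3)] \<sigma> by (simp add: perm_series_def)
    finally show "a (h n) = a n" .
  next
    fix \<sigma> assume *: "\<forall>h\<in>perm_hat ` G. \<forall>n>0. a (h n) = a n" "\<sigma> \<in> G"
    show "perm_series \<sigma> a = a"
    proof
      fix n
      show "perm_series \<sigma> a n = a n"
      proof (cases "n = 0")
        case False
        obtain k where k: "k \<in> perm_hat ` G" "\<forall>n>0. k (perm_hat \<sigma> n) = n \<and> perm_hat \<sigma> (k n) = n"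
          using inverse[of "perm_hat \<sigma>"] *(2) by blast
        have "k n > 0" using pos[OF k(1)] False by simp
        then have "inv_into {1..} (perm_hat \<sigma>) n = k n" using inv[OF *(2), of "k n"] k False by simp
        moreover have "a (k n) = a n" using *(1)[rule_format, OF k(1)] False by simp
        ultimately show ?thesis using False by (simp add: perm_series_def)
      qed (simp add: perm_series_def assms)
    qed
  qed
qed

end

section \<open>The function algebras on the coefficient side\<close>

lemma O_u_coeffs: "f \<in> O_u \<Longrightarrow> has_dirichlet_series f (dirichlet_coeffs f)"
  using dirichlet_coeffs_eq by (auto simp: O_u_def)

lemma O_uI: "has_dirichlet_series f a \<Longrightarrow> f \<in> O_u"
  using dseries_holomorphic by (auto simp: O_u_def)

lemma one_in_right_half_plane: "1 \<in> right_half_plane"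
  by (simp add: right_half_plane_def)

lemma sup_norm_le:
  assumes "has_dirichlet_series f a" "mult_bound M a"
  shows "sup_norm f \<le> M"
  unfolding sup_norm_def
  by (rule cSUP_least) (use one_in_right_half_plane bounded_iff_mult_bound[OF assms(1)] assms(2) in auto)

lemma mult_bound_sup_norm:
  assumes "has_dirichlet_series f a" "mult_bound M a"
  shows "mult_bound (sup_norm f) a"
  unfolding bounded_iff_mult_bound[OF assms(1), symmetric] sup_norm_def
  by (intro ballI cSUP_upper) (use bounded_iff_mult_bound[OF assms(1)] assms(2) in \<open>auto simp: bdd_above_def\<close>)

lemma H_inf_iff: "f \<in> H_inf \<longleftrightarrow> (\<exists>a M. has_dirichlet_series f a \<and> mult_bound M a)"
proof
  assume f: "f \<in> H_inf"
  then have ser: "has_dirichlet_series f (dirichlet_coeffs f)" by (auto simp: H_inf_def O_u_coeffs)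
  obtain M where "\<forall>s\<in>right_half_plane. norm (f s) \<le> M" using f by (auto simp: H_inf_def bounded_iff)
  then show "\<exists>a M. has_dirichlet_series f a \<and> mult_bound M a" using ser bounded_iff_mult_bound[OF ser] by blast
next
  assume "\<exists>a M. has_dirichlet_series f a \<and> mult_bound M a"
  then show "f \<in> H_inf" using bounded_iff_mult_bound by (fastforce simp: H_inf_def bounded_iff intro: O_uI)
qed

lemma H_inf_mult_bound: "f \<in> H_inf \<Longrightarrow> mult_bound (sup_norm f) (dirichlet_coeffs f)"
  using mult_bound_sup_norm dirichlet_coeffs_eq unfolding H_inf_iff by blast

lemma H_inf_coeffs: "f \<in> H_inf \<Longrightarrow> has_dirichlet_series f (dirichlet_coeffs f)"
  by (simp add: H_inf_def O_u_coeffs)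

lemma bigomega_1: "bigomega 1 = 0"
  by (simp add: bigomega_def)

lemma mult_bound_omega:
  assumes "mult_bound M a" "0 \<le> r" "r \<le> 1"
  shows "mult_bound M (\<lambda>n. of_real r ^ bigomega n * a n)"
proof -
  have "mult_bound M (\<lambda>n. of_real (r ^ bigomega n) * a n)"
    by (rule mult_bound_completely_multiplicative)
       (use assms in \<open>auto simp: bigomega_1[simplified] bigomega_mult power_add power_le_one\<close>)
  then show ?thesis by simp
qed

lemma two_power_bigomega_le: "n > 0 \<Longrightarrow> 2 ^ bigomega n \<le> n"
proof (induction n rule: prime_divisors_induct)
  case (factor p n)
  then have n: "n > 0" "p > 0" by auto
  have "bigomega p = 1" using factor.hyps by (simp add: bigomega_def prime_factorization_prime)
  then have "bigomega (p * n) = Suc (bigomega n)" using n by (simp add: bigomega_mult)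
  then show ?case using factor.IH[OF n(1)] prime_ge_2_nat[OF factor.hyps] by (simp add: mult_le_mono)
qed (auto simp: bigomega_def)

lemma locally_mult_bounded_omega:
  assumes "locally_mult_bounded a" "0 \<le> r" "r \<le> 1"
  shows "locally_mult_bounded (\<lambda>n. of_real r ^ bigomega n * a n)"
  unfolding locally_mult_bounded_def
proof (intro allI impI)
  fix \<epsilon> :: real assume "\<epsilon> > 0"
  then obtain M where "mult_bound M (\<lambda>n. of_real (real n powr (- \<epsilon>)) * a n)"
    using assms(1) unfolding locally_mult_bounded_def by blast
  from mult_bound_omega[OF this assms(2,3)]
  show "\<exists>M. mult_bound M (\<lambda>n. of_real (real n powr (- \<epsilon>)) * (of_real r ^ bigomega n * a n))"
    by (auto simp: mult_ac)
qed

text \<open>With \<open>r = 2 powr (- \<epsilon>)\<close> the quotient of \<open>n powr (- \<epsilon>)\<close> by \<open>r ^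
  bigomega n\<close> is completely multiplicative with values in \<open>[0, 1]\<close>, since \<open>2 ^ bigomega n
  \<le> n\<close>. So bounded dilations control all right translates.\<close>
lemma locally_mult_bounded_of_dilations:
  assumes "\<And>r. r \<in> {0<..<1} \<Longrightarrow> \<exists>M. mult_bound M (\<lambda>n. of_real r ^ bigomega n * a n)"
  shows "locally_mult_bounded a"
  unfolding locally_mult_bounded_def
proof (intro allI impI)
  fix \<epsilon> :: real assume \<epsilon>: "\<epsilon> > 0"
  define r where "r = (2::real) powr (- \<epsilon>)"
  have r: "r \<in> {0<..<1}" using \<epsilon> powr_less_mono[of "-\<epsilon>" 0 "2::real"] by (simp add: r_def)
  define c where "c = (\<lambda>n. (2 ^ bigomega n / real n) powr \<epsilon>)"
  from assms[OF r] obtain M where M: "mult_bound M (\<lambda>n. of_real r ^ bigomega n * a n)" by blast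
  have "mult_bound M (\<lambda>n. of_real (c n) * (of_real r ^ bigomega n * a n))"
  proof (rule mult_bound_completely_multiplicative[OF _ _ _ _ M])
    show "c n \<le> 1" if "n > 0" for n
    proof -
      have "(2::real) ^ bigomega n \<le> real n"
        using of_nat_mono[OF two_power_bigomega_le[OF that], where ?'a = real] by simp
      then have "2 ^ bigomega n / real n \<le> 1" using that by simp
      then show ?thesis unfolding c_def using \<epsilon> powr_mono2[of \<epsilon> "2 ^ bigomega n / real n" 1] by simp
    qed
    show "c (m * n) = c m * c n" if "m > 0" "n > 0" for m n
      using that unfolding c_def by (simp add: bigomega_mult power_add powr_mult[symmetric])
  qed (simp_all add: c_def bigomega_1[simplified])
  moreover have "of_real (c n) * (of_real r ^ bigomega n * a n) = of_real (real n powr (- \<epsilon>)) * a n" if "n > 0" for n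
  proof -
    have "r ^ bigomega n = (2 ^ bigomega n) powr (- \<epsilon>)"
      by (simp add: r_def powr_powr powr_realpow[symmetric] mult.commute)
    then have "c n * r ^ bigomega n = real n powr (- \<epsilon>)"
      using that unfolding c_def by (simp add: powr_divide powr_minus divide_simps mult.commute)
    then show ?thesis by (metis (no_types, opaque_lifting) mult.assoc of_real_mult of_real_power)
  qed
  ultimately have "mult_bound M (\<lambda>n. of_real (real n powr (- \<epsilon>)) * a n)"
    by (rule mult_bound_cong)
  then show "\<exists>M. mult_bound M (\<lambda>n. of_real (real n powr (- \<epsilon>)) * a n)" ..
qed

lemma dseries_dilate:
  assumes f: "has_dirichlet_series f a" and r: "r \<in> {0<..<1}"
  shows "has_dirichlet_series (dilate r f) (\<lambda>n. of_real r ^ bigomega n * a n)"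
  unfolding dilate_def dirichlet_coeffs_eq[OF f]
  using dseries_coeff0[OF f] r
  by (intro dseries_of_mult_bounded locally_mult_bounded_omega
        dseries_locally_mult_bounded[OF f]) auto

lemma O_b_iff:
  "f \<in> O_b \<longleftrightarrow> (\<exists>a. has_dirichlet_series f a \<and>
      (\<forall>r\<in>{0<..<1}. \<exists>M. mult_bound M (\<lambda>n. of_real r ^ bigomega n * a n)))"
proof -
  have "bounded (dilate r f ` right_half_plane) \<longleftrightarrow> (\<exists>M. mult_bound M (\<lambda>n. of_real r ^ bigomega n * a n))"
    if "has_dirichlet_series f a" "r \<in> {0<..<1}" for r a
    by (simp add: bounded_iff bounded_iff_mult_bound[OF dseries_dilate[OF that], symmetric])
  then show ?thesis
    unfolding O_b_def using O_u_coeffs O_uI by blast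
qed

lemma O_b_coeffs: "f \<in> O_b \<Longrightarrow> has_dirichlet_series f (dirichlet_coeffs f)"
  by (simp add: O_b_def O_u_coeffs)

lemma O_b_mult_bound:
  assumes "f \<in> O_b" "r \<in> {0<..<1}"
  shows "mult_bound (dilate_seminorm r f) (\<lambda>n. of_real r ^ bigomega n * dirichlet_coeffs f n)"
proof -
  obtain a M where a: "has_dirichlet_series f a" "mult_bound M (\<lambda>n. of_real r ^ bigomega n * a n)"
    using assms unfolding O_b_iff by blast
  then show ?thesis
    unfolding dilate_seminorm_def dirichlet_coeffs_eq[OF a(1)]
    by (intro mult_bound_sup_norm dseries_dilate assms)
qed

lemma Wiener_iff: "f \<in> Wiener_Dirichlet \<longleftrightarrow> (\<exists>a. has_dirichlet_series f a \<and> summable (\<lambda>n. norm (a n)))"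
proof
  assume "f \<in> Wiener_Dirichlet"
  then obtain a where a: "f = dirichlet_function a" "a 0 = 0" "summable (\<lambda>n. norm (a n))"
    by (auto simp: Wiener_Dirichlet_def formal_dirichlet_series_def)
  then have "has_dirichlet_series f a"
    by (auto intro!: dseries_of_mult_bounded mult_bound_imp_locally mult_bound_absolutely_summable)
  then show "\<exists>a. has_dirichlet_series f a \<and> summable (\<lambda>n. norm (a n))" using a by blast
next
  assume "\<exists>a. has_dirichlet_series f a \<and> summable (\<lambda>n. norm (a n))"
  then obtain a where a: "has_dirichlet_series f a" "summable (\<lambda>n. norm (a n))" by blast
  have "a \<in> formal_dirichlet_series" using a(1) by (simp add: has_dirichlet_series_def)
  then show "f \<in> Wiener_Dirichlet"
    unfolding Wiener_Dirichlet_def using dseries_eq_dirichlet_function[OF a(1)] a(2) by blast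
qed

lemma Wiener_subset_H_inf: "Wiener_Dirichlet \<subseteq> H_inf"
  unfolding subset_iff Wiener_iff H_inf_iff using mult_bound_absolutely_summable by blast

lemma H_inf_subset_O_b: "H_inf \<subseteq> O_b"
proof
  fix f assume "f \<in> H_inf"
  then obtain a M where "has_dirichlet_series f a" "mult_bound M a" by (auto simp: H_inf_iff)
  moreover from this have "mult_bound M (\<lambda>n. of_real r ^ bigomega n * a n)" if "r \<in> {0<..<1}" for r
    using that by (intro mult_bound_omega) auto
  ultimately show "f \<in> O_b" unfolding O_b_iff by blast
qed

lemma coeffs_diff:
  assumes "f \<in> O_b" "g \<in> O_b"
  shows "dirichlet_coeffs (\<lambda>s. f s - g s) = (\<lambda>n. dirichlet_coeffs f n - dirichlet_coeffs g n)"
  by (intro dirichlet_coeffs_eq dseries_diff O_b_coeffs assms)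

lemma mult_bound_diff:
  assumes "mult_bound M a" "mult_bound N b"
  shows "mult_bound (M + N) (\<lambda>n. a n - b n)"
  using mult_bound_add[OF assms(1) mult_bound_cmult[OF assms(2), of "-1"]] by simp

lemma H_inf_diff: "f \<in> H_inf \<Longrightarrow> g \<in> H_inf \<Longrightarrow> (\<lambda>s. f s - g s) \<in> H_inf"
  unfolding H_inf_iff using dseries_diff mult_bound_diff by blast

lemma O_b_diff:
  assumes "f \<in> O_b" "g \<in> O_b"
  shows "(\<lambda>s. f s - g s) \<in> O_b"
  unfolding O_b_iff
proof (intro exI conjI ballI)
  show "has_dirichlet_series (\<lambda>s. f s - g s) (\<lambda>n. dirichlet_coeffs f n - dirichlet_coeffs g n)"
    by (intro dseries_diff O_b_coeffs assms)
  fix r :: real assume "r \<in> {0<..<1}"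
  from mult_bound_diff[OF O_b_mult_bound[OF assms(1) this] O_b_mult_bound[OF assms(2) this]]
  show "mult_bound (dilate_seminorm r f + dilate_seminorm r g)
     (\<lambda>n. of_real r ^ bigomega n * (dirichlet_coeffs f n - dirichlet_coeffs g n))"
    by (simp add: algebra_simps)
qed

lemma Wiener_diff:
  assumes "f \<in> Wiener_Dirichlet" "g \<in> Wiener_Dirichlet"
  shows "(\<lambda>s. f s - g s) \<in> Wiener_Dirichlet"
proof -
  obtain a b where ab: "has_dirichlet_series f a" "summable (\<lambda>n. norm (a n))"
    "has_dirichlet_series g b" "summable (\<lambda>n. norm (b n))"
    using assms by (auto simp: Wiener_iff)
  have "summable (\<lambda>n. norm (a n - b n))"
    by (rule summable_comparison_test'[OF summable_add[OF ab(2,4)]]) (simp add: norm_triangle_ineq4)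
  then show ?thesis using dseries_diff[OF ab(1,3)] by (auto simp: Wiener_iff)
qed

lemma sup_norm_triangle:
  assumes "u \<in> H_inf" "v \<in> H_inf" "w \<in> H_inf"
  shows "sup_norm (\<lambda>s. u s - w s) \<le> sup_norm (\<lambda>s. u s - v s) + sup_norm (\<lambda>s. v s - w s)"
proof -
  have "mult_bound (sup_norm (\<lambda>s. u s - v s) + sup_norm (\<lambda>s. v s - w s))
     (\<lambda>n. dirichlet_coeffs (\<lambda>s. u s - v s) n + dirichlet_coeffs (\<lambda>s. v s - w s) n)"
    by (intro mult_bound_add H_inf_mult_bound H_inf_diff assms)
  moreover have "has_dirichlet_series (\<lambda>s. (u s - v s) + (v s - w s))
     (\<lambda>n. dirichlet_coeffs (\<lambda>s. u s - v s) n + dirichlet_coeffs (\<lambda>s. v s - w s) n)"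
    by (intro dseries_add H_inf_coeffs H_inf_diff assms)
  ultimately show ?thesis using sup_norm_le by fastforce
qed

lemma dilate_seminorm_triangle:
  assumes "u \<in> O_b" "v \<in> O_b" "w \<in> O_b" and r: "r \<in> {0<..<1}"
  shows "dilate_seminorm r (\<lambda>s. u s - w s) \<le> dilate_seminorm r (\<lambda>s. u s - v s) + dilate_seminorm r (\<lambda>s. v s - w s)"
proof -
  let ?a = "dirichlet_coeffs u" and ?b = "dirichlet_coeffs v" and ?c = "dirichlet_coeffs w"
  have "mult_bound (dilate_seminorm r (\<lambda>s. u s - v s) + dilate_seminorm r (\<lambda>s. v s - w s))
     (\<lambda>n. of_real r ^ bigomega n * dirichlet_coeffs (\<lambda>s. u s - v s) n + of_real r ^ bigomega n * dirichlet_coeffs (\<lambda>s. v s - w s) n)"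
    by (intro mult_bound_add O_b_mult_bound O_b_diff assms)
  then have "mult_bound (dilate_seminorm r (\<lambda>s. u s - v s) + dilate_seminorm r (\<lambda>s. v s - w s))
     (\<lambda>n. of_real r ^ bigomega n * dirichlet_coeffs (\<lambda>s. u s - w s) n)"
    by (simp add: coeffs_diff assms algebra_simps)
  then show ?thesis
    unfolding dilate_seminorm_def[of r "\<lambda>s. u s - w s"]
    by (rule sup_norm_le[OF dseries_dilate[OF O_b_coeffs[OF O_b_diff[OF assms(1,3)]] r]])
qed

lemma l1_norm_triangle:
  assumes "u \<in> Wiener_Dirichlet" "v \<in> Wiener_Dirichlet" "w \<in> Wiener_Dirichlet"
  shows "l1_norm (\<lambda>s. u s - w s) \<le> l1_norm (\<lambda>s. u s - v s) + l1_norm (\<lambda>s. v s - w s)"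
proof -
  have sm: "summable (\<lambda>n. norm (dirichlet_coeffs f n))" if "f \<in> Wiener_Dirichlet" for f
    using that dirichlet_coeffs_eq by (auto simp: Wiener_iff)
  have ob: "f \<in> O_b" if "f \<in> Wiener_Dirichlet" for f
    using that Wiener_subset_H_inf H_inf_subset_O_b by blast
  have "l1_norm (\<lambda>s. u s - w s) \<le> (\<Sum>n. norm (dirichlet_coeffs (\<lambda>s. u s - v s) n) + norm (dirichlet_coeffs (\<lambda>s. v s - w s) n))"
    unfolding l1_norm_def
  proof (rule suminf_le)
    show "norm (dirichlet_coeffs (\<lambda>s. u s - w s) n) \<le> norm (dirichlet_coeffs (\<lambda>s. u s - v s) n) + norm (dirichlet_coeffs (\<lambda>s. v s - w s) n)" for n
      using norm_triangle_ineq[of "dirichlet_coeffs u n - dirichlet_coeffs v n" "dirichlet_coeffs v n - dirichlet_coeffs w n"]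
      by (simp add: coeffs_diff ob assms)
  qed (intro summable_add sm Wiener_diff assms)+
  also have "\<dots> = l1_norm (\<lambda>s. u s - v s) + l1_norm (\<lambda>s. v s - w s)"
    unfolding l1_norm_def by (intro suminf_add[symmetric] sm Wiener_diff assms)
  finally show ?thesis .
qed

lemma dseries_zero: "has_dirichlet_series (\<lambda>s. 0) (\<lambda>n. 0)"
  by (simp add: has_dirichlet_series_def formal_dirichlet_series_def uniform_limit_const)

lemma mult_bound_zero: "mult_bound 0 (\<lambda>n. 0)"
  by (rule mult_boundI) simp

lemma sup_norm_zero: "sup_norm (\<lambda>s. 0) = 0"
  unfolding sup_norm_def using one_in_right_half_plane by (subst norm_zero, subst cSUP_const) auto

lemma dilate_zero: "dilate r (\<lambda>s. 0) = (\<lambda>s. 0)"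
  by (simp add: dilate_def dirichlet_coeffs_eq[OF dseries_zero] dirichlet_function_def fun_eq_iff)

lemma l1_norm_zero: "l1_norm (\<lambda>s. 0) = 0"
  by (simp add: l1_norm_def dirichlet_coeffs_eq[OF dseries_zero])

section \<open>Topologies generated by seminorms\<close>

lemma seminorm_ball_open:
  "f \<in> X \<Longrightarrow> q \<in> Q \<Longrightarrow> e > 0 \<Longrightarrow> openin (seminorm_topology X Q) {g \<in> X. q (\<lambda>s. g s - f s) < e}"
  unfolding seminorm_topology_def by (rule topology_generated_by_Basis) blast

lemma topspace_seminorm_topology:
  assumes "Q \<noteq> {}" "\<And>q. q \<in> Q \<Longrightarrow> q (\<lambda>s. 0) = 0"
  shows "topspace (seminorm_topology X Q) = X"
proof -
  obtain q where q: "q \<in> Q" using assms(1) by blast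
  have "f \<in> \<Union> {{g \<in> X. q (\<lambda>s. g s - f s) < e} | f q e. f \<in> X \<and> q \<in> Q \<and> e > 0}" if f: "f \<in> X" for f
  proof (rule UnionI)
    show "{g \<in> X. q (\<lambda>s. g s - f s) < 1} \<in> {{g \<in> X. q (\<lambda>s. g s - f s) < e} | f q e. f \<in> X \<and> q \<in> Q \<and> e > 0}"
      using f q by (intro CollectI exI[of _ f] exI[of _ q] exI[of _ 1]) auto
  qed (use f assms(2)[OF q] in simp)
  then show ?thesis unfolding seminorm_topology_def topology_generated_by_topspace by blast
qed

text \<open>The preimage of a subbasic ball contains a ball of the same seminorm around each of its points.\<close>
lemma seminorm_contraction_continuous:
  assumes Q: "Q \<noteq> {}" "\<And>q. q \<in> Q \<Longrightarrow> q (\<lambda>s. 0) = 0"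
    and tri: "\<And>q u v w. q \<in> Q \<Longrightarrow> u \<in> X \<Longrightarrow> v \<in> X \<Longrightarrow> w \<in> X \<Longrightarrow>
       q (\<lambda>s. u s - w s) \<le> q (\<lambda>s. u s - v s) + q (\<lambda>s. v s - w s)"
    and T: "\<And>f. f \<in> X \<Longrightarrow> T f \<in> X"
    and con: "\<And>q u v. q \<in> Q \<Longrightarrow> u \<in> X \<Longrightarrow> v \<in> X \<Longrightarrow> q (\<lambda>s. T u s - T v s) \<le> q (\<lambda>s. u s - v s)"
  shows "continuous_map (seminorm_topology X Q) (seminorm_topology X Q) T"
proof -
  have top: "topspace (seminorm_topology X Q) = X"
    using Q by (intro topspace_seminorm_topology)
  have "continuous_map (seminorm_topology X Q)
    (topology_generated_by {{g \<in> X. q (\<lambda>s. g s - f s) < e} | f q e. f \<in> X \<and> q \<in> Q \<and> e > 0}) T"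
proof (rule continuous_on_generated_topo)
  fix U assume "U \<in> {{g \<in> X. q (\<lambda>s. g s - f s) < e} | f q e. f \<in> X \<and> q \<in> Q \<and> e > 0}"
  then obtain f q e where U: "U = {g \<in> X. q (\<lambda>s. g s - f s) < e}" and f: "f \<in> X" "q \<in> Q" by blast
  show "openin (seminorm_topology X Q) (T -` U \<inter> topspace (seminorm_topology X Q))"
  proof (subst openin_subopen, intro ballI)
    fix x assume "x \<in> T -` U \<inter> topspace (seminorm_topology X Q)"
    then have x: "x \<in> X" "q (\<lambda>s. T x s - f s) < e"
      unfolding top by (auto simp: U)
    define d where "d = e - q (\<lambda>s. T x s - f s)"
    have d: "d > 0" using x by (simp add: d_def)
    let ?B = "{g \<in> X. q (\<lambda>s. g s - x s) < d}"
    have "q (\<lambda>s. T g s - f s) < e" if "g \<in> ?B" for g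
      using tri[OF f(2) T[of g] T[OF x(1)] f(1)] con[OF f(2), of g x] that x(1) by (auto simp: d_def)
    then have "?B \<subseteq> T -` U \<inter> topspace (seminorm_topology X Q)"
      unfolding top U using T by auto
    moreover have "x \<in> ?B" using x d Q(2)[of q, OF f(2)] by simp
    ultimately show "\<exists>B. openin (seminorm_topology X Q) B \<and> x \<in> B \<and> B \<subseteq> T -` U \<inter> topspace (seminorm_topology X Q)"
      using seminorm_ball_open[OF x(1) f(2) d] by blast
  qed
next
  show "T ` topspace (seminorm_topology X Q) \<subseteq> \<Union> {{g \<in> X. q (\<lambda>s. g s - f s) < e} | f q e. f \<in> X \<and> q \<in> Q \<and> e > 0}"
    unfolding topology_generated_by_topspace[symmetric] seminorm_topology_def[symmetric]
      top using T by auto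
qed
  then show ?thesis by (simp only: seminorm_topology_def)
qed

lemma topspace_H_inf: "topspace (seminorm_topology H_inf {sup_norm}) = H_inf"
  by (intro topspace_seminorm_topology) (auto simp: sup_norm_zero)

lemma A_alg_subset_H_inf: "A_alg \<subseteq> H_inf"
  using closure_of_subset_topspace[of "seminorm_topology H_inf {sup_norm}"] by (simp add: A_alg_def topspace_H_inf)

lemma Wiener_subset_A_alg: "Wiener_Dirichlet \<subseteq> A_alg"
  unfolding A_alg_def by (rule closure_of_subset) (simp add: topspace_H_inf Wiener_subset_H_inf)

lemma elems_subset_O_b: "elems \<AA> \<subseteq> O_b"
  using Wiener_subset_H_inf H_inf_subset_O_b A_alg_subset_H_inf by (cases \<AA>) auto

lemma seminorms_zero: "q \<in> seminorms \<AA> \<Longrightarrow> q (\<lambda>s. 0) = 0"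
  by (cases \<AA>) (auto simp: sup_norm_zero l1_norm_zero dilate_seminorm_def dilate_zero)

lemma seminorms_nonempty: "seminorms \<AA> \<noteq> {}"
  by (cases \<AA>) auto

lemma seminorms_triangle:
  assumes "q \<in> seminorms \<AA>" "u \<in> elems \<AA>" "v \<in> elems \<AA>" "w \<in> elems \<AA>"
  shows "q (\<lambda>s. u s - w s) \<le> q (\<lambda>s. u s - v s) + q (\<lambda>s. v s - w s)"
  using assms A_alg_subset_H_inf
  by (cases \<AA>) (auto intro!: dilate_seminorm_triangle l1_norm_triangle sup_norm_triangle)

section \<open>The unit\<close>

lemma dseries_one: "has_dirichlet_series one_fun (\<lambda>n. if n = 1 then 1 else 0)"
proof -
  let ?d = "\<lambda>n::nat. if n = 1 then 1 else (0::complex)"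
  have "summable (\<lambda>n. norm (?d n))" by (rule summable_finite[of "{1}"]) auto
  then have "has_dirichlet_series (dirichlet_function ?d) ?d"
    by (rule dseries_of_mult_bounded[OF mult_bound_imp_locally[OF mult_bound_absolutely_summable]]) simp
  moreover have "(\<Sum>n. ?d n * of_nat n powr (- s)) = 1" for s :: complex
  proof -
    have "(\<Sum>n. ?d n * of_nat n powr (- s)) = (\<Sum>n\<in>{1}. ?d n * of_nat n powr (- s))"
      by (rule suminf_finite) auto
    then show ?thesis by simp
  qed
  then have "dirichlet_function ?d = one_fun"
    by (simp add: dirichlet_function_def one_fun_def fun_eq_iff)
  ultimately show ?thesis by simp
qed

lemma one_Wiener: "one_fun \<in> Wiener_Dirichlet"
  unfolding Wiener_iff by (intro exI conjI, rule dseries_one, rule summable_finite[of "{1}"]) auto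

lemma one_elems: "one_fun \<in> elems \<AA>"
  using one_Wiener Wiener_subset_A_alg A_alg_subset_H_inf H_inf_subset_O_b by (cases \<AA>) auto

lemma sup_norm_one: "sup_norm one_fun = 1"
proof -
  have "sup_norm one_fun = (SUP s\<in>right_half_plane. 1)"
    unfolding sup_norm_def by (intro SUP_cong) (auto simp: one_fun_def)
  also have "\<dots> = 1" using one_in_right_half_plane by (intro cSUP_const) auto
  finally show ?thesis .
qed

lemma l1_norm_one: "l1_norm one_fun = 1"
proof -
  have "l1_norm one_fun = (\<Sum>n\<in>{1::nat}. norm (if n = 1 then 1 else (0::complex)))"
    unfolding l1_norm_def dirichlet_coeffs_eq[OF dseries_one] by (rule suminf_finite) auto
  then show ?thesis by simp
qed

lemma operator_norm_eq_oneI: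
  assumes con: "\<And>f. f \<in> X \<Longrightarrow> q (T f) \<le> q f" and nonneg: "\<And>f. f \<in> X \<Longrightarrow> q f \<ge> 0"
    and one: "one_fun \<in> X" "T one_fun = one_fun" "q one_fun = 1"
  shows "operator_norm_eq_one X q T"
proof -
  have le: "q (T f) / q f \<le> 1" if "f \<in> X" for f
    using con[OF that] nonneg[OF that] by (cases "q f = 0") (auto simp: divide_le_eq_1)
  have bdd: "bdd_above ((\<lambda>f. q (T f) / q f) ` X)" using le by (auto simp: bdd_above_def)
  moreover have "(SUP f\<in>X. q (T f) / q f) = 1"
  proof (rule antisym)
    show "(SUP f\<in>X. q (T f) / q f) \<le> 1" using one le by (intro cSUP_least) auto
    show "1 \<le> (SUP f\<in>X. q (T f) / q f)" using cSUP_upper[OF one(1) bdd] one by simp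
  qed
  ultimately show ?thesis by (simp add: operator_norm_eq_one_def)
qed

lemma sup_norm_nonneg: "f \<in> H_inf \<Longrightarrow> sup_norm f \<ge> 0"
  using mult_bound_nonneg[OF H_inf_mult_bound] .

section \<open>The projection\<close>

context permutation_group
begin

text \<open>Permuting primes preserves the number of prime factors, so the projection commutes with dilations.\<close>
lemma omega_average:
  "of_real r ^ bigomega n * average a n = average (\<lambda>n. of_real r ^ bigomega n * a n) n"
proof (cases "n \<in> finitary")
  case True
  have "bigomega k = bigomega n" if "k \<in> orbit n" for k
    using that bigomega_perm_hat[OF G_Bij] finitary_pos[OF True] by (auto simp: orbit_def)
  then show ?thesis using True by (simp add: average_def sum_distrib_left cong: sum.cong)
qed (simp add: average_def)

lemma average_0: "average a 0 = 0"
  using finitary_pos by (auto simp: average_def)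

lemma average_dilation_bound:
  assumes "f \<in> O_b" "r \<in> {0<..<1}"
  shows "mult_bound (dilate_seminorm r f) (\<lambda>n. of_real r ^ bigomega n * average (dirichlet_coeffs f) n)"
  unfolding omega_average by (intro mult_bound_orbit_average O_b_mult_bound assms)

text \<open>The partial sums of the projected series are not projections of partial sums, because permuting primes destroys the
  order of the summation. Convergence comes from the multiplier bounds of all dilations instead.\<close>
lemma dseries_proj:
  assumes "f \<in> O_b"
  shows "has_dirichlet_series (proj G f) (average (dirichlet_coeffs f))"
  unfolding proj_def proj_series_eq
  using average_dilation_bound[OF assms]
  by (intro dseries_of_mult_bounded locally_mult_bounded_of_dilations) (auto simp: average_0)

lemma coeffs_proj: "f \<in> O_b \<Longrightarrow> dirichlet_coeffs (proj G f) = average (dirichlet_coeffs f)"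
  by (rule dirichlet_coeffs_eq[OF dseries_proj])

lemma proj_eqI:
  assumes "f \<in> O_b" "has_dirichlet_series g (average (dirichlet_coeffs f))"
  shows "proj G f = g"
  using dseries_proj[OF assms(1)] assms(2) dseries_eq_dirichlet_function by metis

lemma average_add: "average (\<lambda>n. a n + b n) = (\<lambda>n. average a n + average b n)"
  by (auto simp: average_def fun_eq_iff sum.distrib add_divide_distrib)

lemma average_cmult: "average (\<lambda>n. c * a n) = (\<lambda>n. c * average a n)"
  by (auto simp: average_def fun_eq_iff simp flip: sum_distrib_left)

lemma proj_add:
  assumes "f \<in> O_b" "g \<in> O_b"
  shows "proj G (\<lambda>s. f s + g s) = (\<lambda>s. proj G f s + proj G g s)"
proof -
  have "dirichlet_coeffs (\<lambda>s. f s + g s) = (\<lambda>n. dirichlet_coeffs f n + dirichlet_coeffs g n)"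
    by (intro dirichlet_coeffs_eq dseries_add O_b_coeffs assms)
  then show ?thesis
    unfolding proj_def[of G "\<lambda>s. f s + g s"] proj_series_eq
    using dseries_add[OF dseries_proj dseries_proj, OF assms]
    by (simp add: average_add dseries_eq_dirichlet_function[symmetric])
qed

lemma proj_cmult:
  assumes "f \<in> O_b"
  shows "proj G (\<lambda>s. c * f s) = (\<lambda>s. c * proj G f s)"
proof -
  have "dirichlet_coeffs (\<lambda>s. c * f s) = (\<lambda>n. c * dirichlet_coeffs f n)"
    by (intro dirichlet_coeffs_eq dseries_cmult O_b_coeffs assms)
  then show ?thesis
    unfolding proj_def[of G "\<lambda>s. c * f s"] proj_series_eq
    using dseries_cmult[OF dseries_proj, OF assms]
    by (simp add: average_cmult dseries_eq_dirichlet_function[symmetric])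
qed

lemma proj_diff:
  assumes "f \<in> O_b" "g \<in> O_b"
  shows "proj G (\<lambda>s. f s - g s) = (\<lambda>s. proj G f s - proj G g s)"
proof (rule proj_eqI)
  show "has_dirichlet_series (\<lambda>s. proj G f s - proj G g s) (average (dirichlet_coeffs (\<lambda>s. f s - g s)))"
    using dseries_diff[OF dseries_proj dseries_proj, OF assms]
      average_add[of "dirichlet_coeffs f" "\<lambda>n. (-1) * dirichlet_coeffs g n"] average_cmult[of "-1" "dirichlet_coeffs g"]
    by (simp add: coeffs_diff assms)
qed (rule O_b_diff[OF assms])

lemma proj_O_b:
  assumes "f \<in> O_b"
  shows "proj G f \<in> O_b"
  unfolding O_b_iff using dseries_proj average_dilation_bound assms by blast

lemma dilate_seminorm_proj:
  assumes "f \<in> O_b" "r \<in> {0<..<1}"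
  shows "dilate_seminorm r (proj G f) \<le> dilate_seminorm r f"
  unfolding dilate_seminorm_def[of r "proj G f"]
  by (rule sup_norm_le[OF dseries_dilate[OF dseries_proj]])
     (use assms average_dilation_bound in auto)

lemma proj_H_inf_bound: "f \<in> H_inf \<Longrightarrow> mult_bound (sup_norm f) (average (dirichlet_coeffs f))"
  by (intro mult_bound_orbit_average H_inf_mult_bound)

lemma proj_H_inf: "f \<in> H_inf \<Longrightarrow> proj G f \<in> H_inf"
  unfolding H_inf_iff[of "proj G f"] using dseries_proj proj_H_inf_bound H_inf_subset_O_b by blast

lemma sup_norm_proj: "f \<in> H_inf \<Longrightarrow> sup_norm (proj G f) \<le> sup_norm f"
  using sup_norm_le dseries_proj proj_H_inf_bound H_inf_subset_O_b by blast

lemma Wiener_summable: "f \<in> Wiener_Dirichlet \<Longrightarrow> summable (\<lambda>n. norm (dirichlet_coeffs f n))"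
  using dirichlet_coeffs_eq by (auto simp: Wiener_iff)

lemma l1_norm_nonneg: "f \<in> Wiener_Dirichlet \<Longrightarrow> l1_norm f \<ge> 0"
  unfolding l1_norm_def by (intro suminf_nonneg Wiener_summable) auto

lemma proj_Wiener:
  assumes "f \<in> Wiener_Dirichlet"
  shows "proj G f \<in> Wiener_Dirichlet" "l1_norm (proj G f) \<le> l1_norm f"
proof -
  have "f \<in> O_b" using assms Wiener_subset_H_inf H_inf_subset_O_b by blast
  then show "proj G f \<in> Wiener_Dirichlet" "l1_norm (proj G f) \<le> l1_norm f"
    using dseries_proj average_norm_sum[OF Wiener_summable[OF assms]]
    by (auto simp: Wiener_iff l1_norm_def coeffs_proj)
qed

lemma sup_norm_proj_diff:
  assumes "f \<in> H_inf" "g \<in> H_inf"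
  shows "sup_norm (\<lambda>s. proj G f s - proj G g s) \<le> sup_norm (\<lambda>s. f s - g s)"
proof -
  have "(\<lambda>s. proj G f s - proj G g s) = proj G (\<lambda>s. f s - g s)"
    using assms H_inf_subset_O_b by (intro proj_diff[symmetric]) auto
  then show ?thesis using sup_norm_proj[OF H_inf_diff[OF assms]] by (simp only:)
qed

text \<open>The projection is continuous on \<open>H_inf\<close> and maps \<open>Wiener_Dirichlet\<close> to itself, hence also
  its closure.\<close>
lemma proj_A_alg: "f \<in> A_alg \<Longrightarrow> proj G f \<in> A_alg"
proof -
  let ?T = "seminorm_topology H_inf {sup_norm}"
  have "continuous_map ?T ?T (proj G)"
    by (rule seminorm_contraction_continuous) (auto simp: sup_norm_zero intro: sup_norm_triangle proj_H_inf sup_norm_proj_diff)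
  from continuous_map_image_closure_subset[OF this, of Wiener_Dirichlet]
  have "proj G ` A_alg \<subseteq> ?T closure_of (proj G ` Wiener_Dirichlet)" by (simp add: A_alg_def)
  also have "\<dots> \<subseteq> A_alg" unfolding A_alg_def by (intro closure_of_mono) (auto intro: proj_Wiener)
  finally show "f \<in> A_alg \<Longrightarrow> proj G f \<in> A_alg" by blast
qed

lemma proj_elems: "f \<in> elems \<AA> \<Longrightarrow> proj G f \<in> elems \<AA>"
  by (cases \<AA>) (auto intro: proj_O_b proj_Wiener proj_A_alg proj_H_inf)

lemma proj_one: "proj G one_fun = one_fun"
proof (rule proj_eqI)
  show "one_fun \<in> O_b" using one_elems[of Alg_O_b] by simp
  let ?d = "\<lambda>n::nat. if n = 1 then 1 else (0::complex)"
  have "average ?d = ?d"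
  proof
    fix n
    show "average ?d n = ?d n"
    proof (cases "n \<in> finitary")
      case True
      have "h n = 1 \<longleftrightarrow> n = 1" if "h \<in> perm_hat ` G" "n > 0" for h n
        using map_one[OF that(1)] map_inj[OF that(1), of n 1] that(2) by auto
      then show ?thesis using True by (intro average_of_invariant) auto
    next
      case False
      then show ?thesis using one_finitary by (auto simp: average_def)
    qed
  qed
  then show "has_dirichlet_series one_fun (average (dirichlet_coeffs one_fun))"
    using dseries_one by (simp add: dirichlet_coeffs_eq[OF dseries_one])
qed

text \<open>The coefficients of \<open>f\<close> itself need not be square summable when \<open>f\<close> lies in
  \<open>O_b\<close>, but those of its dilation at \<open>r = 1/2\<close> are, and they are still invariant.\<close>
lemma invariant_coeffs:
  assumes "f \<in> invariant_elems \<AA> G"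
  shows "h \<in> perm_hat ` G \<Longrightarrow> n > 0 \<Longrightarrow> dirichlet_coeffs f (h n) = dirichlet_coeffs f n"
    and "n > 0 \<Longrightarrow> n \<notin> finitary \<Longrightarrow> dirichlet_coeffs f n = 0"
proof -
  let ?a = "dirichlet_coeffs f"
  have f: "f \<in> O_b" using assms elems_subset_O_b by (auto simp: invariant_elems_def)
  have inv: "\<forall>h\<in>perm_hat ` G. \<forall>n>0. ?a (h n) = ?a n"
    using assms perm_series_invariant_iff[of ?a, OF dseries_coeff0[of f, OF O_b_coeffs[OF f]]]
    by (simp add: invariant_elems_def)
  then show "h \<in> perm_hat ` G \<Longrightarrow> n > 0 \<Longrightarrow> ?a (h n) = ?a n" for h n by blast
  assume n: "n > 0" "n \<notin> finitary"
  have "of_real (1/2) ^ bigomega n * ?a n = (0 :: complex)"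
  proof (rule invariant_vanishes[OF _ O_b_mult_bound[OF f] n])
    fix h m assume hm: "h \<in> perm_hat ` G" "m > (0::nat)"
    then have "bigomega (h m) = bigomega m" using bigomega_perm_hat[OF G_Bij] by auto
    then show "of_real (1/2) ^ bigomega (h m) * ?a (h m) = of_real (1/2) ^ bigomega m * ?a m"
      using inv[rule_format, OF hm] by simp
  qed simp
  then show "?a n = 0" by simp
qed

lemma average_invariant_coeffs:
  assumes "f \<in> invariant_elems \<AA> G"
  shows "average (dirichlet_coeffs f) = dirichlet_coeffs f"
proof
  fix n
  have f: "f \<in> O_b" using assms elems_subset_O_b by (auto simp: invariant_elems_def)
  show "average (dirichlet_coeffs f) n = dirichlet_coeffs f n"
  proof (cases "n \<in> finitary")
    case True
    then show ?thesis using invariant_coeffs(1)[OF assms] by (intro average_of_invariant)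
  next
    case False
    then show ?thesis
      using invariant_coeffs(2)[OF assms, of n] dseries_coeff0[OF O_b_coeffs[OF f]]
      by (cases "n = 0") (auto simp: average_def)
  qed
qed

lemma proj_invariant:
  assumes "f \<in> invariant_elems \<AA> G"
  shows "proj G f = f"
proof (rule proj_eqI)
  show f: "f \<in> O_b" using assms elems_subset_O_b by (auto simp: invariant_elems_def)
  show "has_dirichlet_series f (average (dirichlet_coeffs f))"
    unfolding average_invariant_coeffs[OF assms] by (rule O_b_coeffs[OF f])
qed

lemma proj_in_invariant_elems:
  assumes "f \<in> elems \<AA>"
  shows "proj G f \<in> invariant_elems \<AA> G"
proof -
  have f: "f \<in> O_b" using assms elems_subset_O_b by blast
  show ?thesis
    using perm_series_invariant_iff[of "average (dirichlet_coeffs f)"] average_map average_0 proj_elems[OF assms]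
    by (simp add: invariant_elems_def coeffs_proj[OF f])
qed

lemma proj_image: "proj G ` elems \<AA> = invariant_elems \<AA> G"
proof
  show "proj G ` elems \<AA> \<subseteq> invariant_elems \<AA> G" using proj_in_invariant_elems by blast
  show "invariant_elems \<AA> G \<subseteq> proj G ` elems \<AA>"
  proof
    fix f assume "f \<in> invariant_elems \<AA> G"
    then show "f \<in> proj G ` elems \<AA>"
      using proj_invariant[of f \<AA>] by (intro image_eqI[of _ _ f]) (auto simp: invariant_elems_def)
  qed
qed

lemma proj_mult:
  assumes f: "f \<in> invariant_elems \<AA> G" and g: "g \<in> elems \<AA>"
  shows "proj G (\<lambda>s. f s * g s) = (\<lambda>s. f s * proj G g s)"
proof -
  have fb: "f \<in> O_b" using f elems_subset_O_b by (auto simp: invariant_elems_def)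
  have gb: "g \<in> O_b" using g elems_subset_O_b by blast
  have "dirichlet_coeffs (\<lambda>s. f s * g s) = dirichlet_conv (dirichlet_coeffs f) (dirichlet_coeffs g)"
    by (intro dirichlet_coeffs_eq dseries_product O_b_coeffs fb gb)
  then have "proj G (\<lambda>s. f s * g s)
     = dirichlet_function (dirichlet_conv (dirichlet_coeffs f) (average (dirichlet_coeffs g)))"
    unfolding proj_def proj_series_eq using invariant_coeffs[OF f] by (simp add: average_conv)
  also have "\<dots> = (\<lambda>s. f s * proj G g s)"
    by (intro dseries_eq_dirichlet_function[symmetric] dseries_product
        O_b_coeffs[OF fb] dseries_proj[OF gb])
  finally show ?thesis .
qed

lemma proj_continuous: "continuous_map (alg_topology \<AA>) (alg_topology \<AA>) (proj G)"
  unfolding alg_topology_def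
proof (rule seminorm_contraction_continuous)
  show "seminorms \<AA> \<noteq> {}" by (rule seminorms_nonempty)
  show "q (\<lambda>s. 0) = 0" if "q \<in> seminorms \<AA>" for q using that by (rule seminorms_zero)
  show "q (\<lambda>s. u s - w s) \<le> q (\<lambda>s. u s - v s) + q (\<lambda>s. v s - w s)"
    if "q \<in> seminorms \<AA>" "u \<in> elems \<AA>" "v \<in> elems \<AA>" "w \<in> elems \<AA>" for q u v w
    using that by (rule seminorms_triangle)
  show "proj G f \<in> elems \<AA>" if "f \<in> elems \<AA>" for f using that by (rule proj_elems)
  fix q u v assume *: "q \<in> seminorms \<AA>" "u \<in> elems \<AA>" "v \<in> elems \<AA>"
  then have "(\<lambda>s. proj G u s - proj G v s) = proj G (\<lambda>s. u s - v s)"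
    using proj_diff elems_subset_O_b by (metis subsetD)
  then show "q (\<lambda>s. proj G u s - proj G v s) \<le> q (\<lambda>s. u s - v s)"
    using * A_alg_subset_H_inf
    by (cases \<AA>) (auto intro!: dilate_seminorm_proj proj_Wiener sup_norm_proj O_b_diff Wiener_diff H_inf_diff)
qed

lemma proj_has_norm_one: "has_norm_one \<AA> (proj G)"
proof (cases \<AA>)
  case Alg_O_b
  then show ?thesis using dilate_seminorm_proj proj_one by simp
next
  case Alg_W
  then show ?thesis
    using proj_Wiener one_Wiener l1_norm_nonneg
    by (auto intro!: operator_norm_eq_oneI proj_one l1_norm_one)
next
  case Alg_A
  then show ?thesis
    using sup_norm_proj one_elems[of Alg_A] A_alg_subset_H_inf sup_norm_nonneg
    by (auto intro!: operator_norm_eq_oneI proj_one sup_norm_one)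
next
  case Alg_H_inf
  then show ?thesis
    using sup_norm_proj one_elems[of Alg_H_inf] sup_norm_nonneg
    by (auto intro!: operator_norm_eq_oneI proj_one sup_norm_one)
qed

lemma proj_series_of: "proj_series G ` series_of \<AA> \<subseteq> series_of \<AA>"
proof
  fix b assume "b \<in> proj_series G ` series_of \<AA>"
  then obtain f a where fa: "f \<in> elems \<AA>" "has_dirichlet_series f a" "b = average a"
    by (auto simp: series_of_def proj_series_eq)
  then have "has_dirichlet_series (proj G f) b"
    using dseries_proj[of f] elems_subset_O_b dirichlet_coeffs_eq[OF fa(2)] by auto
  then show "b \<in> series_of \<AA>" using proj_elems[OF fa(1)] by (auto simp: series_of_def)
qed

end

theorem theorem2p8:
  fixes G :: "(nat \<Rightarrow> nat) set" and \<AA> :: dirichlet_algebra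
  assumes "subgroup G (BijGroup {1..})"
  shows
    "proj_series G ` series_of \<AA> \<subseteq> series_of \<AA> \<and>
     (\<forall>f\<in>elems \<AA>. proj G f \<in> elems \<AA>) \<and>
     continuous_map (alg_topology \<AA>) (alg_topology \<AA>) (proj G) \<and>
     (\<forall>f\<in>elems \<AA>. \<forall>g\<in>elems \<AA>. proj G (\<lambda>s. f s + g s) = (\<lambda>s. proj G f s + proj G g s)) \<and>
     (\<forall>c. \<forall>f\<in>elems \<AA>. proj G (\<lambda>s. c * f s) = (\<lambda>s. c * proj G f s)) \<and>
     (\<forall>f\<in>elems \<AA>. proj G (proj G f) = proj G f) \<and>
     proj G ` elems \<AA> = invariant_elems \<AA> G \<and>
     has_norm_one \<AA> (proj G) \<and>
     (\<forall>f\<in>invariant_elems \<AA> G. \<forall>g\<in>elems \<AA>.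
        proj G (\<lambda>s. f s * g s) = (\<lambda>s. f s * proj G g s))"
proof -
  interpret permutation_group G by (rule permutation_group.intro) (rule assms)
  show ?thesis
    using elems_subset_O_b[of \<AA>]
    by (intro conjI ballI allI proj_series_of proj_elems proj_continuous proj_add proj_cmult
          proj_invariant[OF proj_in_invariant_elems] proj_image proj_has_norm_one proj_mult) auto
qed

end
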